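(* Suppose that $\mathbb{P}^{\alpha,y}(T_A<\infty)=1$ for all $y\in S_Y$. Then $Y=(N,\Lambda)$ is Harris recurrent with unique (up to scaling) invariant measure given by $$\Pi(B)=\mathbb{E}^{\alpha,y^*}\int_0^{T_A}\mathbf{1}_B(Y_t)\,dt,\qquad B\in\mathcal{S}_Y,$$ where $y^*=(0,\lambda^o)$. Moreover, $\Pi$ is finite if and only if $\mathbb{E}^{\alpha,y^*}[T_A]<\infty$.
   Context: Constants: $\alpha\ge 0$, $\beta>0$, $A\in(\beta,\infty)$, $\lambda^o\in(0,\beta]$. $(Z_i)_{i\ge1}$ are i.i.d. $[0,\infty)$-valued random variables with distribution function $G$ and finite second moment. $\ell(n,z)$ ($n\ge1$, $z\ge0$) is a strictly positive function such that, for each $n$, $z\mapsto\ell(n,z)$ is non-decreasing and continuous. $Y=(N,\Lambda)$ is the (first two components of the) self-exciting piecewise-deterministic Markov process with resetting: the right-continuous Markov process on $S_Y=(\mathbb{N}\cup\{0\})\times[\lambda^o,A)$ (with $\sigma$-algebra $\mathcal{S}_Y$) such that between jumps $d\Lambda_t=\alpha(\beta-\Lambda_t)dt$ and $N$ is constant; jumps occur at rate $\Lambda$; at a jump, with mark $Z$ freshly drawn from $G$, $(N,\Lambda)$ moves from $(n,\lambda)$ to $(n+1,\lambda+\ell(n+1,Z))$ if $\lambda+\ell(n+1,Z)<A$, and to $(0,\lambda^o)$ (a reset) otherwise. $T_A$ is the time of the first reset (equivalently, the first time the intensity without resetting, started from the same point, enters $[A,\infty)$). $\mathbb{P}^{\alpha,y}$,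 $\mathbb{E}^{\alpha,y}$ are law and expectation when $Y_0=y$. $Y$ is Harris recurrent if there is a nonzero $\sigma$-finite measure $\mu$ on $(S_Y,\mathcal{S}_Y)$ such that, for every $B$ with $\mu(B)>0$, $\int_0^\infty\mathbf{1}_B(Y_t)dt=\infty$ $\mathbb{P}^{\alpha,y}$-a.s. for all $y\in S_Y$. A measure is invariant if it is preserved by the transition semigroup of $Y$. *)

theory Defs
  imports "HOL-Probability.Probability"
begin

section \<open>The self-exciting process with resetting\<close>

text \<open>
  The process is built by the standard construction of a piecewise-deterministic Markov process
  from its flow, jump rate and jump kernel.  The randomness consists of an i.i.d. sequence
  \<open>E 1, E 2, ...\<close> of unit exponential variables and, independently, the i.i.d. marks
  \<open>Z 1, Z 2, ...\<close>: the \<open>k\<close>-th jump occurs when the rate accumulated since the previous jump reaches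
  \<open>E k\<close>, and uses the mark \<open>Z k\<close>.  The law and the expectation for the starting point \<open>y\<close> are
  those of the constructed process started at \<open>y\<close>.

  A state is a pair \<open>(n, x)\<close> of the number of jumps since the last reset and the intensity.
\<close>

type_synonym state = "nat \<times> real"

definition state_space :: "real \<Rightarrow> real \<Rightarrow> state measure" where
  "state_space lam0 A = count_space UNIV \<Otimes>\<^sub>M restrict_space borel {lam0..<A}"

definition intensity :: "real \<Rightarrow> real \<Rightarrow> real \<Rightarrow> real \<Rightarrow> real" where
  "intensity \<alpha> \<beta> x t = \<beta> + (x - \<beta>) * exp (- \<alpha> * t)"

lemma intensity_ode:
  "intensity \<alpha> \<beta> x 0 = x"
  "(intensity \<alpha> \<beta> x has_real_derivative \<alpha> * (\<beta> - intensity \<alpha> \<beta> x t)) (at t)"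
  unfolding intensity_def by (auto intro!: derivative_eq_intros simp: algebra_simps)

definition holding_time :: "real \<Rightarrow> real \<Rightarrow> real \<Rightarrow> real \<Rightarrow> real" where
  "holding_time \<alpha> \<beta> x u = Inf {t. 0 \<le> t \<and> u \<le> integral {0..t} (intensity \<alpha> \<beta> x)}"

definition flow :: "real \<Rightarrow> real \<Rightarrow> state \<Rightarrow> real \<Rightarrow> state" where
  "flow \<alpha> \<beta> y t = (fst y, intensity \<alpha> \<beta> (snd y) t)"

definition exceeds :: "real \<Rightarrow> (nat \<Rightarrow> real \<Rightarrow> real) \<Rightarrow> state \<Rightarrow> real \<Rightarrow> bool" where
  "exceeds A ell y z \<longleftrightarrow> A \<le> snd y + ell (fst y + 1) z"

definition jump :: "real \<Rightarrow> real \<Rightarrow> (nat \<Rightarrow> real \<Rightarrow> real) \<Rightarrow> state \<Rightarrow> real \<Rightarrow> state" where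
  "jump A lam0 ell y z =
     (if exceeds A ell y z then (0, lam0) else (fst y + 1, snd y + ell (fst y + 1) z))"

text \<open>
  Below, \<open>e\<close> and \<open>z\<close> are realisations of the two driving sequences, indexed from 1.
  \<open>post_jump k\<close> is the state right after the \<open>k\<close>-th jump (the starting point for \<open>k = 0\<close>), and
  \<open>pre_jump k\<close> the state right before jump \<open>k + 1\<close>.
\<close>

definition before_jump :: "real \<Rightarrow> real \<Rightarrow> state \<Rightarrow> real \<Rightarrow> state" where
  "before_jump \<alpha> \<beta> y u = flow \<alpha> \<beta> y (holding_time \<alpha> \<beta> (snd y) u)"

primrec post_jump ::
  "real \<Rightarrow> real \<Rightarrow> real \<Rightarrow> real \<Rightarrow> (nat \<Rightarrow> real \<Rightarrow> real) \<Rightarrow>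
   state \<Rightarrow> (nat \<Rightarrow> real) \<Rightarrow> (nat \<Rightarrow> real) \<Rightarrow> nat \<Rightarrow> state" where
  "post_jump \<alpha> \<beta> A lam0 ell y e z 0 = y"
| "post_jump \<alpha> \<beta> A lam0 ell y e z (Suc k) =
     jump A lam0 ell (before_jump \<alpha> \<beta> (post_jump \<alpha> \<beta> A lam0 ell y e z k) (e (Suc k))) (z (Suc k))"

definition pre_jump ::
  "real \<Rightarrow> real \<Rightarrow> real \<Rightarrow> real \<Rightarrow> (nat \<Rightarrow> real \<Rightarrow> real) \<Rightarrow>
   state \<Rightarrow> (nat \<Rightarrow> real) \<Rightarrow> (nat \<Rightarrow> real) \<Rightarrow> nat \<Rightarrow> state" where
  "pre_jump \<alpha> \<beta> A lam0 ell y e z k =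
     before_jump \<alpha> \<beta> (post_jump \<alpha> \<beta> A lam0 ell y e z k) (e (Suc k))"

definition jump_time ::
  "real \<Rightarrow> real \<Rightarrow> real \<Rightarrow> real \<Rightarrow> (nat \<Rightarrow> real \<Rightarrow> real) \<Rightarrow>
   state \<Rightarrow> (nat \<Rightarrow> real) \<Rightarrow> (nat \<Rightarrow> real) \<Rightarrow> nat \<Rightarrow> real" where
  "jump_time \<alpha> \<beta> A lam0 ell y e z k =
     (\<Sum>i<k. holding_time \<alpha> \<beta> (snd (post_jump \<alpha> \<beta> A lam0 ell y e z i)) (e (Suc i)))"

text \<open>
  The least index below exists almost surely: the rate is bounded by \<open>A\<close>, so the jump times tend to
  infinity.
\<close>

definition pdmp_path ::
  "real \<Rightarrow> real \<Rightarrow> real \<Rightarrow> real \<Rightarrow> (nat \<Rightarrow> real \<Rightarrow> real) \<Rightarrow>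
   state \<Rightarrow> (nat \<Rightarrow> real) \<Rightarrow> (nat \<Rightarrow> real) \<Rightarrow> real \<Rightarrow> state" where
  "pdmp_path \<alpha> \<beta> A lam0 ell y e z t =
     (let k = (LEAST k. t < jump_time \<alpha> \<beta> A lam0 ell y e z (Suc k))
      in flow \<alpha> \<beta> (post_jump \<alpha> \<beta> A lam0 ell y e z k) (t - jump_time \<alpha> \<beta> A lam0 ell y e z k))"

text \<open>
  The first reset is \<open>\<infinity>\<close> if there is none.  It is read off the jumps and not off the path, because a
  jump from \<open>(0, lam0)\<close> to \<open>(0, lam0)\<close> leaves no trace in the path.
\<close>

definition first_reset ::
  "real \<Rightarrow> real \<Rightarrow> real \<Rightarrow> real \<Rightarrow> (nat \<Rightarrow> real \<Rightarrow> real) \<Rightarrow>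
   state \<Rightarrow> (nat \<Rightarrow> real) \<Rightarrow> (nat \<Rightarrow> real) \<Rightarrow> ennreal" where
  "first_reset \<alpha> \<beta> A lam0 ell y e z =
     (INF k \<in> {k. exceeds A ell (pre_jump \<alpha> \<beta> A lam0 ell y e z k) (z (Suc k))}.
        ennreal (jump_time \<alpha> \<beta> A lam0 ell y e z (Suc k)))"

text \<open>
  The holding time after reaching intensity \<open>x\<close> has survival function
  \<open>exp (- integral {0..t} (intensity \<alpha> \<beta> x))\<close>, i.e. the jump rate is the current intensity.
\<close>

lemma intensity_lower_bound:
  assumes "\<alpha> \<ge> 0" "t \<ge> 0"
  shows "min x \<beta> \<le> intensity \<alpha> \<beta> x t"
proof -
  define q where "q = exp (- \<alpha> * t)"
  have q: "0 \<le> q" "q \<le> 1" using assms by (auto simp: q_def)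
  have "min x \<beta> = min x \<beta> * (1 - q) + min x \<beta> * q" by (simp add: algebra_simps)
  also have "\<dots> \<le> \<beta> * (1 - q) + x * q"
    using q by (intro add_mono mult_right_mono) auto
  finally show ?thesis by (simp add: intensity_def q_def algebra_simps)
qed

lemma less_holding_time_iff:
  assumes "\<alpha> \<ge> 0" "\<beta> > 0" "x > 0" "t \<ge> 0"
  shows "t < holding_time \<alpha> \<beta> x u \<longleftrightarrow> integral {0..t} (intensity \<alpha> \<beta> x) < u"
proof -
  define H where "H = (\<lambda>t. integral {0..t} (intensity \<alpha> \<beta> x))"
  define m where "m = min x \<beta>"
  have m: "m > 0" using assms by (simp add: m_def)
  have cont: "continuous_on S (intensity \<alpha> \<beta> x)" for S
    unfolding intensity_def by (intro continuous_intros)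
  have incr: "H a + m * (b - a) \<le> H b" if "0 \<le> a" "a \<le> b" for a b
  proof -
    have "H a + integral {a..b} (intensity \<alpha> \<beta> x) = H b"
      unfolding H_def using that
      by (intro Henstock_Kurzweil_Integration.integral_combine integrable_continuous_real cont) auto
    moreover have "m * (b - a) \<le> integral {a..b} (intensity \<alpha> \<beta> x)"
    proof -
      have "integral {a..b} (\<lambda>_. m) \<le> integral {a..b} (intensity \<alpha> \<beta> x)"
        unfolding m_def using that assms(1)
        by (intro integral_le integrable_continuous_real cont continuous_on_const
            intensity_lower_bound) auto
      then show ?thesis using that by (simp add: mult.commute)
    qed
    ultimately show ?thesis by linarith
  qed
  have mono: "H a \<le> H b" if "0 \<le> a" "a \<le> b" for a b
  proof -
    have "0 \<le> m * (b - a)" using m that by simp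
    then show ?thesis using incr[OF that] by linarith
  qed
  have H0: "H 0 = 0" by (simp add: H_def)
  have Hcont: "continuous_on {0..b} H" for b
    unfolding H_def by (intro indefinite_integral_continuous_1 integrable_continuous_real cont)
  let ?S = "{t. 0 \<le> t \<and> u \<le> H t}"
  have bdd: "bdd_below ?S" by (rule bdd_belowI[of _ 0]) auto
  have ne: "?S \<noteq> {}"
  proof -
    have "u \<le> \<bar>u\<bar>" by simp
    also have "\<dots> = H 0 + m * (\<bar>u\<bar> / m - 0)" using m H0 by simp
    also have "\<dots> \<le> H (\<bar>u\<bar> / m)" using m by (intro incr) auto
    finally have "\<bar>u\<bar> / m \<in> ?S" using m by simp
    then show ?thesis by blast
  qed
  have "t < Inf ?S" if "H t < u"
  proof -
    obtain s where s: "0 \<le> s" "u \<le> H s" using ne by auto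
    have "t \<le> s"
    proof (rule ccontr)
      assume "\<not> t \<le> s"
      then have "H s \<le> H t"
        using mono[of s t] s by auto
      then show False using s that by simp
    qed
    define v where "v = (H t + u) / 2"
    have v: "H t < v" "v < u" using that by (auto simp: v_def)
    obtain r where r: "t \<le> r" "r \<le> s" "H r = v"
      using IVT'[of H t v s] \<open>t \<le> s\<close> s v
        continuous_on_subset[OF Hcont[of s], of "{t..s}"] assms(4) by auto
    have "t < r" using r v by (cases "t = r") auto
    moreover have "r \<le> Inf ?S"
    proof (rule cInf_greatest[OF ne])
      fix a assume a: "a \<in> ?S"
      show "r \<le> a"
      proof (rule ccontr)
        assume "\<not> r \<le> a"
        then have "H a \<le> H r"
          using mono[of a r] a by auto
        then show False using a r v by simp
      qed
    qed
    ultimately show ?thesis by linarith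
  qed
  moreover have "H t < u" if "t < Inf ?S"
  proof (rule ccontr)
    assume "\<not> H t < u"
    then have "Inf ?S \<le> t" using assms by (intro cInf_lower bdd) auto
    then show False using that by simp
  qed
  ultimately show ?thesis unfolding holding_time_def H_def by blast
qed

lemma (in prob_space) prob_less_holding_time:
  assumes "\<alpha> \<ge> 0" "\<beta> > 0" "x > 0" "t \<ge> 0"
    and "distributed M lborel X (exponential_density 1)"
  shows "\<P>(\<omega> in M. t < holding_time \<alpha> \<beta> x (X \<omega>)) = exp (- integral {0..t} (intensity \<alpha> \<beta> x))"
proof -
  have "0 \<le> intensity \<alpha> \<beta> x s" if "0 \<le> s" for s
    using intensity_lower_bound[OF assms(1) that, of x \<beta>] assms by auto
  then have "0 \<le> integral {0..t} (intensity \<alpha> \<beta> x)"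
    by (intro Henstock_Kurzweil_Integration.integral_nonneg integrable_continuous_real)
      (auto simp: intensity_def intro!: continuous_intros)
  then show ?thesis
    using exponential_distributedD_gt[OF assms(5), of "integral {0..t} (intensity \<alpha> \<beta> x)"]
    by (simp add: less_holding_time_iff[OF assms(1-4)])
qed

section \<open>Harris recurrence and invariant measures\<close>

text \<open>
  \<open>Y y t \<omega>\<close> is the position at time \<open>t\<close> of a process started at \<open>y\<close>, all starting points being
  realised on the same probability space \<open>M\<close>; only the laws for the individual \<open>y\<close> matter.
\<close>

definition harris_recurrent :: "'s measure \<Rightarrow> 'w measure \<Rightarrow> ('s \<Rightarrow> real \<Rightarrow> 'w \<Rightarrow> 's) \<Rightarrow> bool" where
  "harris_recurrent S M Y \<longleftrightarrow>
     (\<exists>\<mu>. sigma_finite_measure \<mu> \<and> sets \<mu> = sets S \<and> emeasure \<mu> (space S) \<noteq> 0 \<and>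
        (\<forall>B\<in>sets S. emeasure \<mu> B > 0 \<longrightarrow>
           (\<forall>y\<in>space S. AE \<omega> in M. (\<integral>\<^sup>+t\<in>{0..}. indicator B (Y y t \<omega>) \<partial>lborel) = \<infinity>)))"

definition transition :: "'w measure \<Rightarrow> ('s \<Rightarrow> real \<Rightarrow> 'w \<Rightarrow> 's) \<Rightarrow> real \<Rightarrow> 's \<Rightarrow> 's set \<Rightarrow> ennreal" where
  "transition M Y t y B = emeasure M {\<omega> \<in> space M. Y y t \<omega> \<in> B}"

definition invariant :: "'s measure \<Rightarrow> 'w measure \<Rightarrow> ('s \<Rightarrow> real \<Rightarrow> 'w \<Rightarrow> 's) \<Rightarrow> 's measure \<Rightarrow> bool" where
  "invariant S M Y \<nu> \<longleftrightarrow> sets \<nu> = sets S \<and>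
     (\<forall>t\<ge>0. \<forall>B\<in>sets S. (\<integral>\<^sup>+y. transition M Y t y B \<partial>\<nu>) = emeasure \<nu> B)"

text \<open>
  Uniqueness is among \<open>\<sigma>\<close>-finite measures; it would fail otherwise, as \<open>\<infinity>\<close> times an invariant
  measure is again invariant.
\<close>

definition unique_invariant ::
  "'s measure \<Rightarrow> 'w measure \<Rightarrow> ('s \<Rightarrow> real \<Rightarrow> 'w \<Rightarrow> 's) \<Rightarrow> 's measure \<Rightarrow> bool" where
  "unique_invariant S M Y \<pi> \<longleftrightarrow>
     sigma_finite_measure \<pi> \<and> invariant S M Y \<pi> \<and> emeasure \<pi> (space S) \<noteq> 0 \<and>
     (\<forall>\<nu>. sigma_finite_measure \<nu> \<and> invariant S M Y \<nu> \<longrightarrow>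
        (\<exists>c<\<infinity>. \<nu> = scale_measure c \<pi>))"

end

theory Submission
  imports Defs
begin

text \<open>
  All probabilistic input is the first-jump decomposition along the noise stream together with the
  memorylessness of its exponential component.  A functional of the path is determined in mean by
  its first-jump recursion, because a reset happens almost surely (\<open>renewal_unique\<close>).

  Invariance: memorylessness turns \<open>\<Pi> (P\<^sub>t f)\<close> into the mean integral of \<open>f (Y\<^sub>s)\<close> over
  \<open>t \<le> s < T + t\<close>, and by regeneration at \<open>T\<close> the part over \<open>T \<le> s < T + t\<close> has the same mean as the
  missing part over \<open>0 \<le> s < t\<close>.

  Harris recurrence: \<open>F y = E\<^sup>y exp (- occupation time of B)\<close> satisfies
  \<open>F y = E\<^sup>y exp (- occupation time before the reset) * F y*\<close>; at \<open>y = y*\<close> the first factor is less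
  than 1, so \<open>F\<close> vanishes.

  Uniqueness: let \<open>s\<^sub>\<epsilon> y = E\<^sup>y exp (- \<epsilon> T)\<close> and let \<open>U\<^sub>\<epsilon>\<close> and \<open>R\<^sub>\<epsilon>\<close> be the resolvents of the
  process killed at the reset and of the process itself.  Splitting at the reset gives
  \<open>R\<^sub>\<epsilon> f = U\<^sub>\<epsilon> f + s\<^sub>\<epsilon> * R\<^sub>\<epsilon> f y*\<close>, so an invariant \<open>\<nu>\<close> satisfies
  \<open>\<nu> f = \<epsilon> * \<nu> (U\<^sub>\<epsilon> f) + \<epsilon> * \<nu> s\<^sub>\<epsilon> * R\<^sub>\<epsilon> f y*\<close>.  Evaluating this at \<open>f = s\<^sub>1\<close>, where
  \<open>(1 - \<epsilon>) * U\<^sub>\<epsilon> s\<^sub>1 + s\<^sub>1 = s\<^sub>\<epsilon>\<close>, shows that the constant in \<open>\<nu> \<ge> c * U\<^sub>\<epsilon> (y*, \<cdot>)\<close> does not depend on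
  \<open>\<epsilon>\<close>.  Letting \<open>\<epsilon>\<close> tend to 0 yields \<open>\<nu> \<ge> c * \<Pi>\<close>, with equality on the positive integrable function
  \<open>s\<^sub>1\<close>, hence \<open>\<nu> = c * \<Pi>\<close>.
\<close>

section \<open>Measures, integrals and independence\<close>

lemma nn_integral_lborel_shift:
  fixes g :: "real \<Rightarrow> ennreal"
  assumes [measurable]: "g \<in> borel_measurable borel"
  shows "(\<integral>\<^sup>+t. g (h + t) \<partial>lborel) = (\<integral>\<^sup>+t. g t \<partial>lborel)"
  using nn_integral_real_affine[of g 1 h] by simp

text \<open>The end of the window is an extended number because later it is a reset time,
  \<open>\<infinity>\<close> or a sum involving these. Translating time by \<open>h\<close> turns
  what lies beyond \<open>h\<close> into a window of length \<open>b\<close>.\<close>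

lemma nn_integral_split_at:
  fixes g :: "real \<Rightarrow> ennreal"
  assumes [measurable]: "g \<in> borel_measurable borel" and "h \<ge> 0"
  shows "(\<integral>\<^sup>+t\<in>{t. 0 \<le> t \<and> ennreal t < ennreal h + b}. g t \<partial>lborel) =
    (\<integral>\<^sup>+t\<in>{0..<h}. g t \<partial>lborel) + (\<integral>\<^sup>+t\<in>{t. 0 \<le> t \<and> ennreal t < b}. g (h + t) \<partial>lborel)"
proof -
  have *: "ennreal (h + t) < ennreal h + b \<longleftrightarrow> ennreal t < b" if "0 \<le> t" for t
    using that assms(2) by (cases b) (auto simp: ennreal_less_iff simp flip: ennreal_plus)
  have **: "ennreal t < ennreal h + b" if "0 \<le> t" "t < h" for t
    using that assms(2) by (cases b) (auto simp: ennreal_less_iff simp flip: ennreal_plus)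
  have "(\<integral>\<^sup>+t\<in>{t. 0 \<le> t \<and> ennreal t < b}. g (h + t) \<partial>lborel) =
      (\<integral>\<^sup>+t. g (h + t) * indicator {t. h \<le> t \<and> ennreal t < ennreal h + b} (h + t) \<partial>lborel)"
    using * by (intro nn_integral_cong) (auto split: split_indicator)
  also have "\<dots> = (\<integral>\<^sup>+t\<in>{t. h \<le> t \<and> ennreal t < ennreal h + b}. g t \<partial>lborel)"
    by (rule nn_integral_lborel_shift) measurable
  finally have eq: "(\<integral>\<^sup>+t\<in>{t. 0 \<le> t \<and> ennreal t < b}. g (h + t) \<partial>lborel) = \<dots>" .
  show ?thesis
    unfolding eq using assms(2) **
    by (subst nn_integral_add[symmetric]) (auto intro!: nn_integral_cong split: split_indicator)
qed

text \<open>The exponential \<open>exp (- \<epsilon> * x)\<close> of an extended time. At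
  \<open>\<infinity>\<close> it is 0 even for \<open>\<epsilon> = 0\<close>, where its mean is
  therefore the probability of a finite time. It turns sums of times into products, which is what
  the recursions use.\<close>

definition discount :: "real \<Rightarrow> ennreal \<Rightarrow> ennreal" where
  "discount \<epsilon> x = (if x = \<infinity> then 0 else ennreal (exp (- \<epsilon> * enn2real x)))"

lemma discount_measurable [measurable]: "discount \<epsilon> \<in> borel_measurable borel"
  unfolding discount_def by measurable

lemma discount_add: "discount \<epsilon> (x + y) = discount \<epsilon> x * discount \<epsilon> y"
  by (cases x; cases y)
    (auto simp: discount_def algebra_simps mult_exp_exp simp flip: ennreal_plus ennreal_mult)

lemma discount_ennreal [simp]: "x \<ge> 0 \<Longrightarrow> discount \<epsilon> (ennreal x) = ennreal (exp (- \<epsilon> * x))"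
  by (simp add: discount_def)

lemma discount_zero [simp]: "discount \<epsilon> 0 = 1"
  by (simp add: discount_def)

lemma discount_top [simp]: "discount \<epsilon> \<top> = 0"
  by (simp add: discount_def)

lemma discount_le_1: "\<epsilon> \<ge> 0 \<Longrightarrow> discount \<epsilon> x \<le> 1"
  by (auto simp: discount_def)

lemma discount_eq_0_iff: "discount \<epsilon> x = 0 \<longleftrightarrow> x = \<infinity>"
  by (auto simp: discount_def)

lemma discount_eq_1_iff: "\<epsilon> > 0 \<Longrightarrow> discount \<epsilon> x = 1 \<longleftrightarrow> x = 0"
  by (cases x) (auto simp: discount_def)

text \<open>If the mean were 1, the nonnegative variable
  \<open>1 - discount \<epsilon> (X \<omega>)\<close> would have mean 0, forcing
  \<open>X = 0\<close> almost surely. The strict inequality is the contraction factor of the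
  fixed-point arguments below.\<close>

lemma (in prob_space) nn_integral_discount_less_1:
  assumes [measurable]: "X \<in> borel_measurable M" and "\<epsilon> > 0" and "(\<integral>\<^sup>+\<omega>. X \<omega> \<partial>M) \<noteq> 0"
  shows "(\<integral>\<^sup>+\<omega>. discount \<epsilon> (X \<omega>) \<partial>M) < 1"
proof -
  have le: "discount \<epsilon> (X \<omega>) \<le> 1" for \<omega>
    using assms(2) by (intro discount_le_1) auto
  have "(\<integral>\<^sup>+\<omega>. discount \<epsilon> (X \<omega>) \<partial>M) \<le> (\<integral>\<^sup>+\<omega>. 1 \<partial>M)"
    using le by (intro nn_integral_mono) auto
  then have le1: "(\<integral>\<^sup>+\<omega>. discount \<epsilon> (X \<omega>) \<partial>M) \<le> 1"
    by (simp add: emeasure_space_1)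
  moreover have "(\<integral>\<^sup>+\<omega>. discount \<epsilon> (X \<omega>) \<partial>M) \<noteq> 1"
  proof
    assume *: "(\<integral>\<^sup>+\<omega>. discount \<epsilon> (X \<omega>) \<partial>M) = 1"
    have "(\<integral>\<^sup>+\<omega>. 1 - discount \<epsilon> (X \<omega>) \<partial>M) = (\<integral>\<^sup>+\<omega>. 1 \<partial>M) - (\<integral>\<^sup>+\<omega>. discount \<epsilon> (X \<omega>) \<partial>M)"
      using * le by (intro nn_integral_diff) auto
    also have "\<dots> = 0"
      using * by (simp add: emeasure_space_1)
    finally have "AE \<omega> in M. 1 - discount \<epsilon> (X \<omega>) = 0"
      by (subst (asm) nn_integral_0_iff_AE) auto
    then have "AE \<omega> in M. X \<omega> = 0"
    proof eventually_elim
      case (elim \<omega>)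
      then have "1 \<le> discount \<epsilon> (X \<omega>)"
        by (simp add: diff_eq_0_iff_ennreal top_unique)
      with le[of \<omega>] have "discount \<epsilon> (X \<omega>) = 1" by simp
      then show ?case using assms(2) by (simp add: discount_eq_1_iff)
    qed
    then show False
      using assms(3) by (subst (asm) nn_integral_0_iff_AE) auto
  qed
  ultimately show ?thesis by simp
qed

lemma INF_const_add_ennreal:
  fixes f :: "'i \<Rightarrow> ennreal"
  assumes "I \<noteq> {}"
  shows "(INF i\<in>I. c + f i) = c + (INF i\<in>I. f i)"
  using assms continuous_at_Inf_mono[of "\<lambda>x. c + x" "f ` I"]
    continuous_add[of "at_right (Inf (f ` I))", of "\<lambda>x. c" "\<lambda>x. x"]
  by (auto simp: mono_def image_comp add_left_mono)

text \<open>Finiteness rules out the fixed point \<open>\<infinity>\<close>. This closes the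
  arguments for the noise sum and for occupation times.\<close>

lemma ennreal_eq_mult_self_imp_0:
  fixes x q :: ennreal
  assumes "x = q * x" "q < 1" "x < \<infinity>"
  shows "x = 0"
  using assms
  by (cases x; cases q) (auto simp: ennreal_less_one_iff simp flip: ennreal_mult)

lemma indicator_Ico_measurable [measurable (raw)]:
  fixes f t :: "'m \<Rightarrow> real"
  assumes [measurable]: "f \<in> borel_measurable M" "t \<in> borel_measurable M"
  shows "(\<lambda>x. indicator {0..<f x} (t x) :: ennreal) \<in> borel_measurable M"
  by (rule borel_measurable_indicator') simp

lemma ennreal_mult_inverse: "0 < x \<Longrightarrow> x < \<top> \<Longrightarrow> x * inverse x = (1 :: ennreal)"
  using ennreal_divide_self[of x] by (simp add: divide_ennreal_def)

section \<open>Comparing measures, and sigma-finiteness from an integrable function\<close>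

text \<open>A set \<open>B\<close> and its complement each contribute at most as much of
  \<open>f\<close> under \<open>\<mu>\<close> as under \<open>\<nu>\<close>. The totals agree and
  are finite, so neither inequality can be strict and the densities with respect to \<open>f\<close>
  coincide. As \<open>f\<close> is positive and finite, it can be divided out.\<close>

lemma measure_eqI_le:
  assumes sets: "sets \<mu> = sets \<nu>"
    and [measurable]: "f \<in> borel_measurable \<mu>"
    and pos: "\<And>x. x \<in> space \<mu> \<Longrightarrow> 0 < f x \<and> f x < (\<infinity> :: ennreal)"
    and le: "\<And>g. g \<in> borel_measurable \<mu> \<Longrightarrow> (\<integral>\<^sup>+x. g x \<partial>\<mu>) \<le> (\<integral>\<^sup>+x. g x \<partial>\<nu>)"
    and eq: "(\<integral>\<^sup>+x. f x \<partial>\<mu>) = (\<integral>\<^sup>+x. f x \<partial>\<nu>)" and fin: "(\<integral>\<^sup>+x. f x \<partial>\<mu>) < \<infinity>"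
  shows "\<mu> = \<nu>"
proof -
  have f\<nu> [measurable]: "f \<in> borel_measurable \<nu>"
    using assms(2) by (simp add: measurable_cong_sets[OF sets refl])
  have dens: "density \<mu> f = density \<nu> f"
  proof (rule measure_eqI)
    fix B assume "B \<in> sets (density \<mu> f)"
    then have B [measurable]: "B \<in> sets \<mu>" "B \<in> sets \<nu>" by (simp_all add: sets)
    have split: "(\<integral>\<^sup>+x. f x \<partial>M) = (\<integral>\<^sup>+x\<in>B. f x \<partial>M) + (\<integral>\<^sup>+x\<in>space M - B. f x \<partial>M)"
      if "f \<in> borel_measurable M" "B \<in> sets M" for M
      using that by (subst nn_integral_add[symmetric]) (auto intro!: nn_integral_cong split: split_indicator)
    have le1: "(\<integral>\<^sup>+x\<in>B. f x \<partial>\<mu>) \<le> (\<integral>\<^sup>+x\<in>B. f x \<partial>\<nu>)"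
      "(\<integral>\<^sup>+x\<in>space \<mu> - B. f x \<partial>\<mu>) \<le> (\<integral>\<^sup>+x\<in>space \<nu> - B. f x \<partial>\<nu>)"
      unfolding sets_eq_imp_space_eq[OF sets, symmetric] by (intro le; measurable)+
    have fin': "(\<integral>\<^sup>+x\<in>space \<nu> - B. f x \<partial>\<nu>) < \<infinity>"
      using fin unfolding eq split[OF f\<nu> B(2)] by simp
    have "(\<integral>\<^sup>+x\<in>B. f x \<partial>\<nu>) + (\<integral>\<^sup>+x\<in>space \<nu> - B. f x \<partial>\<nu>) =
        (\<integral>\<^sup>+x\<in>B. f x \<partial>\<mu>) + (\<integral>\<^sup>+x\<in>space \<mu> - B. f x \<partial>\<mu>)"
      using eq split[OF f\<nu> B(2)] split[OF assms(2) B(1)] by simp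
    also have "\<dots> \<le> (\<integral>\<^sup>+x\<in>B. f x \<partial>\<mu>) + (\<integral>\<^sup>+x\<in>space \<nu> - B. f x \<partial>\<nu>)"
      by (intro add_left_mono le1)
    finally have "(\<integral>\<^sup>+x\<in>B. f x \<partial>\<nu>) \<le> (\<integral>\<^sup>+x\<in>B. f x \<partial>\<mu>)"
      using less_imp_neq[OF fin'] by simp
    with le1 show "emeasure (density \<mu> f) B = emeasure (density \<nu> f) B"
      by (simp add: emeasure_density)
  qed (simp add: sets)
  have inv: "density (density M f) (\<lambda>x. inverse (f x)) = M" if "space M = space \<mu>" "f \<in> borel_measurable M" for M
  proof -
    have "density (density M f) (\<lambda>x. inverse (f x)) = density M (\<lambda>x. f x * inverse (f x))"
      using that(2) by (intro density_density_eq) auto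
    also have "\<dots> = density M (\<lambda>_. 1)"
      using that pos by (intro density_cong) (auto intro!: AE_I2 ennreal_mult_inverse)
    finally show ?thesis by (simp add: density_1)
  qed
  have "\<mu> = density (density \<mu> f) (\<lambda>x. inverse (f x))"
    by (rule inv[OF refl assms(2), symmetric])
  also have "\<dots> = density (density \<nu> f) (\<lambda>x. inverse (f x))"
    by (simp only: dens)
  also have "\<dots> = \<nu>"
    by (rule inv[OF sets_eq_imp_space_eq[OF sets, symmetric] f\<nu>])
  finally show ?thesis .
qed

text \<open>The sets where \<open>f\<close> is at least \<open>1 / (n + 1)\<close> have finite
  measure by Markov's inequality, and they exhaust the space because \<open>f\<close> is
  positive.\<close>

lemma sigma_finite_measureI_integral:
  assumes [measurable]: "f \<in> borel_measurable M"
    and pos: "\<And>x. x \<in> space M \<Longrightarrow> (0 :: ennreal) < f x" and fin: "(\<integral>\<^sup>+x. f x \<partial>M) < \<infinity>"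
  shows "sigma_finite_measure M"
proof
  define C where "C n = {x \<in> space M. 1 \<le> of_nat (Suc n) * f x}" for n
  have [measurable]: "C n \<in> sets M" for n
    unfolding C_def by measurable
  have "emeasure M (C n) \<noteq> \<infinity>" for n
  proof -
    have "emeasure M (C n) \<le> of_nat (Suc n) * (\<integral>\<^sup>+x\<in>space M. f x \<partial>M)"
      unfolding C_def using nn_integral_Markov_inequality[of f "space M" M "of_nat (Suc n)"]
      by (auto simp: Int_def conj_commute)
    also have "(\<integral>\<^sup>+x\<in>space M. f x \<partial>M) = (\<integral>\<^sup>+x. f x \<partial>M)"
      by (intro nn_integral_cong) auto
    also have "of_nat (Suc n) * \<dots> < \<infinity>"
      using fin by (simp add: ennreal_mult_less_top of_nat_less_top)
    finally show ?thesis by (rule less_imp_neq)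
  qed
  moreover have "(\<Union>n. C n) = space M"
  proof (intro equalityI subsetI)
    fix x assume x: "x \<in> space M"
    show "x \<in> (\<Union>n. C n)"
    proof (cases "f x = \<infinity>")
      case True
      with x have "x \<in> C 0" by (simp add: C_def)
      then show ?thesis by blast
    next
      case False
      then obtain r where r: "f x = ennreal r" "0 < r"
        using pos[OF x] by (cases "f x") auto
      obtain n where "1 < real n * r"
        using ex_less_of_nat_mult[OF r(2)] by auto
      then have "1 \<le> real (Suc n) * r"
        using r(2) by (simp add: distrib_right)
      then have "ennreal 1 \<le> ennreal (real (Suc n) * r)"
        by (rule ennreal_leI)
      also have "\<dots> = of_nat (Suc n) * f x"
        using r by (simp only: ennreal_mult' of_nat_0_le_iff ennreal_of_nat_eq_real_of_nat)
      finally have "x \<in> C n"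
        using x by (simp add: C_def)
      then show ?thesis by blast
    qed
  qed (auto simp: C_def)
  ultimately show "\<exists>A. countable A \<and> A \<subseteq> sets M \<and> \<Union> A = space M \<and> (\<forall>a\<in>A. emeasure M a \<noteq> \<infinity>)"
    by (intro exI[of _ "range C"]) auto
qed

section \<open>Exponential integrals and the infinite length of the half-line\<close>

lemma nn_integral_exp_Ico:
  assumes "0 < a" "0 \<le> h"
  shows "(\<integral>\<^sup>+s\<in>{0..<h}. ennreal (exp (a * s)) \<partial>lborel) = ennreal ((exp (a * h) - 1) / a)"
proof -
  have "(\<integral>\<^sup>+s\<in>{0..<h}. ennreal (exp (a * s)) \<partial>lborel) = (\<integral>\<^sup>+s\<in>{0..h}. ennreal (exp (a * s)) \<partial>lborel)"
    using AE_lborel_singleton[of h]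
    by (intro nn_integral_cong_AE) (auto split: split_indicator elim: eventually_mono)
  also have "\<dots> = ennreal (exp (a * h) / a - exp (a * 0) / a)"
    using assms by (intro nn_integral_FTC_Icc) (auto intro!: derivative_eq_intros)
  finally show ?thesis by (simp add: diff_divide_distrib)
qed

lemma nn_integral_exp_Ici:
  assumes "0 < a"
  shows "(\<integral>\<^sup>+t\<in>{0..}. ennreal (exp (- a * t)) \<partial>lborel) = ennreal (1 / a)"
proof -
  have "((\<lambda>t. - (exp (- a * t) / a)) \<longlongrightarrow> 0) at_top"
  proof -
    have "filterlim (\<lambda>t. - a * t) at_bot at_top"
      using assms by (intro filterlim_tendsto_neg_mult_at_bot[OF tendsto_const _ filterlim_ident]) auto
    then have "((\<lambda>t. exp (- a * t)) \<longlongrightarrow> 0) at_top"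
      by (rule filterlim_compose[OF exp_at_bot])
    from tendsto_minus[OF tendsto_divide[OF this tendsto_const, of a]] assms show ?thesis
      by simp
  qed
  then have "(\<integral>\<^sup>+t\<in>{0..}. ennreal (exp (- a * t)) \<partial>lborel) = ennreal (0 - (- (exp (- a * 0) / a)))"
    using assms by (intro nn_integral_FTC_atLeast) (auto intro!: derivative_eq_intros)
  then show ?thesis by simp
qed

lemma emeasure_lborel_Ici: "emeasure lborel {a::real..} = \<infinity>"
proof (rule ccontr)
  assume "emeasure lborel {a..} \<noteq> \<infinity>"
  then obtain r where r: "emeasure lborel {a..} = ennreal r" "0 \<le> r"
    by (cases "emeasure lborel {a..}") auto
  have "emeasure lborel {a..a + (r + 1)} \<le> emeasure lborel {a..}"
    by (intro emeasure_mono) auto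
  with r show False by (simp add: ennreal_le_iff)
qed

section \<open>Independent driving pairs as a random stream\<close>

text \<open>Independence makes the joint law of the sequence a product measure, and
  \<open>stream_space D\<close> is the image of that product under \<open>to_stream\<close>. A
  stream separates the first pair from the remaining noise, on which every recursion below
  rests.\<close>

lemma (in prob_space) distr_to_stream:
  assumes indep: "indep_vars (\<lambda>_. K) X UNIV" and D: "\<And>i. distr M K (X i) = D"
  shows "(\<lambda>\<omega>. to_stream (\<lambda>i. X i \<omega>)) \<in> M \<rightarrow>\<^sub>M stream_space D"
    and "distr M (stream_space D) (\<lambda>\<omega>. to_stream (\<lambda>i. X i \<omega>)) = stream_space D"
proof -
  have X [measurable]: "X i \<in> M \<rightarrow>\<^sub>M K" for i
    using indep by (auto simp: indep_vars_def)
  have sets: "sets D = sets K"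
    using D[of 0] by (metis sets_distr)
  have X' [measurable]: "X i \<in> M \<rightarrow>\<^sub>M D" for i
    using X[of i] by (simp add: measurable_cong_sets[OF refl sets])
  have [measurable]: "(\<lambda>\<omega> i. X i \<omega>) \<in> M \<rightarrow>\<^sub>M (\<Pi>\<^sub>M i\<in>UNIV. D)"
    by (rule measurable_PiM_single') (auto dest: measurable_space[OF X'])
  show "(\<lambda>\<omega>. to_stream (\<lambda>i. X i \<omega>)) \<in> M \<rightarrow>\<^sub>M stream_space D"
    by measurable
  have "distr M (\<Pi>\<^sub>M i\<in>UNIV. K) (\<lambda>\<omega>. \<lambda>i\<in>UNIV. X i \<omega>) = (\<Pi>\<^sub>M i\<in>UNIV. distr M K (X i))"
    using indep by (subst indep_vars_iff_distr_eq_PiM[symmetric]) auto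
  then have "distr M (\<Pi>\<^sub>M i\<in>UNIV. K) (\<lambda>\<omega> i. X i \<omega>) = (\<Pi>\<^sub>M i\<in>UNIV. D)"
    by (simp only: D restrict_UNIV)
  moreover have "distr M (\<Pi>\<^sub>M i\<in>UNIV. K) (\<lambda>\<omega> i. X i \<omega>) = distr M (\<Pi>\<^sub>M i\<in>UNIV. D) (\<lambda>\<omega> i. X i \<omega>)"
    by (intro distr_cong sets_PiM_cong) (auto simp: sets)
  ultimately have "stream_space D = distr (distr M (\<Pi>\<^sub>M i\<in>UNIV. D) (\<lambda>\<omega> i. X i \<omega>)) (stream_space D) to_stream"
    by (simp only: stream_space_eq_distr[symmetric])
  also have "\<dots> = distr M (stream_space D) (\<lambda>\<omega>. to_stream (\<lambda>i. X i \<omega>))"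
    by (subst distr_distr) (auto simp: comp_def)
  finally show "distr M (stream_space D) (\<lambda>\<omega>. to_stream (\<lambda>i. X i \<omega>)) = stream_space D" ..
qed

text \<open>The index blocks \<open>{Inl (Suc j), Inr (Suc j)}\<close> are disjoint, which yields
  independence across \<open>j\<close>; independence within a block makes the law of each pair a
  product.\<close>

lemma (in prob_space) indep_vars_pairs:
  fixes E Z :: "nat \<Rightarrow> 'a \<Rightarrow> real"
  assumes indep: "indep_vars (\<lambda>_. borel) (case_sum E Z) ({1..} <+> {1..})"
  shows "indep_vars (\<lambda>_. borel \<Otimes>\<^sub>M borel) (\<lambda>i \<omega>. (E (Suc i) \<omega>, Z (Suc i) \<omega>)) UNIV"
    and "distr M (borel \<Otimes>\<^sub>M borel) (\<lambda>\<omega>. (E (Suc i) \<omega>, Z (Suc i) \<omega>)) =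
      distr M borel (E (Suc i)) \<Otimes>\<^sub>M distr M borel (Z (Suc i))"
proof -
  define K :: "nat \<Rightarrow> (nat + nat) set" where "K j = {Inl (Suc j), Inr (Suc j)}" for j
  have "indep_vars (\<lambda>j. PiM (K j) (\<lambda>_. borel)) (\<lambda>j \<omega>. restrict (\<lambda>i. case_sum E Z i \<omega>) (K j)) UNIV"
    by (rule indep_vars_restrict[OF indep]) (auto simp: K_def disjoint_family_on_def)
  then have "indep_vars (\<lambda>_. borel \<Otimes>\<^sub>M borel)
      (\<lambda>j \<omega>. (\<lambda>f. (f (Inl (Suc j)), f (Inr (Suc j)))) (restrict (\<lambda>i. case_sum E Z i \<omega>) (K j))) UNIV"
    by (rule indep_vars_compose2) (auto simp: K_def intro!: measurable_Pair measurable_component_singleton)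
  then show "indep_vars (\<lambda>_. borel \<Otimes>\<^sub>M borel) (\<lambda>i \<omega>. (E (Suc i) \<omega>, Z (Suc i) \<omega>)) UNIV"
    by (simp add: K_def)
  have "indep_var
      borel ((\<lambda>f. f (Inl (Suc i))) \<circ> (\<lambda>\<omega>. restrict (\<lambda>k. case_sum E Z k \<omega>) {Inl (Suc i)}))
      borel ((\<lambda>f. f (Inr (Suc i))) \<circ> (\<lambda>\<omega>. restrict (\<lambda>k. case_sum E Z k \<omega>) {Inr (Suc i)}))"
    by (rule indep_var_compose[OF indep_var_restrict[OF indep]])
      (auto intro!: measurable_component_singleton)
  then have "indep_var borel (E (Suc i)) borel (Z (Suc i))"
    by (simp add: comp_def)
  then show "distr M (borel \<Otimes>\<^sub>M borel) (\<lambda>\<omega>. (E (Suc i) \<omega>, Z (Suc i) \<omega>)) =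
      distr M borel (E (Suc i)) \<Otimes>\<^sub>M distr M borel (Z (Suc i))"
    by (simp add: indep_var_distribution_eq)
qed

section \<open>Congruence and semigroup properties of the construction\<close>

text \<open>The closed form of the integrated intensity makes measurability in \<open>x\<close> and
  \<open>t\<close> immediate. The branch \<open>\<alpha> = 0\<close>, where the intensity stays at
  \<open>x\<close>, avoids a division by zero.\<close>

definition cum :: "real \<Rightarrow> real \<Rightarrow> real \<Rightarrow> real \<Rightarrow> real" where
  "cum \<alpha> \<beta> x t = \<beta> * t + (x - \<beta>) * (if \<alpha> = 0 then t else (1 - exp (- \<alpha> * t)) / \<alpha>)"

lemma integral_intensity:
  assumes "t \<ge> 0"
  shows "integral {0..t} (intensity \<alpha> \<beta> x) = cum \<alpha> \<beta> x t"
proof -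
  have "(cum \<alpha> \<beta> x has_real_derivative intensity \<alpha> \<beta> x s) (at s)" for s
    unfolding cum_def[abs_def] intensity_def
    by (cases "\<alpha> = 0") (auto intro!: derivative_eq_intros)
  then have "((intensity \<alpha> \<beta> x) has_integral (cum \<alpha> \<beta> x t - cum \<alpha> \<beta> x 0)) {0..t}"
    using assms
    by (intro fundamental_theorem_of_calculus)
      (auto simp: has_real_derivative_iff_has_vector_derivative[symmetric]
        intro: has_field_derivative_at_within)
  then show ?thesis
    by (simp add: cum_def integral_unique)
qed

lemma intensity_add: "intensity \<alpha> \<beta> x (s + t) = intensity \<alpha> \<beta> (intensity \<alpha> \<beta> x s) t"
  by (simp add: intensity_def algebra_simps flip: exp_add)

text \<open>Cocycle identity along the flow: a running holding time can be restarted at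
  \<open>s\<close> once its level is lowered by the rate already accumulated.\<close>

lemma cum_add: "cum \<alpha> \<beta> x (s + t) = cum \<alpha> \<beta> x s + cum \<alpha> \<beta> (intensity \<alpha> \<beta> x s) t"
proof (cases "\<alpha> = 0")
  case True
  then show ?thesis by (simp add: cum_def intensity_def algebra_simps)
next
  case False
  have "exp (- \<alpha> * (s + t)) = exp (- \<alpha> * s) * exp (- \<alpha> * t)"
    by (simp add: algebra_simps flip: exp_add)
  with False show ?thesis
    by (simp add: cum_def intensity_def field_simps)
qed

text \<open>The construction reads the driving sequences only at positive indices, and the marks
  only through \<open>ell (Suc n)\<close>. Hence the noise can be re-indexed, and \<open>ell\<close>
  can be altered at values that no mark takes.\<close>

lemma post_jump_cong:
  assumes "\<And>k. e (Suc k) = e' (Suc k)" "\<And>k n. ell (Suc n) (z (Suc k)) = ell' (Suc n) (z' (Suc k))"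
  shows "post_jump \<alpha> \<beta> A lam0 ell y e z k = post_jump \<alpha> \<beta> A lam0 ell' y e' z' k"
  using assms by (induction k) (simp_all add: jump_def exceeds_def)

lemma pdmp_path_cong:
  assumes "\<And>k. e (Suc k) = e' (Suc k)" "\<And>k n. ell (Suc n) (z (Suc k)) = ell' (Suc n) (z' (Suc k))"
  shows "pdmp_path \<alpha> \<beta> A lam0 ell y e z t = pdmp_path \<alpha> \<beta> A lam0 ell' y e' z' t"
  unfolding pdmp_path_def jump_time_def post_jump_cong[of e e' ell z ell' z', OF assms] assms(1) ..

lemma first_reset_cong:
  assumes "\<And>k. e (Suc k) = e' (Suc k)" "\<And>k n. ell (Suc n) (z (Suc k)) = ell' (Suc n) (z' (Suc k))"
  shows "first_reset \<alpha> \<beta> A lam0 ell y e z = first_reset \<alpha> \<beta> A lam0 ell' y e' z'"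
  unfolding first_reset_def jump_time_def pre_jump_def exceeds_def
    post_jump_cong[of e e' ell z ell' z', OF assms] assms(1)
  using assms(2) by simp

section \<open>The process as a functional of the noise stream\<close>

text \<open>Positivity and measurability of \<open>ell\<close> are asked for all real marks. The
  given function is controlled at nonnegative ones; the final theorem applies the locale to
  \<open>ell\<close> read at \<open>max 0 z\<close>.\<close>

locale resetting_pdmp =
  fixes \<alpha> \<beta> A lam0 :: real
    and ell :: "nat \<Rightarrow> real \<Rightarrow> real"
    and mark :: "real measure"
  assumes alpha: "0 \<le> \<alpha>" and beta: "0 < \<beta>" "\<beta> < A" and lam0: "0 < lam0" "lam0 \<le> \<beta>"
    and ell_pos: "\<And>n z. 0 < ell (Suc n) z"
    and ell_measurable [measurable]: "\<And>n. ell (Suc n) \<in> borel_measurable borel"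
    and mark_prob: "prob_space mark" and sets_mark [measurable_cong]: "sets mark = sets borel"
begin

abbreviation "S \<equiv> state_space lam0 A"
abbreviation "ystar \<equiv> (0 :: nat, lam0)"

definition noise :: "(real \<times> real) measure" where
  "noise = density lborel (exponential_density 1) \<Otimes>\<^sub>M mark"

definition N :: "(real \<times> real) stream measure" where
  "N = stream_space noise"

definition hold :: "state \<Rightarrow> real \<times> real \<Rightarrow> real" where
  "hold y p = holding_time \<alpha> \<beta> (snd y) (fst p)"

definition resets :: "state \<Rightarrow> real \<times> real \<Rightarrow> bool" where
  "resets y p \<longleftrightarrow> exceeds A ell (before_jump \<alpha> \<beta> y (fst p)) (snd p)"

definition step :: "state \<Rightarrow> real \<times> real \<Rightarrow> state" where
  "step y p = jump A lam0 ell (before_jump \<alpha> \<beta> y (fst p)) (snd p)"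

text \<open>Streams are indexed from 0 and the driving sequences from 1, hence the shift
  \<open>i - 1\<close> here and in the next three definitions.\<close>

definition chain :: "state \<Rightarrow> (real \<times> real) stream \<Rightarrow> nat \<Rightarrow> state" where
  "chain y w = post_jump \<alpha> \<beta> A lam0 ell y (\<lambda>i. fst (w !! (i - 1))) (\<lambda>i. snd (w !! (i - 1)))"

definition jtime :: "state \<Rightarrow> (real \<times> real) stream \<Rightarrow> nat \<Rightarrow> real" where
  "jtime y w = jump_time \<alpha> \<beta> A lam0 ell y (\<lambda>i. fst (w !! (i - 1))) (\<lambda>i. snd (w !! (i - 1)))"

definition raw_path :: "state \<Rightarrow> (real \<times> real) stream \<Rightarrow> real \<Rightarrow> state" where
  "raw_path y w = pdmp_path \<alpha> \<beta> A lam0 ell y (\<lambda>i. fst (w !! (i - 1))) (\<lambda>i. snd (w !! (i - 1)))"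

definition T :: "state \<Rightarrow> (real \<times> real) stream \<Rightarrow> ennreal" where
  "T y w = first_reset \<alpha> \<beta> A lam0 ell y (\<lambda>i. fst (w !! (i - 1))) (\<lambda>i. snd (w !! (i - 1)))"

text \<open>
  Sending the path to \<open>ystar\<close> wherever \<open>pdmp_path\<close> takes a junk value makes the first-jump
  recursion \<open>path_rec\<close> hold for every noise sequence and keeps the path inside the state space.
\<close>

definition path :: "state \<Rightarrow> (real \<times> real) stream \<Rightarrow> real \<Rightarrow> state" where
  "path y w t = (if 0 \<le> t \<and> (\<exists>k. t < jtime y w (Suc k)) then raw_path y w t else ystar)"

section \<open>The state space\<close>

lemma space_S: "space S = UNIV \<times> {lam0..<A}"
  by (simp add: state_space_def space_pair_measure space_restrict_space)

lemma in_space_S: "y \<in> space S \<longleftrightarrow> lam0 \<le> snd y \<and> snd y < A"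
  by (cases y) (simp add: space_S)

lemma ystar_in_S [simp]: "ystar \<in> space S"
  using beta lam0 by (simp add: space_S)

lemma fst_S [measurable]: "fst \<in> S \<rightarrow>\<^sub>M count_space UNIV"
  unfolding state_space_def by measurable

lemma snd_S [measurable]: "snd \<in> S \<rightarrow>\<^sub>M borel"
proof -
  have "snd \<in> S \<rightarrow>\<^sub>M restrict_space borel {lam0..<A}"
    unfolding state_space_def by measurable
  then show ?thesis
    by (rule measurable_compose) (rule measurable_restrict_space1, simp)
qed

lemma measurable_into_S:
  assumes "(\<lambda>x. fst (f x)) \<in> M \<rightarrow>\<^sub>M count_space UNIV" "(\<lambda>x. snd (f x)) \<in> borel_measurable M"
    and "\<And>x. x \<in> space M \<Longrightarrow> f x \<in> space S"
  shows "f \<in> M \<rightarrow>\<^sub>M S"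
proof -
  have "(\<lambda>x. (fst (f x), snd (f x))) \<in> M \<rightarrow>\<^sub>M S"
    unfolding state_space_def using assms
    by (intro measurable_Pair measurable_restrict_space2) (auto simp: in_space_S)
  then show ?thesis by simp
qed

text \<open>The raw path is shown measurable only into the ambient product space. To test it against
  a set of \<open>S\<close>, the set is pulled back along the retraction \<open>r\<close> that sends
  outside intensities to \<open>lam0\<close>, and the outside points are then cut off.\<close>

lemma sets_S_borel:
  assumes "B \<in> sets S"
  shows "B \<in> sets (count_space UNIV \<Otimes>\<^sub>M borel)"
proof -
  define r where "r y = (fst y, if snd y \<in> {lam0..<A} then snd y else lam0)" for y :: state
  have "r \<in> count_space UNIV \<Otimes>\<^sub>M borel \<rightarrow>\<^sub>M S"
    using beta lam0 by (intro measurable_into_S) (auto simp: r_def in_space_S)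
  from measurable_sets[OF this assms]
  have "r -` B \<inter> UNIV \<in> sets (count_space UNIV \<Otimes>\<^sub>M borel)"
    by (simp add: space_pair_measure)
  moreover have "{y. snd y \<in> {lam0..<A}} \<in> sets (count_space (UNIV :: nat set) \<Otimes>\<^sub>M (borel :: real measure))"
  proof -
    have "{y \<in> space (count_space (UNIV :: nat set) \<Otimes>\<^sub>M (borel :: real measure)). snd y \<in> {lam0..<A}}
        \<in> sets (count_space UNIV \<Otimes>\<^sub>M borel)"
      by measurable
    then show ?thesis by (simp add: space_pair_measure)
  qed
  ultimately have "(r -` B \<inter> UNIV) \<inter> {y. snd y \<in> {lam0..<A}} \<in> sets (count_space UNIV \<Otimes>\<^sub>M borel)"
    by (rule sets.Int)
  also have "(r -` B \<inter> UNIV) \<inter> {y. snd y \<in> {lam0..<A}} = B"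
    using sets.sets_into_space[OF assms] by (auto simp: r_def space_S split: if_splits)
  finally show ?thesis .
qed

section \<open>Flow, holding times and single jumps\<close>

text \<open>The current intensity is a convex combination of \<open>x\<close> and
  \<open>\<beta>\<close>, which both lie in \<open>[lam0, A)\<close>.\<close>

lemma intensity_range:
  assumes "lam0 \<le> x" "x < A" "0 \<le> t"
  shows "lam0 \<le> intensity \<alpha> \<beta> x t" "intensity \<alpha> \<beta> x t < A"
proof -
  have "min x \<beta> \<le> intensity \<alpha> \<beta> x t"
    using alpha assms by (intro intensity_lower_bound)
  with assms lam0 show "lam0 \<le> intensity \<alpha> \<beta> x t" by auto
  define q where "q = exp (- \<alpha> * t)"
  have q: "0 \<le> q" "q \<le> 1" using assms alpha by (auto simp: q_def)
  have "intensity \<alpha> \<beta> x t = \<beta> * (1 - q) + x * q"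
    by (simp add: intensity_def q_def algebra_simps)
  also have "\<dots> \<le> max x \<beta> * (1 - q) + max x \<beta> * q"
    using q by (intro add_mono mult_right_mono) auto
  also have "\<dots> = max x \<beta>" by (simp add: algebra_simps)
  finally show "intensity \<alpha> \<beta> x t < A" using assms beta by auto
qed

lemma flow_in_S: "y \<in> space S \<Longrightarrow> 0 \<le> t \<Longrightarrow> flow \<alpha> \<beta> y t \<in> space S"
  using intensity_range[of "snd y" t] by (auto simp: in_space_S flow_def)

lemma flow_add: "flow \<alpha> \<beta> y (s + t) = flow \<alpha> \<beta> (flow \<alpha> \<beta> y s) t"
  by (simp add: flow_def intensity_add)

lemma less_hold_iff:
  assumes "y \<in> space S" "0 \<le> t"
  shows "t < hold y p \<longleftrightarrow> cum \<alpha> \<beta> (snd y) t < fst p"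
  using assms alpha beta lam0 unfolding hold_def
  by (subst less_holding_time_iff) (auto simp: in_space_S integral_intensity)

lemma cum_bounds:
  assumes "y \<in> space S" "0 \<le> t"
  shows "lam0 * t \<le> cum \<alpha> \<beta> (snd y) t" "cum \<alpha> \<beta> (snd y) t \<le> A * t"
proof -
  have *: "intensity \<alpha> \<beta> (snd y) integrable_on {0..t}"
    unfolding intensity_def by (intro integrable_continuous_real continuous_intros)
  have "integral {0..t} (\<lambda>_. lam0) \<le> integral {0..t} (intensity \<alpha> \<beta> (snd y))"
    using assms intensity_range[of "snd y"] * by (intro integral_le) (auto simp: in_space_S)
  then show "lam0 * t \<le> cum \<alpha> \<beta> (snd y) t"
    using assms by (simp add: integral_intensity mult.commute)
  have "integral {0..t} (intensity \<alpha> \<beta> (snd y)) \<le> integral {0..t} (\<lambda>_. A)"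
    using assms intensity_range[of "snd y"] * by (intro integral_le) (auto simp: in_space_S less_imp_le)
  then show "cum \<alpha> \<beta> (snd y) t \<le> A * t"
    using assms by (simp add: integral_intensity mult.commute)
qed

lemma hold_nonneg:
  assumes "y \<in> space S"
  shows "0 \<le> hold y p"
proof -
  \<comment> \<open>The infimum defining the holding time is controlled only if its set is nonempty.
    At rate at least \<open>lam0\<close>, the level \<open>fst p\<close> is reached by this time;
    the absolute value covers negative levels.\<close>
  have "fst p \<le> \<bar>fst p\<bar> / lam0 * lam0" using lam0 by simp
  also have "\<dots> \<le> integral {0..\<bar>fst p\<bar> / lam0} (intensity \<alpha> \<beta> (snd y))"
    using cum_bounds(1)[OF assms, of "\<bar>fst p\<bar> / lam0"] lam0 by (simp add: integral_intensity)
  finally have "\<bar>fst p\<bar> / lam0 \<in> {t. 0 \<le> t \<and> fst p \<le> integral {0..t} (intensity \<alpha> \<beta> (snd y))}"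
    using lam0 by simp
  then show ?thesis
    unfolding hold_def holding_time_def by (intro cInf_greatest) auto
qed

text \<open>With the rate bounded by \<open>A\<close>, accumulating \<open>fst p\<close> takes at
  least \<open>fst p / A\<close>. This is what excludes explosion.\<close>

lemma hold_ge: "y \<in> space S \<Longrightarrow> fst p / A \<le> hold y p"
proof (rule ccontr)
  assume y: "y \<in> space S" and "\<not> fst p / A \<le> hold y p"
  then have *: "hold y p * A < fst p"
    using beta by (simp add: field_simps)
  have "cum \<alpha> \<beta> (snd y) (hold y p) \<le> A * hold y p"
    by (intro cum_bounds y hold_nonneg)
  with * have "hold y p < hold y p"
    by (subst less_hold_iff[OF y hold_nonneg[OF y]]) (simp add: mult.commute)
  then show False by simp
qed

lemma before_jump_eq: "before_jump \<alpha> \<beta> y (fst p) = flow \<alpha> \<beta> y (hold y p)"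
  by (simp add: before_jump_def hold_def)

lemma step_in_S: "y \<in> space S \<Longrightarrow> step y p \<in> space S"
  using flow_in_S[OF _ hold_nonneg, of y y p] ystar_in_S
    ell_pos[of "fst (flow \<alpha> \<beta> y (hold y p))" "snd p"]
  unfolding step_def before_jump_eq jump_def exceeds_def
  by (auto simp: in_space_S)

lemma step_resets: "resets y p \<Longrightarrow> step y p = ystar"
  by (simp add: resets_def step_def jump_def)

section \<open>Jump chain, jump times and first-jump recursions\<close>

lemma chain_0 [simp]: "chain y w 0 = y"
  by (simp add: chain_def)

lemma chain_Suc_last: "chain y w (Suc k) = step (chain y w k) (w !! k)"
  by (simp add: chain_def step_def)

text \<open>The definition recurs at the last jump. Peeling off the first one instead lets the
  future be driven by \<open>stl w\<close>.\<close>

lemma chain_Suc: "chain y w (Suc k) = chain (step y (shd w)) (stl w) k"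
  by (induction k) (simp_all add: chain_Suc_last)

lemma chain_in_S: "y \<in> space S \<Longrightarrow> chain y w k \<in> space S"
  by (induction k) (auto simp: chain_Suc_last step_in_S)

lemma jtime_eq: "jtime y w k = (\<Sum>i<k. hold (chain y w i) (w !! i))"
  by (simp add: jtime_def jump_time_def chain_def hold_def)

lemma jtime_Suc: "jtime y w (Suc k) = hold y (shd w) + jtime (step y (shd w)) (stl w) k"
  unfolding jtime_eq by (subst sum.lessThan_Suc_shift) (simp add: chain_Suc)

lemma jtime_0 [simp]: "jtime y w 0 = 0"
  by (simp add: jtime_eq)

lemma jtime_mono:
  assumes "y \<in> space S" "i \<le> k"
  shows "jtime y w i \<le> jtime y w k"
  unfolding jtime_eq using assms by (intro sum_mono2) (auto intro: hold_nonneg chain_in_S)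

lemma jtime_nonneg: "y \<in> space S \<Longrightarrow> 0 \<le> jtime y w k"
  using jtime_mono[of y 0 k w] by simp

lemma raw_path_eq:
  "raw_path y w t = (let k = LEAST k. t < jtime y w (Suc k) in flow \<alpha> \<beta> (chain y w k) (t - jtime y w k))"
  by (simp add: raw_path_def pdmp_path_def jtime_def chain_def)

text \<open>After the first jump, subtracting its time from \<open>t\<close> lowers the least jump
  index by one. If no jump time exceeds \<open>t\<close>, the same holds for the shifted path, and
  both sides are \<open>ystar\<close>.\<close>

lemma path_rec:
  assumes y: "y \<in> space S" and t: "0 \<le> t"
  shows "path y w t =
    (if t < hold y (shd w) then flow \<alpha> \<beta> y t else path (step y (shd w)) (stl w) (t - hold y (shd w)))"
proof (cases "t < hold y (shd w)")
  case True
  then have "(LEAST k. t < jtime y w (Suc k)) = 0" "t < jtime y w (Suc 0)"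
    by (auto simp: jtime_Suc intro!: Least_equality)
  with True t show ?thesis
    by (auto simp: path_def raw_path_eq)
next
  case False
  have iff: "t < jtime y w (Suc (Suc k)) \<longleftrightarrow>
      t - hold y (shd w) < jtime (step y (shd w)) (stl w) (Suc k)" for k
    by (subst jtime_Suc) auto
  have "\<not> t < jtime y w (Suc 0)"
    using False by (simp add: jtime_Suc)
  then have ex: "(\<exists>k. t < jtime y w (Suc k)) \<longleftrightarrow>
      (\<exists>k. t - hold y (shd w) < jtime (step y (shd w)) (stl w) (Suc k))"
    using iff by (metis not0_implies_Suc)
  show ?thesis
  proof (cases "\<exists>k. t < jtime y w (Suc k)")
    case True
    then obtain k where "t < jtime y w (Suc k)" ..
    from Least_Suc[where P = "\<lambda>k. t < jtime y w (Suc k)", OF this \<open>\<not> t < jtime y w (Suc 0)\<close>]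
    have "(LEAST k. t < jtime y w (Suc k)) =
        Suc (LEAST k. t - hold y (shd w) < jtime (step y (shd w)) (stl w) (Suc k))"
      by (simp add: iff)
    with True False ex t show ?thesis
      by (simp add: path_def raw_path_eq Let_def chain_Suc jtime_Suc algebra_simps)
  next
    case False
    with ex \<open>\<not> t < hold y (shd w)\<close> show ?thesis by (simp add: path_def)
  qed
qed

lemma path_in_S:
  assumes "y \<in> space S"
  shows "path y w t \<in> space S"
proof (cases "0 \<le> t \<and> (\<exists>k. t < jtime y w (Suc k))")
  case True
  define k where "k = (LEAST k. t < jtime y w (Suc k))"
  \<comment> \<open>Minimality of \<open>k\<close> ensures that the flow is run for a nonnegative
    time.\<close>
  have "jtime y w k \<le> t"
  proof (cases k)
    case (Suc m)
    then have "\<not> t < jtime y w (Suc m)"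
      using not_less_Least[of m "\<lambda>k. t < jtime y w (Suc k)"] by (simp add: k_def)
    with Suc show ?thesis by simp
  qed (use True in simp)
  then show ?thesis
    using True assms by (simp add: path_def raw_path_eq k_def[symmetric] Let_def flow_in_S chain_in_S)
qed (auto simp: path_def)

lemma reset_set_eq:
  "T y w = (INF k\<in>{k. resets (chain y w k) (w !! k)}. ennreal (jtime y w (Suc k)))"
  by (simp add: T_def first_reset_def resets_def chain_def jtime_def pre_jump_def)

text \<open>If the first jump resets, it attains the infimum because jump times increase. Otherwise
  every resetting index is a successor, and the first holding time comes out of the infimum; with no
  resetting index both sides are infinite.\<close>

lemma T_rec:
  assumes y: "y \<in> space S"
  shows "T y w = ennreal (hold y (shd w)) + (if resets y (shd w) then 0 else T (step y (shd w)) (stl w))"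
proof (cases "resets y (shd w)")
  case True
  have "T y w = ennreal (jtime y w (Suc 0))"
    unfolding reset_set_eq
  proof (rule antisym)
    show "(INF k\<in>{k. resets (chain y w k) (w !! k)}. ennreal (jtime y w (Suc k))) \<le> ennreal (jtime y w (Suc 0))"
      using True by (intro INF_lower) auto
    show "ennreal (jtime y w (Suc 0)) \<le> (INF k\<in>{k. resets (chain y w k) (w !! k)}. ennreal (jtime y w (Suc k)))"
      by (intro INF_greatest ennreal_leI jtime_mono y) simp
  qed
  with True show ?thesis by (simp add: jtime_Suc)
next
  case False
  let ?y = "step y (shd w)" and ?R = "\<lambda>y w. {k. resets (chain y w k) (w !! k)}"
  have R: "?R y w = Suc ` ?R ?y (stl w)"
  proof (intro set_eqI)
    fix k show "k \<in> ?R y w \<longleftrightarrow> k \<in> Suc ` ?R ?y (stl w)"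
      using False by (cases k) (auto simp: chain_Suc)
  qed
  have "T y w = (INF k\<in>?R ?y (stl w). ennreal (hold y (shd w)) + ennreal (jtime ?y (stl w) (Suc k)))"
    unfolding reset_set_eq R image_image
    by (subst jtime_Suc) (simp add: hold_nonneg y step_in_S jtime_nonneg flip: ennreal_plus)
  also have "\<dots> = ennreal (hold y (shd w)) + T ?y (stl w)"
    unfolding reset_set_eq
    by (cases "?R ?y (stl w) = {}") (auto simp: INF_const_add_ennreal)
  finally show ?thesis using False by simp
qed

subsection \<open>Measurability\<close>

sublocale mark: prob_space mark
  by (rule mark_prob)

lemma sets_noise [measurable_cong]: "sets noise = sets borel"
proof -
  have "sets noise = sets (borel \<Otimes>\<^sub>M borel :: (real \<times> real) measure)"
    unfolding noise_def by (intro sets_pair_measure_cong) (auto simp: sets_mark)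
  also have "\<dots> = sets borel"
    by (simp only: borel_prod)
  finally show ?thesis .
qed

sublocale noise: prob_space noise
proof -
  interpret E: prob_space "density lborel (exponential_density 1)"
    by (rule prob_space_exponential_density) simp
  interpret pair_prob_space "density lborel (exponential_density 1)" mark ..
  show "prob_space noise"
    unfolding noise_def by (rule P.prob_space_axioms)
qed

sublocale N: prob_space N
  unfolding N_def by (rule noise.prob_space_stream_space)

lemma space_N [simp]: "space N = UNIV"
  using sets_eq_imp_space_eq[OF sets_noise] by (simp add: N_def space_stream_space)

lemma snth_N [measurable]: "(\<lambda>w. w !! n) \<in> N \<rightarrow>\<^sub>M borel"
  unfolding N_def measurable_cong_sets[OF refl sets_noise[symmetric]] by measurable

lemma shd_N [measurable]: "shd \<in> N \<rightarrow>\<^sub>M borel"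
  using snth_N[of 0] by simp

lemma stl_N [measurable]: "stl \<in> N \<rightarrow>\<^sub>M N"
  unfolding N_def by measurable

lemma Stream_N [measurable (raw)]:
  assumes "f \<in> M \<rightarrow>\<^sub>M borel" "g \<in> M \<rightarrow>\<^sub>M N"
  shows "(\<lambda>x. f x ## g x) \<in> M \<rightarrow>\<^sub>M N"
  using assms(2) assms(1)[unfolded measurable_cong_sets[OF refl sets_noise[symmetric]]]
  unfolding N_def by (intro measurable_Stream)

lemma fst_borel_measurable [measurable (raw)]:
  fixes g :: "'m \<Rightarrow> real \<times> real"
  assumes "g \<in> M \<rightarrow>\<^sub>M borel"
  shows "(\<lambda>x. fst (g x)) \<in> borel_measurable M"
  by (rule measurable_compose[OF assms]) (intro borel_measurable_continuous_onI continuous_intros)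

lemma snd_borel_measurable [measurable (raw)]:
  fixes g :: "'m \<Rightarrow> real \<times> real"
  assumes "g \<in> M \<rightarrow>\<^sub>M borel"
  shows "(\<lambda>x. snd (g x)) \<in> borel_measurable M"
  by (rule measurable_compose[OF assms]) (intro borel_measurable_continuous_onI continuous_intros)

lemma nn_integral_N:
  "f \<in> borel_measurable N \<Longrightarrow> (\<integral>\<^sup>+w. f w \<partial>N) = (\<integral>\<^sup>+p. (\<integral>\<^sup>+w. f (p ## w) \<partial>N) \<partial>noise)"
  unfolding N_def by (rule noise.nn_integral_stream_space)

text \<open>At nonnegative levels, \<open>less_hold_iff\<close> replaces the infimum in the holding
  time by an inequality for the closed form \<open>cum\<close>.\<close>

lemma hold_measurable [measurable (raw)]:
  assumes [measurable]: "f \<in> M \<rightarrow>\<^sub>M S" "g \<in> M \<rightarrow>\<^sub>M borel"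
  shows "(\<lambda>x. hold (f x) (g x)) \<in> borel_measurable M"
proof (subst borel_measurable_iff_greater, intro allI)
  fix a :: real
  note S = measurable_space[OF assms(1)]
  show "{x \<in> space M. a < hold (f x) (g x)} \<in> sets M"
  proof (cases "a < 0")
    case True
    then have "a < hold (f x) (g x)" if "x \<in> space M" for x
      using hold_nonneg[OF S[OF that], of "g x"] by linarith
    then have "{x \<in> space M. a < hold (f x) (g x)} = space M"
      by blast
    then show ?thesis by simp
  next
    case False
    then have "{x \<in> space M. a < hold (f x) (g x)} = {x \<in> space M. cum \<alpha> \<beta> (snd (f x)) a < fst (g x)}"
      using S by (auto simp: less_hold_iff)
    also have "\<dots> \<in> sets M"
      unfolding cum_def by measurable
    finally show ?thesis .
  qed
qed

lemma fst_flow_measurable [measurable (raw)]: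
  "f \<in> M \<rightarrow>\<^sub>M S \<Longrightarrow> (\<lambda>x. fst (flow \<alpha> \<beta> (f x) (t x))) \<in> M \<rightarrow>\<^sub>M count_space UNIV"
  unfolding flow_def by simp

lemma snd_flow_measurable [measurable (raw)]:
  assumes [measurable]: "f \<in> M \<rightarrow>\<^sub>M S" "t \<in> borel_measurable M"
  shows "(\<lambda>x. snd (flow \<alpha> \<beta> (f x) (t x))) \<in> borel_measurable M"
  unfolding flow_def intensity_def by simp

lemma flow_measurable:
  assumes "f \<in> M \<rightarrow>\<^sub>M S" "t \<in> borel_measurable M" "\<And>x. x \<in> space M \<Longrightarrow> 0 \<le> t x"
  shows "(\<lambda>x. flow \<alpha> \<beta> (f x) (t x)) \<in> M \<rightarrow>\<^sub>M S"
  using assms by (intro measurable_into_S) (auto intro: flow_in_S measurable_space)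

lemma pre_measurable:
  assumes "f \<in> M \<rightarrow>\<^sub>M S" "g \<in> M \<rightarrow>\<^sub>M borel"
  shows "(\<lambda>x. flow \<alpha> \<beta> (f x) (hold (f x) (g x))) \<in> M \<rightarrow>\<^sub>M S"
  using assms by (intro flow_measurable) (auto intro: hold_nonneg measurable_space)

text \<open>Each \<open>ell (Suc n)\<close> is measurable by itself; the counter takes countably
  many values, so the cases can be glued.\<close>

lemma jump_size_measurable [measurable (raw)]:
  fixes g :: "'m \<Rightarrow> real \<times> real"
  assumes [measurable]: "f \<in> M \<rightarrow>\<^sub>M S" "g \<in> M \<rightarrow>\<^sub>M borel"
  shows "(\<lambda>x. ell (Suc (fst (f x))) (snd (g x))) \<in> borel_measurable M"
proof (rule measurable_compose_countable[where f = "\<lambda>n x. ell (Suc n) (snd (g x))"])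
  show "(\<lambda>x. ell (Suc n) (snd (g x))) \<in> borel_measurable M" for n
    by (rule measurable_compose[OF snd_borel_measurable[OF assms(2)] ell_measurable])
  show "(\<lambda>x. fst (f x)) \<in> M \<rightarrow>\<^sub>M count_space UNIV"
    by (rule measurable_compose[OF assms(1) fst_S])
qed

lemma resets_measurable [measurable (raw)]:
  assumes [measurable]: "f \<in> M \<rightarrow>\<^sub>M S" "g \<in> M \<rightarrow>\<^sub>M borel"
  shows "Measurable.pred M (\<lambda>x. resets (f x) (g x))"
proof -
  note [measurable] = pre_measurable[OF assms]
  show ?thesis
    unfolding resets_def exceeds_def before_jump_eq by simp
qed

lemma step_measurable [measurable (raw)]:
  assumes [measurable]: "f \<in> M \<rightarrow>\<^sub>M S" "g \<in> M \<rightarrow>\<^sub>M borel"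
  shows "(\<lambda>x. step (f x) (g x)) \<in> M \<rightarrow>\<^sub>M S"
proof -
  note [measurable] = pre_measurable[OF assms]
  have eq: "step y p = (if resets y p then ystar else
      (Suc (fst (flow \<alpha> \<beta> y (hold y p))),
       snd (flow \<alpha> \<beta> y (hold y p)) + ell (Suc (fst (flow \<alpha> \<beta> y (hold y p)))) (snd p)))" for y p
    by (simp add: step_def jump_def resets_def before_jump_eq)
  show ?thesis
  proof (rule measurable_into_S)
    show "(\<lambda>x. fst (step (f x) (g x))) \<in> M \<rightarrow>\<^sub>M count_space UNIV"
      unfolding eq if_distrib[of fst] fst_conv by measurable
    show "(\<lambda>x. snd (step (f x) (g x))) \<in> borel_measurable M"
      unfolding eq if_distrib[of snd] snd_conv by measurable
  qed (use measurable_space[OF assms(1)] step_in_S in auto)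
qed

lemma chain_measurable [measurable (raw)]:
  assumes [measurable]: "f \<in> M \<rightarrow>\<^sub>M S" "w \<in> M \<rightarrow>\<^sub>M N"
  shows "(\<lambda>x. chain (f x) (w x) k) \<in> M \<rightarrow>\<^sub>M S"
  by (induction k) (simp_all add: chain_Suc_last)

lemma jtime_measurable [measurable (raw)]:
  assumes [measurable]: "f \<in> M \<rightarrow>\<^sub>M S" "w \<in> M \<rightarrow>\<^sub>M N"
  shows "(\<lambda>x. jtime (f x) (w x) k) \<in> borel_measurable M"
  unfolding jtime_eq by measurable

lemma fst_raw_path_measurable [measurable (raw)]:
  assumes [measurable]: "f \<in> M \<rightarrow>\<^sub>M S" "w \<in> M \<rightarrow>\<^sub>M N" "t \<in> borel_measurable M"
  shows "(\<lambda>x. fst (raw_path (f x) (w x) (t x))) \<in> M \<rightarrow>\<^sub>M count_space UNIV"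
  unfolding raw_path_eq Let_def
  by (rule measurable_compose_countable[where f = "\<lambda>k x. fst (flow \<alpha> \<beta> (chain (f x) (w x) k) (t x - jtime (f x) (w x) k))"])
    measurable

lemma snd_raw_path_measurable [measurable (raw)]:
  assumes [measurable]: "f \<in> M \<rightarrow>\<^sub>M S" "w \<in> M \<rightarrow>\<^sub>M N" "t \<in> borel_measurable M"
  shows "(\<lambda>x. snd (raw_path (f x) (w x) (t x))) \<in> borel_measurable M"
  unfolding raw_path_eq Let_def
  by (rule measurable_compose_countable[where f = "\<lambda>k x. snd (flow \<alpha> \<beta> (chain (f x) (w x) k) (t x - jtime (f x) (w x) k))"])
    measurable

lemma raw_path_measurable:
  assumes [measurable]: "f \<in> M \<rightarrow>\<^sub>M S" "w \<in> M \<rightarrow>\<^sub>M N" "t \<in> borel_measurable M"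
  shows "(\<lambda>x. raw_path (f x) (w x) (t x)) \<in> M \<rightarrow>\<^sub>M count_space UNIV \<Otimes>\<^sub>M borel"
proof -
  have "(\<lambda>x. (fst (raw_path (f x) (w x) (t x)), snd (raw_path (f x) (w x) (t x)))) \<in> M \<rightarrow>\<^sub>M count_space UNIV \<Otimes>\<^sub>M borel"
    by measurable
  then show ?thesis by simp
qed

lemma path_measurable [measurable (raw)]:
  assumes [measurable]: "f \<in> M \<rightarrow>\<^sub>M S" "w \<in> M \<rightarrow>\<^sub>M N" "t \<in> borel_measurable M"
  shows "(\<lambda>x. path (f x) (w x) (t x)) \<in> M \<rightarrow>\<^sub>M S"
proof (rule measurable_into_S)
  show "(\<lambda>x. fst (path (f x) (w x) (t x))) \<in> M \<rightarrow>\<^sub>M count_space UNIV"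
    unfolding path_def if_distrib[of fst] fst_conv by measurable
  show "(\<lambda>x. snd (path (f x) (w x) (t x))) \<in> borel_measurable M"
    unfolding path_def if_distrib[of snd] snd_conv by measurable
qed (auto intro: path_in_S measurable_space[OF assms(1)])

lemma T_measurable [measurable (raw)]:
  assumes [measurable]: "f \<in> M \<rightarrow>\<^sub>M S" "w \<in> M \<rightarrow>\<^sub>M N"
  shows "(\<lambda>x. T (f x) (w x)) \<in> borel_measurable M"
proof -
  have [measurable]: "(\<lambda>x. w x !! k) \<in> M \<rightarrow>\<^sub>M borel" for k
    by (rule measurable_compose[OF assms(2)]) measurable
  \<comment> \<open>The infimum over a random index set becomes one over all indices, with
    \<open>\<top>\<close> where no reset occurs.\<close>
  have *: "T y v = (INF k. if resets (chain y v k) (v !! k) then ennreal (jtime y v (Suc k)) else \<top>)" for y v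
    unfolding reset_set_eq
  proof (rule antisym)
    show "(INF k\<in>{k. resets (chain y v k) (v !! k)}. ennreal (jtime y v (Suc k))) \<le>
        (INF k. if resets (chain y v k) (v !! k) then ennreal (jtime y v (Suc k)) else \<top>)"
      by (rule INF_greatest) (auto intro: INF_lower)
    show "(INF k. if resets (chain y v k) (v !! k) then ennreal (jtime y v (Suc k)) else \<top>) \<le>
        (INF k\<in>{k. resets (chain y v k) (v !! k)}. ennreal (jtime y v (Suc k)))"
    proof (rule INF_greatest)
      fix k assume "k \<in> {k. resets (chain y v k) (v !! k)}"
      then show "(INF k. if resets (chain y v k) (v !! k) then ennreal (jtime y v (Suc k)) else \<top>) \<le>
          ennreal (jtime y v (Suc k))"
        by (intro INF_lower2[of k]) auto
    qed
  qed
  show ?thesis unfolding * by measurable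
qed

lemma nn_integral_noise:
  assumes [measurable]: "f \<in> borel_measurable borel"
  shows "(\<integral>\<^sup>+p. f p \<partial>noise) =
    (\<integral>\<^sup>+z. (\<integral>\<^sup>+u. f (u, z) * ennreal (exponential_density 1 u) \<partial>lborel) \<partial>mark)"
proof -
  interpret E: prob_space "density lborel (exponential_density 1)"
    by (rule prob_space_exponential_density) simp
  interpret pair_sigma_finite "density lborel (exponential_density 1)" mark ..
  have [measurable]: "f \<in> borel_measurable noise"
    by measurable
  then have "(\<integral>\<^sup>+p. f p \<partial>noise) = (\<integral>\<^sup>+z. (\<integral>\<^sup>+u. f (u, z) \<partial>density lborel (exponential_density 1)) \<partial>mark)"
    unfolding noise_def by (rule nn_integral_snd[symmetric])
  also have "\<dots> = (\<integral>\<^sup>+z. (\<integral>\<^sup>+u. f (u, z) * ennreal (exponential_density 1 u) \<partial>lborel) \<partial>mark)"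
  proof (rule nn_integral_cong)
    fix z
    have [measurable]: "(\<lambda>u. f (u, z)) \<in> borel_measurable borel"
      by (rule measurable_compose[OF _ assms]) (auto simp: borel_prod[symmetric])
    show "(\<integral>\<^sup>+u. f (u, z) \<partial>density lborel (exponential_density 1)) = (\<integral>\<^sup>+u. f (u, z) * ennreal (exponential_density 1 u) \<partial>lborel)"
      by (subst nn_integral_density) (auto simp: mult.commute intro!: borel_measurable_erlang_density)
  qed
  finally show ?thesis .
qed

text \<open>Translating the exponential coordinate by \<open>\<eta>\<close> multiplies its density
  by \<open>exp (- \<eta>)\<close>; the independent mark is not affected.\<close>

lemma noise_memoryless:
  assumes [measurable]: "f \<in> borel_measurable borel" and "0 \<le> \<eta>"
  shows "(\<integral>\<^sup>+p. f (fst p - \<eta>, snd p) * indicator {p. \<eta> < fst p} p \<partial>noise) =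
    ennreal (exp (- \<eta>)) * (\<integral>\<^sup>+p. f p \<partial>noise)"
proof -
  note borel_prod[measurable_cong, symmetric]
  have [measurable]: "(\<lambda>p. f (fst p - \<eta>, snd p)) \<in> borel_measurable borel"
    by (rule measurable_compose[OF _ assms(1)]) (simp flip: borel_prod)
  have [measurable]: "{p :: real \<times> real. \<eta> < fst p} \<in> sets borel"
    using open_Collect_less[of "\<lambda>_. \<eta>" fst] by (auto intro!: borel_open continuous_intros)
  have [measurable]: "(\<lambda>u. f (u, z)) \<in> borel_measurable borel" for z
    by (rule measurable_compose[OF _ assms(1)]) (simp flip: borel_prod)
  have [measurable]: "(\<lambda>z. \<integral>\<^sup>+u. f (u, z) * ennreal (exponential_density 1 u) \<partial>lborel) \<in> borel_measurable mark"
  proof -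
    have "(\<lambda>(z, u). f (u, z)) \<in> borel_measurable (borel \<Otimes>\<^sub>M borel)"
      unfolding case_prod_beta by (rule measurable_compose[OF _ assms(1)]) (simp flip: borel_prod)
    then have [measurable]: "(\<lambda>p. f (snd p, fst p)) \<in> borel_measurable (mark \<Otimes>\<^sub>M lborel)"
      by (simp add: case_prod_beta cong: measurable_cong_sets)
    show ?thesis
      by (rule lborel.borel_measurable_nn_integral) (simp add: case_prod_beta)
  qed
  have "(\<integral>\<^sup>+p. f (fst p - \<eta>, snd p) * indicator {p. \<eta> < fst p} p \<partial>noise) =
      (\<integral>\<^sup>+z. (\<integral>\<^sup>+u. f (u - \<eta>, z) * indicator {p. \<eta> < fst p} (u, z) * ennreal (exponential_density 1 u) \<partial>lborel) \<partial>mark)"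
    by (subst nn_integral_noise) auto
  also have "\<dots> = (\<integral>\<^sup>+z. (\<integral>\<^sup>+u. ennreal (exp (- \<eta>)) * (f (u, z) * ennreal (exponential_density 1 u)) \<partial>lborel) \<partial>mark)"
  proof (rule nn_integral_cong)
    fix z
    have "(\<integral>\<^sup>+u. f (u - \<eta>, z) * indicator {p. \<eta> < fst p} (u, z) * ennreal (exponential_density 1 u) \<partial>lborel)
        = (\<integral>\<^sup>+u. f (u - \<eta>, z) * indicator {\<eta><..} u * ennreal (exponential_density 1 u) \<partial>lborel)"
      by (intro nn_integral_cong) (auto split: split_indicator)
    also have "\<dots> = (\<integral>\<^sup>+u. f (\<eta> + u - \<eta>, z) * indicator {\<eta><..} (\<eta> + u) * ennreal (exponential_density 1 (\<eta> + u)) \<partial>lborel)"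
      by (rule nn_integral_lborel_shift[symmetric]) measurable
    also have "\<dots> = (\<integral>\<^sup>+u. ennreal (exp (- \<eta>)) * (f (u, z) * ennreal (exponential_density 1 u)) \<partial>lborel)"
    proof (rule nn_integral_cong_AE)
      \<comment> \<open>At \<open>u = 0\<close> the strict indicator is 0 but the density is not; a
        single point is negligible.\<close>
      have "AE u in lborel. u \<noteq> (0 :: real)"
        by (rule AE_lborel_singleton)
      then show "AE u in lborel. f (\<eta> + u - \<eta>, z) * indicator {\<eta><..} (\<eta> + u) * ennreal (exponential_density 1 (\<eta> + u))
          = ennreal (exp (- \<eta>)) * (f (u, z) * ennreal (exponential_density 1 u))"
      proof eventually_elim
        case (elim u)
        have "exp (- (\<eta> + u)) = exp (- \<eta>) * exp (- u)"
          by (simp add: mult_exp_exp)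
        with elim show ?case
          using \<open>0 \<le> \<eta>\<close> by (auto simp: exponential_density_def ennreal_mult mult_ac)
      qed
    qed
    finally show "(\<integral>\<^sup>+u. f (u - \<eta>, z) * indicator {p. \<eta> < fst p} (u, z) * ennreal (exponential_density 1 u) \<partial>lborel)
        = (\<integral>\<^sup>+u. ennreal (exp (- \<eta>)) * (f (u, z) * ennreal (exponential_density 1 u)) \<partial>lborel)" .
  qed
  also have "\<dots> = ennreal (exp (- \<eta>)) * (\<integral>\<^sup>+p. f p \<partial>noise)"
    by (simp add: nn_integral_cmult nn_integral_noise)
  finally show ?thesis .
qed

subsection \<open>Memorylessness\<close>

abbreviation cumul :: "state \<Rightarrow> real \<Rightarrow> real" where
  "cumul y t \<equiv> cum \<alpha> \<beta> (snd y) t"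

abbreviation flw :: "state \<Rightarrow> real \<Rightarrow> state" where
  "flw y t \<equiv> flow \<alpha> \<beta> y t"

text \<open>The first noise pair as seen at time \<open>s\<close> before the jump: the rate
  accumulated so far is subtracted from the level and the mark is still to come.\<close>

definition residual :: "state \<Rightarrow> real \<Rightarrow> real \<times> real \<Rightarrow> real \<times> real" where
  "residual y s p = (fst p - cumul y s, snd p)"

lemma hold_residual:
  assumes "y \<in> space S" "0 \<le> s" "s < hold y p"
  shows "hold (flw y s) (residual y s p) = hold y p - s"
proof -
  have iff: "t < hold (flw y s) (residual y s p) \<longleftrightarrow> t < hold y p - s" if "0 \<le> t" for t
  proof -
    have "t < hold (flw y s) (residual y s p) \<longleftrightarrow> cumul y (s + t) < fst p"
      using assms that flow_in_S[of y s]
      by (subst less_hold_iff) (auto simp: residual_def flow_def cum_add)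
    also have "\<dots> \<longleftrightarrow> t < hold y p - s"
      using assms that by (subst less_hold_iff[symmetric]) auto
    finally show ?thesis .
  qed
  have "0 \<le> hold (flw y s) (residual y s p)"
    using assms by (intro hold_nonneg flow_in_S)
  \<comment> \<open>Two nonnegative numbers that exceed the same nonnegative times are equal;
    testing at the two numbers themselves suffices.\<close>
  from iff[OF this] iff[of "hold y p - s"] assms show ?thesis by auto
qed

lemma pre_residual:
  assumes "y \<in> space S" "0 \<le> s" "s < hold y p"
  shows "before_jump \<alpha> \<beta> (flw y s) (fst (residual y s p)) = before_jump \<alpha> \<beta> y (fst p)"
  unfolding before_jump_eq using flow_add[of y s "hold y p - s"] hold_residual[OF assms] by simp

lemma step_residual:
  assumes "y \<in> space S" "0 \<le> s" "s < hold y p"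
  shows "step (flw y s) (residual y s p) = step y p"
  using pre_residual[OF assms] by (simp add: step_def) (simp add: residual_def)

lemma resets_residual:
  assumes "y \<in> space S" "0 \<le> s" "s < hold y p"
  shows "resets (flw y s) (residual y s p) = resets y p"
  using pre_residual[OF assms] by (simp add: resets_def) (simp add: residual_def)

lemma path_flow: "y \<in> space S \<Longrightarrow> 0 \<le> t \<Longrightarrow> t < hold y (shd w) \<Longrightarrow> path y w t = flw y t"
  by (simp add: path_rec)

lemma path_shift:
  "y \<in> space S \<Longrightarrow> 0 \<le> t \<Longrightarrow> path y w (hold y (shd w) + t) = path (step y (shd w)) (stl w) t"
  using hold_nonneg[of y "shd w"] by (simp add: path_rec[of y "hold y (shd w) + t"])

text \<open>Restarting from \<open>flw y s\<close> with the residual noise shortens the pending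
  holding time by \<open>s\<close> and leads to the same state after the jump.\<close>

lemma path_memoryless:
  assumes "y \<in> space S" "0 \<le> s" "s < hold y (shd w)" "0 \<le> t"
  shows "path y w (s + t) = path (flw y s) (residual y s (shd w) ## stl w) t"
proof -
  have "path y w (s + t) = (if s + t < hold y (shd w) then flw y (s + t)
      else path (step y (shd w)) (stl w) (s + t - hold y (shd w)))"
    using assms by (intro path_rec) auto
  also have "\<dots> = (if t < hold y (shd w) - s then flw (flw y s) t
      else path (step y (shd w)) (stl w) (t - (hold y (shd w) - s)))"
    by (auto simp: flow_add less_diff_eq add.commute add_diff_eq diff_diff_eq2)
  also have "\<dots> = path (flw y s) (residual y s (shd w) ## stl w) t"
    using assms by (simp add: path_rec[of "flw y s"] flow_in_S hold_residual step_residual)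
  finally show ?thesis .
qed

lemma T_memoryless:
  assumes "y \<in> space S" "0 \<le> s" "s < hold y (shd w)"
  shows "T y w = ennreal s + T (flw y s) (residual y s (shd w) ## stl w)"
proof -
  have "T (flw y s) (residual y s (shd w) ## stl w) = ennreal (hold y (shd w) - s) +
      (if resets y (shd w) then 0 else T (step y (shd w)) (stl w))"
    using assms by (simp only: T_rec[OF flow_in_S] stream.sel hold_residual step_residual resets_residual)
  moreover have "ennreal (hold y (shd w)) = ennreal s + ennreal (hold y (shd w) - s)"
    using assms by (subst ennreal_plus[symmetric]) auto
  ultimately show ?thesis
    by (simp only: T_rec[OF assms(1), of w] add.assoc)
qed

text \<open>No jump up to \<open>s\<close> means that the exponential level exceeds
  \<open>cumul y s\<close>. Given this event, the residual noise has the original law, and the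
  probability of the event is the factor in front.\<close>

lemma nn_integral_hold_gt:
  assumes "y \<in> space S" "0 \<le> s" and [measurable]: "h \<in> borel_measurable N"
  shows "(\<integral>\<^sup>+w. h (residual y s (shd w) ## stl w) * indicator {w. s < hold y (shd w)} w \<partial>N)
    = ennreal (exp (- cumul y s)) * (\<integral>\<^sup>+w. h w \<partial>N)"
proof -
  have 0: "0 \<le> cumul y s"
    using cum_bounds(1)[OF assms(1,2)] lam0 assms(2) mult_nonneg_nonneg[of lam0 s] by linarith
  have [measurable]: "(\<lambda>p. residual y s p) \<in> borel \<rightarrow>\<^sub>M borel"
    unfolding residual_def by measurable
  have [measurable]: "{w. s < hold y (shd w)} \<in> sets N"
  proof -
    have "{w \<in> space N. s < hold y (shd w)} \<in> sets N"
      using assms(1) by measurable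
    then show ?thesis by simp
  qed
  have [measurable]: "(\<lambda>p. \<integral>\<^sup>+w. h (p ## w) \<partial>N) \<in> borel_measurable borel"
    by measurable
  have "(\<integral>\<^sup>+w. h (residual y s (shd w) ## stl w) * indicator {w. s < hold y (shd w)} w \<partial>N)
      = (\<integral>\<^sup>+p. (\<integral>\<^sup>+w. h (residual y s p ## w) * indicator {w. s < hold y (shd w)} (p ## w) \<partial>N) \<partial>noise)"
    by (subst nn_integral_N) simp_all
  also have "\<dots> = (\<integral>\<^sup>+p. (\<lambda>p. \<integral>\<^sup>+w. h (p ## w) \<partial>N) (fst p - cumul y s, snd p) * indicator {p. cumul y s < fst p} p \<partial>noise)"
    using assms by (intro nn_integral_cong) (auto simp: residual_def less_hold_iff split: split_indicator)
  also have "\<dots> = ennreal (exp (- cumul y s)) * (\<integral>\<^sup>+p. (\<integral>\<^sup>+w. h (p ## w) \<partial>N) \<partial>noise)"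
    by (rule noise_memoryless[where f = "\<lambda>p. \<integral>\<^sup>+w. h (p ## w) \<partial>N" and \<eta> = "cumul y s"]) (use 0 in simp_all)
  also have "(\<integral>\<^sup>+p. (\<integral>\<^sup>+w. h (p ## w) \<partial>N) \<partial>noise) = (\<integral>\<^sup>+w. h w \<partial>N)"
    by (rule nn_integral_N[symmetric]) simp
  finally show ?thesis .
qed

text \<open>Before the first jump, \<open>\<Gamma> w s\<close> is a functional of the process
  restarted at time \<open>s\<close>. Under the integral it may be replaced by its mean over fresh
  noise started from \<open>flw y s\<close>: exchange the integrals and use memorylessness for each
  \<open>s\<close>.\<close>

lemma nn_integral_along_flow:
  assumes y: "y \<in> space S"
    and [measurable]: "a \<in> borel_measurable borel"
    and Xi [measurable]: "(\<lambda>(y, w). \<Xi> y w) \<in> borel_measurable (S \<Otimes>\<^sub>M N)"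
    and Ga [measurable]: "(\<lambda>(w, s). \<Gamma> w s) \<in> borel_measurable (N \<Otimes>\<^sub>M lborel)"
    and eq: "\<And>w s. 0 \<le> s \<Longrightarrow> s < hold y (shd w) \<Longrightarrow> \<Gamma> w s = \<Xi> (flw y s) (residual y s (shd w) ## stl w)"
  shows "(\<integral>\<^sup>+w. (\<integral>\<^sup>+s\<in>{0..<hold y (shd w)}. a s * \<Gamma> w s \<partial>lborel) \<partial>N) =
    (\<integral>\<^sup>+w. (\<integral>\<^sup>+s\<in>{0..<hold y (shd w)}. a s * (\<integral>\<^sup>+w'. \<Xi> (flw y s) w' \<partial>N) \<partial>lborel) \<partial>N)"
proof -
  interpret pair_sigma_finite N lborel ..
  \<comment> \<open>Clamping at 0 keeps the starting point in the state space, so that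
    \<open>X\<close> is measurable on the whole line.\<close>
  define X where "X s = (\<integral>\<^sup>+w'. \<Xi> (flw y (max 0 s)) w' \<partial>N)" for s
  have [measurable]: "(\<lambda>s. flw y (max 0 s)) \<in> borel \<rightarrow>\<^sub>M S"
    using y by (intro flow_measurable) auto
  have [measurable]: "(\<lambda>x. \<Xi> (f x) (g x)) \<in> borel_measurable M"
    if "f \<in> M \<rightarrow>\<^sub>M S" "g \<in> M \<rightarrow>\<^sub>M N" for M and f :: "'x \<Rightarrow> state" and g
    using measurable_compose[OF measurable_Pair[OF that] Xi] by simp
  have [measurable]: "X \<in> borel_measurable borel"
    unfolding X_def by measurable
  have [measurable]: "(\<lambda>p. hold y (shd (fst p))) \<in> borel_measurable (N \<Otimes>\<^sub>M lborel)"
    using y by measurable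
  have cond: "0 \<le> s \<and> s < hold y (shd w) \<longleftrightarrow> 0 \<le> s \<and> w \<in> {w. s < hold y (shd w)}" for s w
    by simp
  have inner: "(\<integral>\<^sup>+w. a s * \<Gamma> w s * indicator {0..<hold y (shd w)} s \<partial>N) =
      (\<integral>\<^sup>+w. a s * X s * indicator {0..<hold y (shd w)} s \<partial>N)" for s
  proof (cases "0 \<le> s")
    case True
    have [measurable]: "\<Xi> (flw y s) \<in> borel_measurable N"
      using flow_in_S[OF y True] measurable_Pair2[OF Xi, of "flw y s"] by simp
    have [measurable]: "(\<lambda>w. \<Gamma> w s) \<in> borel_measurable N"
      using measurable_Pair1[OF Ga, of s] by simp
    have [measurable]: "{w. s < hold y (shd w)} \<in> sets N"
    proof -
      have "{w \<in> space N. s < hold y (shd w)} \<in> sets N"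
        using y by measurable
      then show ?thesis by simp
    qed
    have [measurable]: "(\<lambda>w. residual y s (shd w) ## stl w) \<in> N \<rightarrow>\<^sub>M N"
      unfolding residual_def by measurable
    have "(\<integral>\<^sup>+w. a s * \<Gamma> w s * indicator {0..<hold y (shd w)} s \<partial>N) =
        (\<integral>\<^sup>+w. a s * (\<Xi> (flw y s) (residual y s (shd w) ## stl w) * indicator {w. s < hold y (shd w)} w) \<partial>N)"
      using True eq by (intro nn_integral_cong) (auto split: split_indicator)
    also have "\<dots> = a s * (ennreal (exp (- cumul y s)) * X s)"
      using True y by (simp add: nn_integral_cmult nn_integral_hold_gt X_def)
    \<comment> \<open>The survival factor is read backwards as the probability that the holding time
      exceeds \<open>s\<close>, by the same identity for the constant functional.\<close>
    also have "\<dots> = a s * X s * (\<integral>\<^sup>+w. 1 * indicator {w. s < hold y (shd w)} w \<partial>N)"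
      using nn_integral_hold_gt[OF y True, of "\<lambda>_. 1"] by (simp add: N.emeasure_space_1[simplified] mult_ac)
    also have "\<dots> = (\<integral>\<^sup>+w. a s * X s * indicator {0..<hold y (shd w)} s \<partial>N)"
      using True by (subst nn_integral_cmult[symmetric]) (auto intro!: nn_integral_cong split: split_indicator)
    finally show ?thesis .
  qed simp
  have "(\<integral>\<^sup>+w. (\<integral>\<^sup>+s\<in>{0..<hold y (shd w)}. a s * \<Gamma> w s \<partial>lborel) \<partial>N) =
      (\<integral>\<^sup>+s. (\<integral>\<^sup>+w. a s * \<Gamma> w s * indicator {0..<hold y (shd w)} s \<partial>N) \<partial>lborel)"
    by (rule Fubini'[symmetric]) measurable
  also have "\<dots> = (\<integral>\<^sup>+w. (\<integral>\<^sup>+s. a s * X s * indicator {0..<hold y (shd w)} s \<partial>lborel) \<partial>N)"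
    unfolding inner by (rule Fubini') measurable
  also have "\<dots> = (\<integral>\<^sup>+w. (\<integral>\<^sup>+s\<in>{0..<hold y (shd w)}. a s * (\<integral>\<^sup>+w'. \<Xi> (flw y s) w' \<partial>N) \<partial>lborel) \<partial>N)"
    by (intro nn_integral_cong) (auto simp: X_def split: split_indicator)
  finally show ?thesis .
qed

section \<open>Non-explosion\<close>

text \<open>Splitting off the first term multiplies the mean of \<open>exp (- R)\<close> by
  \<open>q < 1\<close>, so this mean is 0 and \<open>R\<close> is almost surely infinite.\<close>

lemma AE_noise_sum: "AE w in N. (\<Sum>i. ennreal (fst (w !! i))) = \<infinity>"
proof -
  define R where "R w = (\<Sum>i. ennreal (fst (w !! i)))" for w :: "(real \<times> real) stream"
  have [measurable]: "R \<in> borel_measurable N"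
    unfolding R_def by measurable
  have R: "R (p ## w) = ennreal (fst p) + R w" for p w
    unfolding R_def using suminf_offset[of "\<lambda>i. ennreal (fst ((p ## w) !! i))" 1] by (simp add: Stream_snth)
  define x where "x = (\<integral>\<^sup>+w. discount 1 (R w) \<partial>N)"
  define q where "q = (\<integral>\<^sup>+p. discount 1 (ennreal (fst p)) \<partial>noise)"
  \<comment> \<open>By Markov's inequality the level has mean at least \<open>exp (- 1)\<close>,
    which makes \<open>q < 1\<close>.\<close>
  have "(\<integral>\<^sup>+p. indicator {p. 1 < fst p} p \<partial>noise) \<le> (\<integral>\<^sup>+p. ennreal (fst p) \<partial>noise)"
    by (intro nn_integral_mono) (auto split: split_indicator)
  moreover have "(\<integral>\<^sup>+p. indicator {p. 1 < fst p} p \<partial>noise) = ennreal (exp (- 1))"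
    using noise_memoryless[of "\<lambda>_. 1" 1] by (simp add: noise.emeasure_space_1)
  ultimately have "q < 1"
    unfolding q_def by (intro noise.nn_integral_discount_less_1) auto
  moreover have "x = q * x"
  proof -
    have "x = (\<integral>\<^sup>+p. (\<integral>\<^sup>+w. discount 1 (ennreal (fst p)) * discount 1 (R w) \<partial>N) \<partial>noise)"
      unfolding x_def by (subst nn_integral_N) (simp_all add: R discount_add)
    also have "\<dots> = q * x"
      by (simp add: nn_integral_cmult nn_integral_multc x_def q_def)
    finally show ?thesis .
  qed
  moreover have "x < \<infinity>"
  proof -
    have "x \<le> (\<integral>\<^sup>+w. 1 \<partial>N)"
      unfolding x_def by (intro nn_integral_mono discount_le_1) auto
    then show ?thesis
      using N.emeasure_space_1 by (simp add: le_less_trans)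
  qed
  ultimately have "x = 0"
    by (intro ennreal_eq_mult_self_imp_0)
  then have "AE w in N. discount 1 (R w) = 0"
    unfolding x_def by (subst (asm) nn_integral_0_iff_AE) auto
  then show ?thesis by (simp add: discount_eq_0_iff R_def)
qed

text \<open>If all jump times stayed below \<open>t\<close>, then \<open>hold_ge\<close> would bound
  the noise sum by \<open>A * t\<close>. Thus the convention in \<open>path\<close> changes the
  process only on a null event.\<close>

lemma AE_no_explosion:
  assumes y: "y \<in> space S"
  shows "AE w in N. \<forall>t\<ge>0. path y w t = raw_path y w t"
  using AE_noise_sum
proof eventually_elim
  case (elim w)
  have "\<exists>k. t < jtime y w (Suc k)" for t
  proof (rule ccontr)
    assume "\<nexists>k. t < jtime y w (Suc k)"
    then have le: "jtime y w (Suc k) \<le> t" for k by (meson not_less)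
    have "(\<Sum>i<k. ennreal (fst (w !! i))) \<le> ennreal (A * t)" for k
    proof -
      have "(\<Sum>i<k. ennreal (fst (w !! i))) \<le> (\<Sum>i<k. ennreal (A * hold (chain y w i) (w !! i)))"
        using hold_ge[OF chain_in_S[OF y]] beta
        by (intro sum_mono ennreal_leI) (simp add: field_simps)
      also have "\<dots> = ennreal (A * jtime y w k)"
        using hold_nonneg[OF chain_in_S[OF y]] beta
        by (subst sum_ennreal) (auto simp: jtime_eq sum_distrib_left)
      also have "\<dots> \<le> ennreal (A * t)"
        using jtime_mono[OF y, of k "Suc k" w] le[of k] beta by (intro ennreal_leI mult_left_mono) auto
      finally show ?thesis .
    qed
    then have "(\<Sum>i. ennreal (fst (w !! i))) \<le> ennreal (A * t)"
      by (intro suminf_le_const) auto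
    with elim show False by (simp add: top_unique)
  qed
  then show ?case by (simp add: path_def)
qed

subsection \<open>Resolvents and the first-jump recursion\<close>

text \<open>The extended end \<open>b\<close> allows a reset time, \<open>\<infinity>\<close> or a
  reset time plus a constant; \<open>\<epsilon> = 0\<close> gives plain occupation
  integrals.\<close>

definition win :: "real \<Rightarrow> (state \<Rightarrow> ennreal) \<Rightarrow> ennreal \<Rightarrow> state \<Rightarrow> (real \<times> real) stream \<Rightarrow> ennreal" where
  "win \<epsilon> f b y w = (\<integral>\<^sup>+t\<in>{t. 0 \<le> t \<and> ennreal t < b}. ennreal (exp (- \<epsilon> * t)) * f (path y w t) \<partial>lborel)"

definition seg :: "real \<Rightarrow> (state \<Rightarrow> ennreal) \<Rightarrow> state \<Rightarrow> real \<times> real \<Rightarrow> ennreal" where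
  "seg \<epsilon> f y p = (\<integral>\<^sup>+t\<in>{0..<hold y p}. ennreal (exp (- \<epsilon> * t)) * f (flw y t) \<partial>lborel)"

text \<open>In the notation of the opening sketch, \<open>killed\<close>, \<open>resolvent\<close>,
  \<open>laplace\<close> and \<open>transition_op\<close> are \<open>U\<^sub>\<epsilon>\<close>,
  \<open>R\<^sub>\<epsilon>\<close>, \<open>s\<^sub>\<epsilon>\<close> and \<open>P\<^sub>t\<close>.
  With \<open>\<epsilon> = 0\<close> and start \<open>ystar\<close>, \<open>killed\<close> is
  integration against \<Pi>.\<close>

definition killed :: "real \<Rightarrow> (state \<Rightarrow> ennreal) \<Rightarrow> state \<Rightarrow> ennreal" where
  "killed \<epsilon> f y = (\<integral>\<^sup>+w. win \<epsilon> f (T y w) y w \<partial>N)"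

definition resolvent :: "real \<Rightarrow> (state \<Rightarrow> ennreal) \<Rightarrow> state \<Rightarrow> ennreal" where
  "resolvent \<epsilon> f y = (\<integral>\<^sup>+w. win \<epsilon> f \<infinity> y w \<partial>N)"

definition laplace :: "real \<Rightarrow> state \<Rightarrow> ennreal" where
  "laplace \<epsilon> y = (\<integral>\<^sup>+w. discount \<epsilon> (T y w) \<partial>N)"

definition transition_op :: "real \<Rightarrow> (state \<Rightarrow> ennreal) \<Rightarrow> state \<Rightarrow> ennreal" where
  "transition_op t f y = (\<integral>\<^sup>+w. f (path y w t) \<partial>N)"

lemma win_measurable [measurable (raw)]:
  assumes [measurable]: "f \<in> borel_measurable S" "b \<in> borel_measurable M" "y \<in> M \<rightarrow>\<^sub>M S" "w \<in> M \<rightarrow>\<^sub>M N"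
  shows "(\<lambda>x. win \<epsilon> f (b x) (y x) (w x)) \<in> borel_measurable M"
proof -
  have [measurable]: "(\<lambda>p. f (path (y (fst p)) (w (fst p)) (snd p))) \<in> borel_measurable (M \<Otimes>\<^sub>M lborel)"
    by (rule measurable_compose[OF _ assms(1)]) measurable
  show ?thesis
    unfolding win_def by measurable
qed

lemma seg_measurable [measurable (raw)]:
  assumes [measurable]: "f \<in> borel_measurable S" "y \<in> M \<rightarrow>\<^sub>M S" "p \<in> M \<rightarrow>\<^sub>M borel"
  shows "(\<lambda>x. seg \<epsilon> f (y x) (p x)) \<in> borel_measurable M"
proof -
  have [measurable]: "(\<lambda>q. f (flw (y (fst q)) (max 0 (snd q)))) \<in> borel_measurable (M \<Otimes>\<^sub>M lborel)"
    by (rule measurable_compose[OF _ assms(1)], rule flow_measurable) auto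
  have eq: "seg \<epsilon> f u v =
      (\<integral>\<^sup>+t\<in>{0..<hold u v}. ennreal (exp (- \<epsilon> * t)) * f (flw u (max 0 t)) \<partial>lborel)" for u v
    unfolding seg_def by (intro nn_integral_cong) (auto split: split_indicator)
  show ?thesis
    unfolding eq by measurable
qed

lemma killed_measurable [measurable]:
  assumes [measurable]: "f \<in> borel_measurable S"
  shows "killed \<epsilon> f \<in> borel_measurable S"
  unfolding killed_def[abs_def] by measurable

lemma resolvent_measurable [measurable]:
  assumes [measurable]: "f \<in> borel_measurable S"
  shows "resolvent \<epsilon> f \<in> borel_measurable S"
  unfolding resolvent_def[abs_def] by measurable

lemma laplace_measurable [measurable]: "laplace \<epsilon> \<in> borel_measurable S"
  unfolding laplace_def[abs_def] by measurable

lemma transition_op_measurable [measurable (raw)]: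
  assumes [measurable]: "f \<in> borel_measurable S" "t \<in> borel_measurable M" "y \<in> M \<rightarrow>\<^sub>M S"
  shows "(\<lambda>x. transition_op (t x) f (y x)) \<in> borel_measurable M"
proof -
  have [measurable]: "(\<lambda>p. f (path (y (fst p)) (snd p) (t (fst p)))) \<in> borel_measurable (M \<Otimes>\<^sub>M N)"
    by (rule measurable_compose[OF _ assms(1)]) measurable
  show ?thesis
    unfolding transition_op_def by measurable
qed

lemma path_fun_measurable:
  assumes "f \<in> borel_measurable S" "y \<in> M \<rightarrow>\<^sub>M S" "w \<in> M \<rightarrow>\<^sub>M N" "t \<in> borel_measurable M"
  shows "(\<lambda>x. f (path (y x) (w x) (t x))) \<in> borel_measurable M"
  by (rule measurable_compose[OF path_measurable assms(1)]) (use assms in auto)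

text \<open>The end of the window is written as the first holding time plus a remainder
  \<open>b\<close>, to match the recursion of the reset time.\<close>

lemma win_rec:
  assumes y: "y \<in> space S" and [measurable]: "f \<in> borel_measurable S"
  shows "win \<epsilon> f (ennreal (hold y (shd w)) + b) y w =
    seg \<epsilon> f y (shd w) + ennreal (exp (- \<epsilon> * hold y (shd w))) * win \<epsilon> f b (step y (shd w)) (stl w)"
proof -
  let ?h = "hold y (shd w)"
  have [measurable]: "(\<lambda>t. f (path z v t)) \<in> borel_measurable borel" if "z \<in> space S" for z v
    using that by (intro path_fun_measurable) auto
  note [measurable] = this[OF y] this[OF step_in_S[OF y]]
  have "win \<epsilon> f (ennreal ?h + b) y w =
      (\<integral>\<^sup>+t\<in>{0..<?h}. ennreal (exp (- \<epsilon> * t)) * f (path y w t) \<partial>lborel) +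
      (\<integral>\<^sup>+t\<in>{t. 0 \<le> t \<and> ennreal t < b}. ennreal (exp (- \<epsilon> * (?h + t))) * f (path y w (?h + t)) \<partial>lborel)"
    unfolding win_def by (rule nn_integral_split_at) (auto simp: hold_nonneg y)
  also have "(\<integral>\<^sup>+t\<in>{0..<?h}. ennreal (exp (- \<epsilon> * t)) * f (path y w t) \<partial>lborel) = seg \<epsilon> f y (shd w)"
    unfolding seg_def using y by (intro nn_integral_cong) (auto simp: path_flow split: split_indicator)
  also have "(\<integral>\<^sup>+t\<in>{t. 0 \<le> t \<and> ennreal t < b}. ennreal (exp (- \<epsilon> * (?h + t))) * f (path y w (?h + t)) \<partial>lborel)
      = (\<integral>\<^sup>+t. ennreal (exp (- \<epsilon> * ?h)) * (ennreal (exp (- \<epsilon> * t)) * f (path (step y (shd w)) (stl w) t) *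
          indicator {t. 0 \<le> t \<and> ennreal t < b} t) \<partial>lborel)"
  proof (rule nn_integral_cong)
    fix t :: real
    have "exp (- \<epsilon> * (?h + t)) = exp (- \<epsilon> * ?h) * exp (- \<epsilon> * t)"
      by (simp add: mult_exp_exp algebra_simps)
    then show "ennreal (exp (- \<epsilon> * (?h + t))) * f (path y w (?h + t)) * indicator {t. 0 \<le> t \<and> ennreal t < b} t =
        ennreal (exp (- \<epsilon> * ?h)) * (ennreal (exp (- \<epsilon> * t)) * f (path (step y (shd w)) (stl w) t) *
          indicator {t. 0 \<le> t \<and> ennreal t < b} t)"
      using y by (simp add: path_shift ennreal_mult mult.assoc split: split_indicator)
  qed
  also have "\<dots> = ennreal (exp (- \<epsilon> * ?h)) * win \<epsilon> f b (step y (shd w)) (stl w)"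
    unfolding win_def by (rule nn_integral_cmult) measurable
  finally show ?thesis .
qed

lemma win_0 [simp]: "win \<epsilon> f 0 y w = 0"
  by (simp add: win_def)

text \<open>The first noise pair is independent of the rest, so the factor in \<open>stl w\<close>
  may be replaced by its mean. This is how fresh noise after a reset is averaged out.\<close>

lemma nn_integral_shd_stl:
  assumes [measurable]: "a \<in> borel_measurable borel" "b \<in> borel_measurable N"
  shows "(\<integral>\<^sup>+w. a (shd w) * b (stl w) \<partial>N) = (\<integral>\<^sup>+w. a (shd w) * (\<integral>\<^sup>+w. b w \<partial>N) \<partial>N)"
proof -
  have "(\<integral>\<^sup>+w. a (shd w) * b (stl w) \<partial>N) = (\<integral>\<^sup>+p. a p * (\<integral>\<^sup>+w. b w \<partial>N) \<partial>noise)"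
    by (subst nn_integral_N) (simp_all add: nn_integral_cmult)
  also have "\<dots> = (\<integral>\<^sup>+w. a (shd w) * (\<integral>\<^sup>+w. b w \<partial>N) \<partial>N)"
    by (subst (2) nn_integral_N) (simp_all add: N.emeasure_space_1[simplified])
  finally show ?thesis .
qed

text \<open>With positive probability there is no jump up to time 1, and a reset cannot precede the
  first jump.\<close>

lemma nn_integral_T_pos:
  assumes y: "y \<in> space S"
  shows "(\<integral>\<^sup>+w. T y w \<partial>N) \<noteq> 0"
proof -
  have [measurable]: "{w. 1 < hold y (shd w)} \<in> sets N"
  proof -
    have "{w \<in> space N. 1 < hold y (shd w)} \<in> sets N"
      using y by measurable
    then show ?thesis by simp
  qed
  have "0 < ennreal (exp (- cumul y 1))" by simp
  also have "\<dots> = (\<integral>\<^sup>+w. 1 * indicator {w. 1 < hold y (shd w)} w \<partial>N)"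
    using nn_integral_hold_gt[OF y, of 1 "\<lambda>_. 1"] N.emeasure_space_1 by simp
  also have "\<dots> \<le> (\<integral>\<^sup>+w. T y w \<partial>N)"
    using hold_nonneg[OF y]
    by (intro nn_integral_mono) (auto simp: T_rec[OF y] intro!: add_increasing2 split: split_indicator)
  finally show ?thesis by simp
qed

lemma laplace_less_1: "y \<in> space S \<Longrightarrow> 0 < \<epsilon> \<Longrightarrow> laplace \<epsilon> y < 1"
  unfolding laplace_def using nn_integral_T_pos
  by (intro N.nn_integral_discount_less_1) auto

lemma laplace_le_1: "0 \<le> \<epsilon> \<Longrightarrow> laplace \<epsilon> y \<le> 1"
proof -
  assume "0 \<le> \<epsilon>"
  then have "laplace \<epsilon> y \<le> (\<integral>\<^sup>+w. 1 \<partial>N)"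
    unfolding laplace_def by (intro nn_integral_mono discount_le_1)
  then show ?thesis using N.emeasure_space_1 by simp
qed

end

section \<open>Renewal at the first reset\<close>

locale recurrent_pdmp = resetting_pdmp +
  assumes T_finite: "\<And>y. y \<in> space S \<Longrightarrow> AE w in N. T y w < \<infinity>"
begin

lemma reset_exists:
  assumes "T y w < \<infinity>"
  obtains n where "resets (chain y w n) (w !! n)"
  using assms unfolding reset_set_eq by force

text \<open>Unrolling the recursion gives a series in the source plus a remainder carrying a product
  of weights. The weight of a resetting jump is 0 and a reset occurs almost surely, so the remainder
  is eventually 0. The two series have equal means term by term.\<close>

lemma renewal_unique:
  assumes c [measurable]: "(\<lambda>(y, p). c y p) \<in> borel_measurable (S \<Otimes>\<^sub>M borel)"
    and meas [measurable]: "(\<lambda>(y, w). G1 y w) \<in> borel_measurable (S \<Otimes>\<^sub>M N)"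
      "(\<lambda>(y, w). G2 y w) \<in> borel_measurable (S \<Otimes>\<^sub>M N)"
    and c0: "\<And>y p. resets y p \<Longrightarrow> c y p = (0 :: ennreal)"
    and eq1: "\<And>y w. y \<in> space S \<Longrightarrow> \<Phi>1 y w = G1 y w + c y (shd w) * \<Phi>1 (step y (shd w)) (stl w)"
    and eq2: "\<And>y w. y \<in> space S \<Longrightarrow> \<Phi>2 y w = G2 y w + c y (shd w) * \<Phi>2 (step y (shd w)) (stl w)"
    and G: "\<And>y. y \<in> space S \<Longrightarrow> (\<integral>\<^sup>+w. G1 y w \<partial>N) = (\<integral>\<^sup>+w. G2 y w \<partial>N)"
    and y: "y \<in> space S"
  shows "(\<integral>\<^sup>+w. \<Phi>1 y w \<partial>N) = (\<integral>\<^sup>+w. \<Phi>2 y w \<partial>N)"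
proof -
  \<comment> \<open>One step of the recursion without its source: weigh the first jump and pass to
    the path after it.\<close>
  define L where "L \<Psi> y w = c y (shd w) * \<Psi> (step y (shd w)) (stl w)"
    for \<Psi> :: "state \<Rightarrow> (real \<times> real) stream \<Rightarrow> ennreal" and y w
  have L_Suc: "(L ^^ Suc k) \<Psi> y w = c y (shd w) * (L ^^ k) \<Psi> (step y (shd w)) (stl w)" for k \<Psi> y w
    unfolding funpow.simps comp_apply by (subst L_def) (rule refl)
  \<comment> \<open>A product of more than \<open>n\<close> weights contains the weight of jump
    number \<open>n\<close> (counted from 0), which resets.\<close>
  have L0: "(L ^^ m) \<Psi> y w = 0" if "resets (chain y w n) (w !! n)" "n < m" for \<Psi> m n y w
    using that
  proof (induction n arbitrary: y w m)
    case 0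
    then obtain m' where "m = Suc m'" by (cases m) auto
    with 0 show ?case by (simp add: L_def c0)
  next
    case (Suc n)
    then obtain m' where "m = Suc m'" by (cases m) auto
    with Suc show ?case by (simp add: L_def chain_Suc)
  qed
  have unroll: "\<Phi> y w = (\<Sum>k<n. (L ^^ k) H y w) + (L ^^ n) \<Phi> y w"
    if "\<And>y w. y \<in> space S \<Longrightarrow> \<Phi> y w = H y w + c y (shd w) * \<Phi> (step y (shd w)) (stl w)" "y \<in> space S"
    for \<Phi> H n y w
    using that(2)
  proof (induction n arbitrary: y w)
    case (Suc n)
    have "\<Phi> y w = H y w + c y (shd w) * \<Phi> (step y (shd w)) (stl w)"
      by (rule that(1)) fact
    also have "\<Phi> (step y (shd w)) (stl w) =
        (\<Sum>k<n. (L ^^ k) H (step y (shd w)) (stl w)) + (L ^^ n) \<Phi> (step y (shd w)) (stl w)"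
      by (intro Suc step_in_S)
    finally show ?case
      by (subst sum.lessThan_Suc_shift) (simp add: L_def distrib_left sum_distrib_left add.assoc)
  qed simp
  have series: "(\<integral>\<^sup>+w. \<Phi> y w \<partial>N) = (\<Sum>k. \<integral>\<^sup>+w. (L ^^ k) H y w \<partial>N)"
    if "\<And>y w. y \<in> space S \<Longrightarrow> \<Phi> y w = H y w + c y (shd w) * \<Phi> (step y (shd w)) (stl w)"
      "\<And>k. (L ^^ k) H y \<in> borel_measurable N" for \<Phi> H
  proof -
    have "AE w in N. \<Phi> y w = (\<Sum>k. (L ^^ k) H y w)"
      using T_finite[OF y]
    proof eventually_elim
      case (elim w)
      then obtain n where n: "resets (chain y w n) (w !! n)" by (rule reset_exists)
      have "(\<Sum>k. (L ^^ k) H y w) = (\<Sum>k<Suc n. (L ^^ k) H y w)"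
        using L0[OF n] by (intro suminf_finite) auto
      also have "\<dots> = \<Phi> y w"
        using unroll[OF that(1) y, where n1 = "Suc n"] L0[OF n, of "Suc n"] by simp
      finally show ?case by simp
    qed
    then have "(\<integral>\<^sup>+w. \<Phi> y w \<partial>N) = (\<integral>\<^sup>+w. (\<Sum>k. (L ^^ k) H y w) \<partial>N)"
      by (rule nn_integral_cong_AE)
    also have "\<dots> = (\<Sum>k. \<integral>\<^sup>+w. (L ^^ k) H y w \<partial>N)"
      by (intro nn_integral_suminf that)
    finally show ?thesis .
  qed
  have meas_L: "(\<lambda>(y, w). (L ^^ k) H y w) \<in> borel_measurable (S \<Otimes>\<^sub>M N)"
    if "(\<lambda>(y, w). H y w) \<in> borel_measurable (S \<Otimes>\<^sub>M N)" for H k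
  proof (induction k)
    case (Suc k)
    have "(\<lambda>p. (L ^^ k) H (step (fst p) (shd (snd p))) (stl (snd p))) \<in> borel_measurable (S \<Otimes>\<^sub>M N)"
      using measurable_compose[OF _ Suc, of "\<lambda>p. (step (fst p) (shd (snd p)), stl (snd p))"] by simp
    moreover have "(\<lambda>p. c (fst p) (shd (snd p))) \<in> borel_measurable (S \<Otimes>\<^sub>M N)"
      using measurable_compose[OF _ c, of "\<lambda>p. (fst p, shd (snd p))"] by simp
    ultimately show ?case
      unfolding L_Suc by (simp add: case_prod_beta)
  qed (use that in simp)
  have meas_L': "(L ^^ k) H y \<in> borel_measurable N"
    if "(\<lambda>(y, w). H y w) \<in> borel_measurable (S \<Otimes>\<^sub>M N)" "y \<in> space S" for H k y
    using measurable_Pair2[OF meas_L[OF that(1)] that(2)] by simp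
  \<comment> \<open>The first noise pair is integrated last: it only weighs the mean of the previous
    term at the state after the jump, and at \<open>k = 0\<close> the means of the sources
    agree.\<close>
  have "(\<integral>\<^sup>+w. (L ^^ k) G1 y w \<partial>N) = (\<integral>\<^sup>+w. (L ^^ k) G2 y w \<partial>N)" if "y \<in> space S" for k y
    using that
  proof (induction k arbitrary: y)
    case 0
    then show ?case by (simp add: G)
  next
    case (Suc k)
    have "(\<integral>\<^sup>+w. (L ^^ Suc k) H y w \<partial>N) = (\<integral>\<^sup>+p. c y p * (\<integral>\<^sup>+w. (L ^^ k) H (step y p) w \<partial>N) \<partial>noise)"
      if H: "(\<lambda>(y, w). H y w) \<in> borel_measurable (S \<Otimes>\<^sub>M N)" for H
      using meas_L'[OF H Suc.prems, of "Suc k"] meas_L'[OF H step_in_S[OF Suc.prems], of k]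
      by (subst nn_integral_N) (simp_all add: L_def nn_integral_cmult)
    from this[OF meas(1)] this[OF meas(2)] show ?case
      by (simp add: Suc.IH step_in_S Suc.prems del: funpow.simps)
  qed
  then show ?thesis
    using y meas by (simp add: series[OF eq1 meas_L'] series[OF eq2 meas_L'])
qed

text \<open>The discount over the first holding interval is split by whether the jump ending it
  resets. \<open>surv_weight\<close> vanishes at a reset and so can serve as the weight
  \<open>c\<close> in \<open>renewal_unique\<close>.\<close>

definition surv_weight :: "real \<Rightarrow> state \<Rightarrow> real \<times> real \<Rightarrow> ennreal" where
  "surv_weight \<epsilon> y p = (if resets y p then 0 else ennreal (exp (- \<epsilon> * hold y p)))"

definition reset_weight :: "real \<Rightarrow> state \<Rightarrow> real \<times> real \<Rightarrow> ennreal" where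
  "reset_weight \<epsilon> y p = (if resets y p then ennreal (exp (- \<epsilon> * hold y p)) else 0)"

lemma surv_weight_measurable [measurable (raw)]:
  assumes [measurable]: "f \<in> M \<rightarrow>\<^sub>M S" "g \<in> M \<rightarrow>\<^sub>M borel"
  shows "(\<lambda>x. surv_weight \<epsilon> (f x) (g x)) \<in> borel_measurable M"
  unfolding surv_weight_def by measurable

lemma reset_weight_measurable [measurable (raw)]:
  assumes [measurable]: "f \<in> M \<rightarrow>\<^sub>M S" "g \<in> M \<rightarrow>\<^sub>M borel"
  shows "(\<lambda>x. reset_weight \<epsilon> (f x) (g x)) \<in> borel_measurable M"
  unfolding reset_weight_def by measurable

lemma surv_weight_measurable_pair: "(\<lambda>(y, p). surv_weight \<epsilon> y p) \<in> borel_measurable (S \<Otimes>\<^sub>M borel)"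
  unfolding case_prod_beta by measurable

lemma surv_weight_resets: "resets y p \<Longrightarrow> surv_weight \<epsilon> y p = 0"
  by (simp add: surv_weight_def)

lemma win_after_reset_rec:
  assumes y: "y \<in> space S" and f: "f \<in> borel_measurable S"
  shows "win \<epsilon> f (T y w + b) y w =
    (seg \<epsilon> f y (shd w) + reset_weight \<epsilon> y (shd w) * win \<epsilon> f b ystar (stl w)) +
    surv_weight \<epsilon> y (shd w) * win \<epsilon> f (T (step y (shd w)) (stl w) + b) (step y (shd w)) (stl w)"
proof (cases "resets y (shd w)")
  case True
  then have eq: "T y w + b = ennreal (hold y (shd w)) + b"
    by (simp add: T_rec[OF y, of w])
  show ?thesis
    unfolding eq win_rec[OF y f] using True
    by (simp add: reset_weight_def surv_weight_def step_resets)
next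
  case False
  then have eq: "T y w + b = ennreal (hold y (shd w)) + (T (step y (shd w)) (stl w) + b)"
    by (simp add: T_rec[OF y, of w] add.assoc)
  show ?thesis
    unfolding eq win_rec[OF y f] using False
    by (simp add: reset_weight_def surv_weight_def)
qed

lemma discount_T_rec:
  assumes y: "y \<in> space S"
  shows "discount \<epsilon> (T y w) =
    reset_weight \<epsilon> y (shd w) + surv_weight \<epsilon> y (shd w) * discount \<epsilon> (T (step y (shd w)) (stl w))"
  using hold_nonneg[OF y, of "shd w"]
  by (subst T_rec[OF y]) (simp add: discount_add reset_weight_def surv_weight_def)

text \<open>After the reset the path starts afresh from \<open>ystar\<close> with independent noise.
  Both sides obey the same recursion; their sources differ only in that the fresh window after a
  resetting jump is replaced by its mean \<open>R\<close>.\<close>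

lemma renewal:
  assumes y: "y \<in> space S" and f [measurable]: "f \<in> borel_measurable S"
  shows "(\<integral>\<^sup>+w. win \<epsilon> f (T y w + b) y w \<partial>N) =
    killed \<epsilon> f y + laplace \<epsilon> y * (\<integral>\<^sup>+w. win \<epsilon> f b ystar w \<partial>N)"
proof -
  define R where "R = (\<integral>\<^sup>+w. win \<epsilon> f b ystar w \<partial>N)"
  have [measurable]: "(\<lambda>w. win \<epsilon> f b ystar w) \<in> borel_measurable N"
    by measurable
  have "(\<integral>\<^sup>+w. win \<epsilon> f (T y w + b) y w \<partial>N) =
      (\<integral>\<^sup>+w. win \<epsilon> f (T y w) y w + discount \<epsilon> (T y w) * R \<partial>N)"
  proof (rule renewal_unique[OF surv_weight_measurable_pair[of \<epsilon>],
        where ?G1.0 = "\<lambda>y w. seg \<epsilon> f y (shd w) + reset_weight \<epsilon> y (shd w) * win \<epsilon> f b ystar (stl w)"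
          and ?G2.0 = "\<lambda>y w. seg \<epsilon> f y (shd w) + reset_weight \<epsilon> y (shd w) * R"])
    show "(\<lambda>(y, w). seg \<epsilon> f y (shd w) + reset_weight \<epsilon> y (shd w) * win \<epsilon> f b ystar (stl w))
        \<in> borel_measurable (S \<Otimes>\<^sub>M N)"
      unfolding case_prod_beta by measurable
    show "(\<lambda>(y, w). seg \<epsilon> f y (shd w) + reset_weight \<epsilon> y (shd w) * R) \<in> borel_measurable (S \<Otimes>\<^sub>M N)"
      unfolding case_prod_beta by measurable
    show "win \<epsilon> f (T y w + b) y w =
      (seg \<epsilon> f y (shd w) + reset_weight \<epsilon> y (shd w) * win \<epsilon> f b ystar (stl w)) +
      surv_weight \<epsilon> y (shd w) * win \<epsilon> f (T (step y (shd w)) (stl w) + b) (step y (shd w)) (stl w)"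
      if "y \<in> space S" for y w
      by (rule win_after_reset_rec[OF that f])
    show "win \<epsilon> f (T y w) y w + discount \<epsilon> (T y w) * R =
        seg \<epsilon> f y (shd w) + reset_weight \<epsilon> y (shd w) * R +
        surv_weight \<epsilon> y (shd w) * (win \<epsilon> f (T (step y (shd w)) (stl w)) (step y (shd w)) (stl w) +
          discount \<epsilon> (T (step y (shd w)) (stl w)) * R)"
      if "y \<in> space S" for y w
    proof -
      have "win \<epsilon> f (T y w) y w = seg \<epsilon> f y (shd w) +
          surv_weight \<epsilon> y (shd w) * win \<epsilon> f (T (step y (shd w)) (stl w)) (step y (shd w)) (stl w)"
        using win_after_reset_rec[OF that f, of \<epsilon> w 0] by simp
      then show ?thesis
        by (simp only: discount_T_rec[OF that, of \<epsilon> w] distrib_left distrib_right ac_simps)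
    qed
    show "(\<integral>\<^sup>+w. seg \<epsilon> f y (shd w) + reset_weight \<epsilon> y (shd w) * win \<epsilon> f b ystar (stl w) \<partial>N) =
        (\<integral>\<^sup>+w. seg \<epsilon> f y (shd w) + reset_weight \<epsilon> y (shd w) * R \<partial>N)" if "y \<in> space S" for y
    proof -
      have [measurable]: "(\<lambda>p. seg \<epsilon> f y p) \<in> borel_measurable borel"
        "(\<lambda>p. reset_weight \<epsilon> y p) \<in> borel_measurable borel"
        using that by measurable
      have "(\<integral>\<^sup>+w. reset_weight \<epsilon> y (shd w) * win \<epsilon> f b ystar (stl w) \<partial>N) =
          (\<integral>\<^sup>+w. reset_weight \<epsilon> y (shd w) * R \<partial>N)"
        unfolding R_def by (rule nn_integral_shd_stl) measurable
      then show ?thesis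
        by (simp add: nn_integral_add)
    qed
  qed (use y surv_weight_resets in auto)
  also have "\<dots> = killed \<epsilon> f y + laplace \<epsilon> y * R"
  proof -
    have [measurable]: "(\<lambda>w. T y w) \<in> borel_measurable N" "(\<lambda>w. win \<epsilon> f (T y w) y w) \<in> borel_measurable N"
      using y by measurable
    show ?thesis
      by (simp add: nn_integral_add nn_integral_multc killed_def laplace_def)
  qed
  finally show ?thesis by (simp add: R_def)
qed

text \<open>Renewal with an infinite remainder, since
  \<open>T y w + \<infinity> = \<infinity>\<close>.\<close>

lemma resolvent_eq:
  assumes "y \<in> space S" "f \<in> borel_measurable S"
  shows "resolvent \<epsilon> f y = killed \<epsilon> f y + laplace \<epsilon> y * resolvent \<epsilon> f ystar"
  using renewal[OF assms, of \<epsilon> \<infinity>] by (simp add: resolvent_def)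

lemma laplace_pos:
  assumes y: "y \<in> space S"
  shows "0 < laplace \<epsilon> y"
proof (rule ccontr)
  have [measurable]: "(\<lambda>w. T y w) \<in> borel_measurable N"
    using y by measurable
  assume "\<not> 0 < laplace \<epsilon> y"
  then have "AE w in N. discount \<epsilon> (T y w) = 0"
    unfolding laplace_def by (subst nn_integral_0_iff_AE[symmetric]) auto
  with T_finite[OF y] have "AE w in N. False"
    by eventually_elim (auto simp: discount_eq_0_iff)
  then show False by simp
qed

lemma laplace_0:
  assumes y: "y \<in> space S"
  shows "laplace 0 y = 1"
proof -
  have "laplace 0 y = (\<integral>\<^sup>+w. 1 \<partial>N)"
    unfolding laplace_def using T_finite[OF y]
    by (intro nn_integral_cong_AE) (auto simp: discount_def elim: eventually_mono)
  then show ?thesis by (simp add: N.emeasure_space_1[simplified])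
qed

text \<open>The gap between \<open>discount \<epsilon> x\<close> and \<open>discount 1 x\<close> for
  \<open>\<epsilon> \<le> 1\<close>, formed among the reals so that subtraction is not
  truncated.\<close>

definition disc_diff :: "real \<Rightarrow> ennreal \<Rightarrow> ennreal" where
  "disc_diff \<epsilon> x = (if x = \<infinity> then 0 else ennreal (exp (- \<epsilon> * enn2real x) - exp (- enn2real x)))"

lemma disc_diff_measurable [measurable]: "disc_diff \<epsilon> \<in> borel_measurable borel"
  unfolding disc_diff_def by measurable

lemma discount_split:
  assumes "\<epsilon> \<le> 1"
  shows "discount \<epsilon> x = disc_diff \<epsilon> x + discount 1 x"
proof (cases x)
  case (real r)
  then have "exp (- r) \<le> exp (- \<epsilon> * r)"
    using mult_right_mono[OF assms, of r] by simp
  with real show ?thesis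
    by (simp add: disc_diff_def ennreal_plus[symmetric] del: ennreal_plus)
qed (simp add: disc_diff_def)

text \<open>For \<open>\<epsilon> < 1\<close> and finite \<open>x\<close>, the first summand is
  \<open>1 - \<epsilon>\<close> times the integral of
  \<open>exp (- \<epsilon> * t) * exp (- (h + x - t))\<close> over \<open>0 \<le> t < h\<close>; the
  second is the same gap restarted after \<open>h\<close>.\<close>

lemma disc_diff_rec:
  assumes "0 \<le> h" "\<epsilon> \<le> 1"
  shows "disc_diff \<epsilon> (ennreal h + x) =
    discount 1 (ennreal h + x) * ennreal (exp ((1 - \<epsilon>) * h) - 1) + ennreal (exp (- \<epsilon> * h)) * disc_diff \<epsilon> x"
proof (cases x)
  case (real r)
  have "\<epsilon> * h \<le> h" "\<epsilon> * r \<le> r"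
    using mult_right_mono[OF assms(2), of h] mult_right_mono[OF assms(2), of r] assms real by auto
  then have nn: "0 \<le> exp ((1 - \<epsilon>) * h) - 1" "0 \<le> exp (- \<epsilon> * r) - exp (- r)"
    by (auto simp: algebra_simps)
  have "exp (- \<epsilon> * (h + r)) - exp (- (h + r)) =
      exp (- (h + r)) * (exp ((1 - \<epsilon>) * h) - 1) + exp (- \<epsilon> * h) * (exp (- \<epsilon> * r) - exp (- r))"
    by (simp add: algebra_simps mult_exp_exp)
  moreover have "ennreal h + x = ennreal (h + r)"
    using real assms by simp
  ultimately show ?thesis
    using nn real assms
    by (simp add: disc_diff_def ennreal_plus[symmetric] ennreal_mult[symmetric] del: ennreal_plus)
qed (simp add: disc_diff_def)

text \<open>
  From time \<open>t < T\<close> on, the remaining time to the reset is \<open>T - t\<close>; hence this is the expectation of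
  \<open>(1 - \<epsilon>) * integral {0..T} (\<lambda>t. exp (- \<epsilon> * t) * exp (- (T - t))) = exp (- \<epsilon> * T) - exp (- T)\<close>.
\<close>

lemma killed_laplace:
  assumes y: "y \<in> space S" and eps: "0 \<le> \<epsilon>" "\<epsilon> < 1"
  shows "ennreal (1 - \<epsilon>) * killed \<epsilon> (laplace 1) y + laplace 1 y = laplace \<epsilon> y"
proof -
  have [measurable]: "(\<lambda>w. T y w) \<in> borel_measurable N" "(\<lambda>w. win \<epsilon> (laplace 1) (T y w) y w) \<in> borel_measurable N"
    using y by measurable
  have "(\<integral>\<^sup>+w. ennreal (1 - \<epsilon>) * win \<epsilon> (laplace 1) (T y w) y w \<partial>N) = (\<integral>\<^sup>+w. disc_diff \<epsilon> (T y w) \<partial>N)"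
  proof (rule renewal_unique[OF surv_weight_measurable_pair[of \<epsilon>],
        where ?G1.0 = "\<lambda>y w. ennreal (1 - \<epsilon>) * seg \<epsilon> (laplace 1) y (shd w)"
          and ?G2.0 = "\<lambda>y w. discount 1 (T y w) * ennreal (exp ((1 - \<epsilon>) * hold y (shd w)) - 1)"])
    show "(\<lambda>(y, w). ennreal (1 - \<epsilon>) * seg \<epsilon> (laplace 1) y (shd w)) \<in> borel_measurable (S \<Otimes>\<^sub>M N)"
      unfolding case_prod_beta by measurable
    show "(\<lambda>(y, w). discount 1 (T y w) * ennreal (exp ((1 - \<epsilon>) * hold y (shd w)) - 1))
        \<in> borel_measurable (S \<Otimes>\<^sub>M N)"
      unfolding case_prod_beta by measurable
    show "ennreal (1 - \<epsilon>) * win \<epsilon> (laplace 1) (T y w) y w =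
        ennreal (1 - \<epsilon>) * seg \<epsilon> (laplace 1) y (shd w) + surv_weight \<epsilon> y (shd w) *
          (ennreal (1 - \<epsilon>) * win \<epsilon> (laplace 1) (T (step y (shd w)) (stl w)) (step y (shd w)) (stl w))"
      if "y \<in> space S" for y w
      using win_after_reset_rec[OF that laplace_measurable, of \<epsilon> 1 w 0]
      by (simp add: distrib_left mult.left_commute)
    show "disc_diff \<epsilon> (T y w) = discount 1 (T y w) * ennreal (exp ((1 - \<epsilon>) * hold y (shd w)) - 1) +
        surv_weight \<epsilon> y (shd w) * disc_diff \<epsilon> (T (step y (shd w)) (stl w))" if "y \<in> space S" for y w
    proof -
      have d0: "disc_diff \<epsilon> 0 = 0" by (simp add: disc_diff_def)
      have "disc_diff \<epsilon> (T y w) = discount 1 (T y w) * ennreal (exp ((1 - \<epsilon>) * hold y (shd w)) - 1) +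
          ennreal (exp (- \<epsilon> * hold y (shd w))) *
          disc_diff \<epsilon> (if resets y (shd w) then 0 else T (step y (shd w)) (stl w))"
        unfolding T_rec[OF that, of w] using hold_nonneg[OF that] eps by (intro disc_diff_rec) auto
      then show ?thesis
        by (simp add: surv_weight_def d0 split: if_splits)
    qed
    show "(\<integral>\<^sup>+w. ennreal (1 - \<epsilon>) * seg \<epsilon> (laplace 1) y (shd w) \<partial>N) =
        (\<integral>\<^sup>+w. discount 1 (T y w) * ennreal (exp ((1 - \<epsilon>) * hold y (shd w)) - 1) \<partial>N)"
      if y: "y \<in> space S" for y
    proof -
      have [measurable]: "(\<lambda>w. T y w) \<in> borel_measurable N" "(\<lambda>p. seg \<epsilon> (laplace 1) y p) \<in> borel_measurable borel"
        using y by measurable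
      \<comment> \<open>At time \<open>s\<close> the remaining time to the reset is
        \<open>T - s\<close>, which puts the factor \<open>exp s\<close> in front of
        \<open>discount 1 (T y w)\<close>.\<close>
      have "(\<integral>\<^sup>+w. seg \<epsilon> (laplace 1) y (shd w) \<partial>N) =
          (\<integral>\<^sup>+w. (\<integral>\<^sup>+s\<in>{0..<hold y (shd w)}. ennreal (exp (- \<epsilon> * s)) * (ennreal (exp s) * discount 1 (T y w)) \<partial>lborel) \<partial>N)"
        unfolding seg_def laplace_def
      proof (rule nn_integral_along_flow[OF y, symmetric])
        show "(\<lambda>(y, w). discount 1 (T y w)) \<in> borel_measurable (S \<Otimes>\<^sub>M N)"
          unfolding case_prod_beta by measurable
        show "(\<lambda>(w, s). ennreal (exp s) * discount 1 (T y w)) \<in> borel_measurable (N \<Otimes>\<^sub>M lborel)"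
          unfolding case_prod_beta using y by measurable
        show "ennreal (exp s) * discount 1 (T y w) = discount 1 (T (flw y s) (residual y s (shd w) ## stl w))"
          if "0 \<le> s" "s < hold y (shd w)" for w s
          using that
          by (simp add: T_memoryless[OF y that] discount_add mult.assoc[symmetric] ennreal_mult[symmetric] mult_exp_exp)
      qed measurable
      also have "\<dots> = (\<integral>\<^sup>+w. discount 1 (T y w) * ennreal ((exp ((1 - \<epsilon>) * hold y (shd w)) - 1) / (1 - \<epsilon>)) \<partial>N)"
      proof (rule nn_integral_cong)
        fix w
        have "(\<integral>\<^sup>+s\<in>{0..<hold y (shd w)}. ennreal (exp (- \<epsilon> * s)) * (ennreal (exp s) * discount 1 (T y w)) \<partial>lborel) =
            (\<integral>\<^sup>+s. discount 1 (T y w) * (ennreal (exp ((1 - \<epsilon>) * s)) * indicator {0..<hold y (shd w)} s) \<partial>lborel)"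
        proof (rule nn_integral_cong)
          fix s
          have "ennreal (exp (- \<epsilon> * s)) * ennreal (exp s) = ennreal (exp ((1 - \<epsilon>) * s))"
            by (subst ennreal_mult[symmetric]) (simp_all add: mult_exp_exp algebra_simps)
          then show "ennreal (exp (- \<epsilon> * s)) * (ennreal (exp s) * discount 1 (T y w)) * indicator {0..<hold y (shd w)} s =
            discount 1 (T y w) * (ennreal (exp ((1 - \<epsilon>) * s)) * indicator {0..<hold y (shd w)} s)"
            by (metis mult.assoc mult.commute)
        qed
        also have "\<dots> = discount 1 (T y w) * ennreal ((exp ((1 - \<epsilon>) * hold y (shd w)) - 1) / (1 - \<epsilon>))"
          using hold_nonneg[OF y] eps by (subst nn_integral_cmult) (auto simp: nn_integral_exp_Ico)
        finally show "(\<integral>\<^sup>+s\<in>{0..<hold y (shd w)}. ennreal (exp (- \<epsilon> * s)) * (ennreal (exp s) * discount 1 (T y w)) \<partial>lborel) =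
          discount 1 (T y w) * ennreal ((exp ((1 - \<epsilon>) * hold y (shd w)) - 1) / (1 - \<epsilon>))" .
      qed
      finally have *: "(\<integral>\<^sup>+w. seg \<epsilon> (laplace 1) y (shd w) \<partial>N) =
        (\<integral>\<^sup>+w. discount 1 (T y w) * ennreal ((exp ((1 - \<epsilon>) * hold y (shd w)) - 1) / (1 - \<epsilon>)) \<partial>N)" .
      have [measurable]: "(\<lambda>w. hold y (shd w)) \<in> borel_measurable N"
        using y by measurable
      have "(\<integral>\<^sup>+w. ennreal (1 - \<epsilon>) * seg \<epsilon> (laplace 1) y (shd w) \<partial>N) =
          ennreal (1 - \<epsilon>) * (\<integral>\<^sup>+w. seg \<epsilon> (laplace 1) y (shd w) \<partial>N)"
        by (rule nn_integral_cmult) measurable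
      also have "\<dots> = (\<integral>\<^sup>+w. ennreal (1 - \<epsilon>) * (discount 1 (T y w) * ennreal ((exp ((1 - \<epsilon>) * hold y (shd w)) - 1) / (1 - \<epsilon>))) \<partial>N)"
        unfolding * by (rule nn_integral_cmult[symmetric]) measurable
      also have "\<dots> = (\<integral>\<^sup>+w. discount 1 (T y w) * ennreal (exp ((1 - \<epsilon>) * hold y (shd w)) - 1) \<partial>N)"
      proof (rule nn_integral_cong)
        fix w
        have "ennreal (1 - \<epsilon>) * ennreal ((exp ((1 - \<epsilon>) * hold y (shd w)) - 1) / (1 - \<epsilon>)) =
            ennreal (exp ((1 - \<epsilon>) * hold y (shd w)) - 1)"
          using eps hold_nonneg[OF y] by (subst ennreal_mult'[symmetric]) auto
        then show "ennreal (1 - \<epsilon>) * (discount 1 (T y w) * ennreal ((exp ((1 - \<epsilon>) * hold y (shd w)) - 1) / (1 - \<epsilon>))) =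
            discount 1 (T y w) * ennreal (exp ((1 - \<epsilon>) * hold y (shd w)) - 1)"
          by (metis mult.left_commute)
      qed
      finally show ?thesis .
    qed
  qed (use y surv_weight_resets in auto)
  moreover have "laplace \<epsilon> y = (\<integral>\<^sup>+w. disc_diff \<epsilon> (T y w) \<partial>N) + laplace 1 y"
    unfolding laplace_def using eps
    by (subst nn_integral_add[symmetric]) (auto simp: discount_split[of \<epsilon>])
  ultimately show ?thesis
    by (simp add: killed_def nn_integral_cmult)
qed

subsection \<open>Invariance and recurrence\<close>

text \<open>Markov property at time \<open>s\<close>, integrated over \<open>s < T\<close>: a fresh
  path from the position at \<open>s\<close>, run for time \<open>t\<close>, may be replaced by the
  original path at \<open>t + s\<close>. Both sides obey the same recursion, and their sources agree
  by memorylessness before the first jump.\<close>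

lemma killed_transition_op_eq_shift:
  assumes y: "y \<in> space S" and f [measurable]: "f \<in> borel_measurable S" and t: "0 \<le> t"
  shows "killed 0 (transition_op t f) y =
    (\<integral>\<^sup>+w. (\<integral>\<^sup>+s\<in>{s. 0 \<le> s \<and> ennreal s < T y w}. f (path y w (t + s)) \<partial>lborel) \<partial>N)"
  unfolding killed_def
proof (rule renewal_unique[OF surv_weight_measurable_pair[of 0],
      where ?G1.0 = "\<lambda>y w. seg 0 (transition_op t f) y (shd w)"
        and ?G2.0 = "\<lambda>y w. \<integral>\<^sup>+s\<in>{0..<hold y (shd w)}. 1 * f (path y w (t + s)) \<partial>lborel"])
  have Ptf [measurable]: "transition_op t f \<in> borel_measurable S"
    by measurable
  show "(\<lambda>(y, w). seg 0 (transition_op t f) y (shd w)) \<in> borel_measurable (S \<Otimes>\<^sub>M N)"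
    unfolding case_prod_beta by measurable
  show "(\<lambda>(y, w). \<integral>\<^sup>+s\<in>{0..<hold y (shd w)}. 1 * f (path y w (t + s)) \<partial>lborel) \<in> borel_measurable (S \<Otimes>\<^sub>M N)"
    unfolding case_prod_beta by measurable
  show "win 0 (transition_op t f) (T y w) y w = seg 0 (transition_op t f) y (shd w) +
      surv_weight 0 y (shd w) * win 0 (transition_op t f) (T (step y (shd w)) (stl w)) (step y (shd w)) (stl w)"
    if "y \<in> space S" for y w
    using win_after_reset_rec[OF that Ptf, of 0 w 0] by simp
  show "(\<integral>\<^sup>+s\<in>{s. 0 \<le> s \<and> ennreal s < T y w}. f (path y w (t + s)) \<partial>lborel) =
      (\<integral>\<^sup>+s\<in>{0..<hold y (shd w)}. 1 * f (path y w (t + s)) \<partial>lborel) + surv_weight 0 y (shd w) *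
      (\<integral>\<^sup>+s\<in>{s. 0 \<le> s \<and> ennreal s < T (step y (shd w)) (stl w)}. f (path (step y (shd w)) (stl w) (t + s)) \<partial>lborel)"
    if y: "y \<in> space S" for y w
  proof -
    have [measurable]: "(\<lambda>s. f (path y w (t + s))) \<in> borel_measurable borel"
      using y by (intro path_fun_measurable) auto
    have "(\<integral>\<^sup>+s\<in>{s. 0 \<le> s \<and> ennreal s < T y w}. f (path y w (t + s)) \<partial>lborel) =
      (\<integral>\<^sup>+s\<in>{0..<hold y (shd w)}. f (path y w (t + s)) \<partial>lborel) +
      (\<integral>\<^sup>+s\<in>{s. 0 \<le> s \<and> ennreal s < (if resets y (shd w) then 0 else T (step y (shd w)) (stl w))}.
        f (path y w (t + (hold y (shd w) + s))) \<partial>lborel)"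
      unfolding T_rec[OF y, of w] by (rule nn_integral_split_at) (auto simp: hold_nonneg y)
    also have "(\<integral>\<^sup>+s\<in>{s. 0 \<le> s \<and> ennreal s < (if resets y (shd w) then 0 else T (step y (shd w)) (stl w))}.
        f (path y w (t + (hold y (shd w) + s))) \<partial>lborel) = surv_weight 0 y (shd w) *
      (\<integral>\<^sup>+s\<in>{s. 0 \<le> s \<and> ennreal s < T (step y (shd w)) (stl w)}. f (path (step y (shd w)) (stl w) (t + s)) \<partial>lborel)"
    proof (cases "resets y (shd w)")
      case False
      have "path y w (t + (hold y (shd w) + s)) = path (step y (shd w)) (stl w) (t + s)" if "0 \<le> s" for s
        using path_shift[OF y, of "t + s" w] that t by (simp add: add.left_commute)
      with False show ?thesis
        by (auto simp: surv_weight_def intro!: nn_integral_cong split: split_indicator)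
    qed (simp add: surv_weight_def)
    finally show ?thesis by simp
  qed
  show "(\<integral>\<^sup>+w. seg 0 (transition_op t f) y (shd w) \<partial>N) =
      (\<integral>\<^sup>+w. (\<integral>\<^sup>+s\<in>{0..<hold y (shd w)}. 1 * f (path y w (t + s)) \<partial>lborel) \<partial>N)" if y: "y \<in> space S" for y
  proof -
    have "(\<integral>\<^sup>+w. (\<integral>\<^sup>+s\<in>{0..<hold y (shd w)}. 1 * f (path y w (t + s)) \<partial>lborel) \<partial>N) =
        (\<integral>\<^sup>+w. (\<integral>\<^sup>+s\<in>{0..<hold y (shd w)}. 1 * (\<integral>\<^sup>+w'. f (path (flw y s) w' t) \<partial>N) \<partial>lborel) \<partial>N)"
    proof (rule nn_integral_along_flow[OF y])
      show "(\<lambda>(y, w). f (path y w t)) \<in> borel_measurable (S \<Otimes>\<^sub>M N)"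
        unfolding case_prod_beta by measurable
      show "(\<lambda>(w, s). f (path y w (t + s))) \<in> borel_measurable (N \<Otimes>\<^sub>M lborel)"
        unfolding case_prod_beta using y by measurable
    qed (use path_memoryless[OF y] t in \<open>auto simp: add.commute\<close>)
    then show ?thesis
      by (simp add: seg_def transition_op_def)
  qed
qed (use y surv_weight_resets in auto)

text \<open>The integral of \<open>f\<close> over \<open>[0, T + t)\<close> is computed twice. Cut
  at \<open>t\<close>, it is the window \<open>[0, t)\<close> plus the shifted cycle; cut at
  \<open>T\<close>, it is the cycle plus a fresh window of length \<open>t\<close>. The window has
  mean \<open>C \<le> t\<close>, as \<open>f \<le> 1\<close>, and cancels.\<close>

lemma killed_transition_op:
  assumes f [measurable]: "f \<in> borel_measurable S" and le: "\<And>x. f x \<le> 1" and t: "0 \<le> t"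
  shows "killed 0 (transition_op t f) ystar = killed 0 f ystar"
proof -
  define C where "C = (\<integral>\<^sup>+w. win 0 f (ennreal t) ystar w \<partial>N)"
  have [measurable]: "(\<lambda>w. win 0 f (ennreal t) ystar w) \<in> borel_measurable N"
    "(\<lambda>w. T ystar w) \<in> borel_measurable N"
    by measurable
  have path [measurable]: "(\<lambda>s. f (path ystar w s)) \<in> borel_measurable borel" for w
    by (intro path_fun_measurable) auto
  have split: "win 0 f (T ystar w + ennreal t) ystar w = win 0 f (ennreal t) ystar w +
      (\<integral>\<^sup>+s\<in>{s. 0 \<le> s \<and> ennreal s < T ystar w}. f (path ystar w (t + s)) \<partial>lborel)" for w
  proof -
    have "win 0 f (ennreal t + T ystar w) ystar w = (\<integral>\<^sup>+s\<in>{0..<t}. f (path ystar w s) \<partial>lborel) +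
        (\<integral>\<^sup>+s\<in>{s. 0 \<le> s \<and> ennreal s < T ystar w}. f (path ystar w (t + s)) \<partial>lborel)"
      unfolding win_def using t by (subst nn_integral_split_at) auto
    also have "(\<integral>\<^sup>+s\<in>{0..<t}. f (path ystar w s) \<partial>lborel) = win 0 f (ennreal t) ystar w"
      unfolding win_def by (intro nn_integral_cong) (auto simp: ennreal_less_iff split: split_indicator)
    finally show ?thesis by (simp add: add.commute)
  qed
  have [measurable]: "(\<lambda>w. \<integral>\<^sup>+s\<in>{s. 0 \<le> s \<and> ennreal s < T ystar w}. f (path ystar w (t + s)) \<partial>lborel) \<in> borel_measurable N"
    by measurable
  have "C + killed 0 (transition_op t f) ystar = (\<integral>\<^sup>+w. win 0 f (T ystar w + ennreal t) ystar w \<partial>N)"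
    unfolding split C_def killed_transition_op_eq_shift[OF ystar_in_S f t] by (rule nn_integral_add[symmetric]) measurable
  also have "\<dots> = killed 0 f ystar + C"
    using renewal[OF ystar_in_S f, of 0 "ennreal t"] by (simp add: laplace_0 C_def)
  finally have eq: "C + killed 0 (transition_op t f) ystar = C + killed 0 f ystar"
    by (simp add: add.commute)
  have "win 0 f (ennreal t) ystar w \<le> ennreal t" for w
  proof -
    have "win 0 f (ennreal t) ystar w \<le> (\<integral>\<^sup>+s. indicator {0..t} s \<partial>lborel)"
      unfolding win_def using le by (intro nn_integral_mono) (auto simp: ennreal_less_iff split: split_indicator)
    with t show ?thesis by simp
  qed
  then have "C \<le> (\<integral>\<^sup>+w. ennreal t \<partial>N)"
    unfolding C_def by (intro nn_integral_mono)
  also have "\<dots> < \<infinity>"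
    using N.emeasure_space_1 by simp
  finally show ?thesis
    using eq less_imp_neq[of C \<infinity>] by (simp add: ennreal_add_left_cancel)
qed

lemma AE_occupation_infinite:
  assumes f [measurable]: "f \<in> borel_measurable S" and pos: "killed 0 f ystar \<noteq> 0" and y: "y \<in> space S"
  shows "AE w in N. win 0 f \<infinity> y w = \<infinity>"
proof -
  define F where "F = (\<integral>\<^sup>+w. discount 1 (win 0 f \<infinity> ystar w) \<partial>N)"
  \<comment> \<open>Discount of the occupation before the first jump: \<open>c\<close> continues the
    cycle and \<open>r\<close> ends it.\<close>
  define c where "c y p = (if resets y p then 0 else discount 1 (seg 0 f y p))" for y p
  define r where "r y p = (if resets y p then discount 1 (seg 0 f y p) else 0)" for y p
  have [measurable]: "(\<lambda>w. win 0 f \<infinity> y w) \<in> borel_measurable N" "(\<lambda>w. win 0 f (T y w) y w) \<in> borel_measurable N"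
    if "y \<in> space S" for y
    using that by measurable
  have regen: "(\<integral>\<^sup>+w. discount 1 (win 0 f \<infinity> y w) \<partial>N) =
      (\<integral>\<^sup>+w. discount 1 (win 0 f (T y w) y w) \<partial>N) * F" if y: "y \<in> space S" for y
  proof -
    have "(\<integral>\<^sup>+w. discount 1 (win 0 f \<infinity> y w) \<partial>N) = (\<integral>\<^sup>+w. discount 1 (win 0 f (T y w) y w) * F \<partial>N)"
    proof (rule renewal_unique[where c = c
          and ?G1.0 = "\<lambda>y w. r y (shd w) * discount 1 (win 0 f \<infinity> ystar (stl w))"
          and ?G2.0 = "\<lambda>y w. r y (shd w) * F"])
      show "(\<lambda>(y, p). c y p) \<in> borel_measurable (S \<Otimes>\<^sub>M borel)"
        unfolding c_def case_prod_beta by measurable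
      show "(\<lambda>(y, w). r y (shd w) * discount 1 (win 0 f \<infinity> ystar (stl w))) \<in> borel_measurable (S \<Otimes>\<^sub>M N)"
        unfolding r_def case_prod_beta by measurable
      show "(\<lambda>(y, w). r y (shd w) * F) \<in> borel_measurable (S \<Otimes>\<^sub>M N)"
        unfolding r_def case_prod_beta by measurable
      show "discount 1 (win 0 f \<infinity> y w) = r y (shd w) * discount 1 (win 0 f \<infinity> ystar (stl w)) +
          c y (shd w) * discount 1 (win 0 f \<infinity> (step y (shd w)) (stl w))" if "y \<in> space S" for y w
        using win_rec[OF that f, of 0 w \<infinity>]
        by (auto simp: discount_add r_def c_def step_resets)
      show "discount 1 (win 0 f (T y w) y w) * F = r y (shd w) * F +
          c y (shd w) * (discount 1 (win 0 f (T (step y (shd w)) (stl w)) (step y (shd w)) (stl w)) * F)"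
        if "y \<in> space S" for y w
        using win_after_reset_rec[OF that f, of 0 w 0]
        by (auto simp: discount_add r_def c_def surv_weight_def mult.assoc)
      show "(\<integral>\<^sup>+w. r y (shd w) * discount 1 (win 0 f \<infinity> ystar (stl w)) \<partial>N) = (\<integral>\<^sup>+w. r y (shd w) * F \<partial>N)"
        if y: "y \<in> space S" for y
        unfolding F_def
      proof (rule nn_integral_shd_stl)
        show "(\<lambda>p. r y p) \<in> borel_measurable borel"
          unfolding r_def using y by measurable
      qed measurable
    qed (use y in \<open>auto simp: c_def\<close>)
    also have "\<dots> = (\<integral>\<^sup>+w. discount 1 (win 0 f (T y w) y w) \<partial>N) * F"
      using y by (intro nn_integral_multc) auto
    finally show ?thesis .
  qed
  \<comment> \<open>At \<open>ystar\<close> the factorisation becomes a fixed-point equation, with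
    factor below 1 because the occupation during one cycle has positive mean.\<close>
  have "F = 0"
  proof (rule ennreal_eq_mult_self_imp_0)
    show "F = (\<integral>\<^sup>+w. discount 1 (win 0 f (T ystar w) ystar w) \<partial>N) * F"
      using regen[OF ystar_in_S] by (simp add: F_def)
    show "(\<integral>\<^sup>+w. discount 1 (win 0 f (T ystar w) ystar w) \<partial>N) < 1"
      using pos unfolding killed_def by (intro N.nn_integral_discount_less_1) auto
    have "F \<le> (\<integral>\<^sup>+w. 1 \<partial>N)"
      unfolding F_def by (intro nn_integral_mono discount_le_1) auto
    then show "F < \<infinity>"
      using N.emeasure_space_1 by (simp add: le_less_trans)
  qed
  with regen[OF y] have "(\<integral>\<^sup>+w. discount 1 (win 0 f \<infinity> y w) \<partial>N) = 0" by simp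
  then have "AE w in N. discount 1 (win 0 f \<infinity> y w) = 0"
    using y by (subst (asm) nn_integral_0_iff_AE) auto
  then show ?thesis by (simp add: discount_eq_0_iff)
qed

section \<open>The cycle measure \<Pi>\<close>

text \<open>The expected occupation before the reset, realised as an image of
  \<open>N \<Otimes>\<^sub>M lborel\<close> restricted to times before the reset, so that it is a
  measure by construction.\<close>

definition cycle_measure :: "state measure" where
  "cycle_measure = distr
     (density (N \<Otimes>\<^sub>M lborel) (\<lambda>(w, t). indicator {t. 0 \<le> t \<and> ennreal t < T ystar w} t))
     S (\<lambda>(w, t). path ystar w t)"

lemma sets_cycle_measure [measurable_cong]: "sets cycle_measure = sets S"
  by (simp add: cycle_measure_def)

lemma killed_eq_pair:
  assumes [measurable]: "f \<in> borel_measurable S"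
  shows "killed \<epsilon> f ystar = (\<integral>\<^sup>+p. indicator {t. 0 \<le> t \<and> ennreal t < T ystar (fst p)} (snd p) *
      (ennreal (exp (- \<epsilon> * snd p)) * f (path ystar (fst p) (snd p))) \<partial>(N \<Otimes>\<^sub>M lborel))"
  unfolding killed_def win_def
  by (subst lborel.nn_integral_fst[symmetric]) (measurable, auto simp: mult.commute)

lemma nn_integral_cycle_measure:
  assumes [measurable]: "f \<in> borel_measurable S"
  shows "(\<integral>\<^sup>+y. f y \<partial>cycle_measure) = killed 0 f ystar"
  unfolding cycle_measure_def case_prod_beta
  by (subst nn_integral_distr, measurable, subst nn_integral_density) (auto simp: killed_eq_pair)

lemma emeasure_cycle_measure: "B \<in> sets S \<Longrightarrow> emeasure cycle_measure B = killed 0 (indicator B) ystar"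
  using nn_integral_cycle_measure[of "indicator B"] by (simp add: sets_cycle_measure)

text \<open>The case \<open>\<epsilon> = 0\<close> of \<open>killed_laplace\<close>, where
  \<open>laplace 0\<close> is 1 because a reset is almost sure. The additive form avoids truncated
  subtraction.\<close>

lemma nn_integral_cycle_laplace: "(\<integral>\<^sup>+y. laplace 1 y \<partial>cycle_measure) + laplace 1 ystar = 1"
  using killed_laplace[OF ystar_in_S, of 0]
  by (simp add: nn_integral_cycle_measure laplace_0)

text \<open>Even if \<Pi> has infinite mass, \<open>laplace 1\<close> is a positive function whose
  integral is at most 1.\<close>

lemma sigma_finite_cycle_measure: "sigma_finite_measure cycle_measure"
proof (rule sigma_finite_measureI_integral[where f = "laplace 1"])
  have "(\<integral>\<^sup>+y. laplace 1 y \<partial>cycle_measure) \<le> 1"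
    using nn_integral_cycle_laplace by (metis le_iff_add)
  then show "(\<integral>\<^sup>+y. laplace 1 y \<partial>cycle_measure) < \<infinity>"
    by (simp add: le_less_trans)
qed (auto simp: laplace_pos sets_eq_imp_space_eq[OF sets_cycle_measure])

lemma killed_one: "killed 0 (\<lambda>_. 1) y = (\<integral>\<^sup>+w. T y w \<partial>N)"
proof -
  have "(\<integral>\<^sup>+t\<in>{t. 0 \<le> t \<and> ennreal t < b}. 1 \<partial>lborel) = b" for b
  proof (cases b)
    case (real r)
    then have "{t. 0 \<le> t \<and> ennreal t < b} = {0..<r}"
      by (auto simp: ennreal_less_iff)
    with real show ?thesis by simp
  next
    case top
    then have "{t. 0 \<le> t \<and> ennreal t < b} = {0..}"
      by auto
    with top show ?thesis by (simp add: emeasure_lborel_Ici)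
  qed
  then show ?thesis
    by (simp add: killed_def win_def)
qed

lemma emeasure_cycle_space: "emeasure cycle_measure (space S) = (\<integral>\<^sup>+w. T ystar w \<partial>N)"
proof -
  have "killed 0 (indicator (space S)) ystar = killed 0 (\<lambda>_. 1) ystar"
    unfolding killed_def win_def using path_in_S[OF ystar_in_S]
    by (intro nn_integral_cong) (auto split: split_indicator)
  then show ?thesis
    by (simp add: emeasure_cycle_measure killed_one)
qed

subsection \<open>Uniqueness\<close>

lemma resolvent_Fubini:
  assumes y: "y \<in> space S" and f [measurable]: "f \<in> borel_measurable S"
  shows "resolvent \<epsilon> f y = (\<integral>\<^sup>+t. indicator {0..} t * (ennreal (exp (- \<epsilon> * t)) * transition_op t f y) \<partial>lborel)"
proof -
  interpret pair_sigma_finite N lborel ..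
  have [measurable]: "(\<lambda>p. f (path y (fst p) (snd p))) \<in> borel_measurable (N \<Otimes>\<^sub>M lborel)"
    using y by measurable
  have "resolvent \<epsilon> f y =
      (\<integral>\<^sup>+w. (\<integral>\<^sup>+t. indicator {0..} t * (ennreal (exp (- \<epsilon> * t)) * f (path y w t)) \<partial>lborel) \<partial>N)"
    unfolding resolvent_def win_def
    by (intro nn_integral_cong) (auto split: split_indicator)
  also have "\<dots> = (\<integral>\<^sup>+t. (\<integral>\<^sup>+w. indicator {0..} t * (ennreal (exp (- \<epsilon> * t)) * f (path y w t)) \<partial>N) \<partial>lborel)"
    by (rule Fubini'[symmetric]) measurable
  also have "\<dots> = (\<integral>\<^sup>+t. indicator {0..} t * (ennreal (exp (- \<epsilon> * t)) * transition_op t f y) \<partial>lborel)"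
  proof (rule nn_integral_cong)
    fix t
    have [measurable]: "(\<lambda>w. f (path y w t)) \<in> borel_measurable N"
      using y by measurable
    show "(\<integral>\<^sup>+w. indicator {0..} t * (ennreal (exp (- \<epsilon> * t)) * f (path y w t)) \<partial>N) =
        indicator {0..} t * (ennreal (exp (- \<epsilon> * t)) * transition_op t f y)"
      by (simp add: nn_integral_cmult transition_op_def)
  qed
  finally show ?thesis .
qed

text \<open>A path stays in the state space for an infinite length of time, so the integral of a
  positive function along it cannot vanish.\<close>

lemma resolvent_pos:
  assumes y: "y \<in> space S" and f [measurable]: "f \<in> borel_measurable S" and pos: "\<And>x. x \<in> space S \<Longrightarrow> 0 < f x"
  shows "resolvent \<epsilon> f y \<noteq> 0"
proof
  assume *: "resolvent \<epsilon> f y = 0"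
  have [measurable]: "(\<lambda>w. win \<epsilon> f \<infinity> y w) \<in> borel_measurable N"
    using y by measurable
  have "AE w in N. win \<epsilon> f \<infinity> y w = 0"
    by (rule nn_integral_0_iff_AE[THEN iffD1, OF _ *[unfolded resolvent_def]]) measurable
  moreover have "win \<epsilon> f \<infinity> y w \<noteq> 0" for w
  proof
    have [measurable]: "(\<lambda>t. f (path y w t)) \<in> borel_measurable lborel"
      using y by measurable
    assume 0: "win \<epsilon> f \<infinity> y w = 0"
    have "AE t in lborel. ennreal (exp (- \<epsilon> * t)) * f (path y w t) * indicator {t. 0 \<le> t \<and> ennreal t < \<infinity>} t = 0"
      by (rule nn_integral_0_iff_AE[THEN iffD1, OF _ 0[unfolded win_def]]) measurable
    then have "AE t in lborel. t \<notin> {0::real..}"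
    proof eventually_elim
      case (elim t)
      show ?case
      proof
        assume "t \<in> {0..}"
        with elim have "f (path y w t) = 0" by simp
        with pos[OF path_in_S[OF y, of w t]] show False by simp
      qed
    qed
    then have "emeasure lborel {0::real..} = 0"
      using AE_iff_measurable[of "{0::real..}" lborel "\<lambda>t. t \<notin> {0..}"] by (simp add: atLeast_def)
    then show False by (simp add: emeasure_lborel_Ici)
  qed
  ultimately show False by simp
qed

section \<open>Integrals against a fixed invariant measure\<close>

context
  fixes \<nu> :: "state measure"
  assumes nu: "sigma_finite_measure \<nu>" and sets_nu [measurable_cong]: "sets \<nu> = sets S"
    and inv: "\<And>t B. 0 \<le> t \<Longrightarrow> B \<in> sets S \<Longrightarrow>
      (\<integral>\<^sup>+y. transition_op t (indicator B) y \<partial>\<nu>) = emeasure \<nu> B"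
begin

lemma space_nu: "space \<nu> = space S"
  by (rule sets_eq_imp_space_eq[OF sets_nu])

text \<open>Invariance on sets says that the image of \<open>\<nu> \<Otimes>\<^sub>M N\<close> under
  the position at time \<open>t\<close> is \<open>\<nu>\<close>, and images carry integrals of
  functions.\<close>

lemma nn_integral_transition_op:
  assumes [measurable]: "f \<in> borel_measurable S" and t: "0 \<le> t"
  shows "(\<integral>\<^sup>+y. transition_op t f y \<partial>\<nu>) = (\<integral>\<^sup>+y. f y \<partial>\<nu>)"
proof -
  have [measurable]: "(\<lambda>p. path (fst p) (snd p) t) \<in> \<nu> \<Otimes>\<^sub>M N \<rightarrow>\<^sub>M S"
    by measurable
  have int: "(\<integral>\<^sup>+y. transition_op t g y \<partial>\<nu>) = (\<integral>\<^sup>+y. g y \<partial>distr (\<nu> \<Otimes>\<^sub>M N) S (\<lambda>p. path (fst p) (snd p) t))"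
    if [measurable]: "g \<in> borel_measurable S" for g
    unfolding transition_op_def
    by (subst nn_integral_distr, measurable, subst N.nn_integral_fst[symmetric]) auto
  have "distr (\<nu> \<Otimes>\<^sub>M N) S (\<lambda>p. path (fst p) (snd p) t) = \<nu>"
  proof (rule measure_eqI)
    fix B assume "B \<in> sets (distr (\<nu> \<Otimes>\<^sub>M N) S (\<lambda>p. path (fst p) (snd p) t))"
    then have B: "B \<in> sets S" by simp
    then show "emeasure (distr (\<nu> \<Otimes>\<^sub>M N) S (\<lambda>p. path (fst p) (snd p) t)) B = emeasure \<nu> B"
      using inv[OF t B] int[of "indicator B"] by simp
  qed (simp add: sets_nu)
  with int[OF assms(1)] show ?thesis by simp
qed

text \<open>\<open>\<epsilon> * resolvent \<epsilon>\<close> averages the transition operators over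
  an exponentially distributed time, and each of them preserves \<open>\<nu>\<close>.
  Sigma-finiteness permits exchanging the integrals.\<close>

lemma nn_integral_resolvent:
  assumes f [measurable]: "f \<in> borel_measurable S" and eps: "0 < \<epsilon>"
  shows "ennreal \<epsilon> * (\<integral>\<^sup>+y. resolvent \<epsilon> f y \<partial>\<nu>) = (\<integral>\<^sup>+y. f y \<partial>\<nu>)"
proof -
  interpret nu: sigma_finite_measure \<nu> by (rule nu)
  interpret pair_sigma_finite \<nu> lborel ..
  have "(\<integral>\<^sup>+y. resolvent \<epsilon> f y \<partial>\<nu>) =
      (\<integral>\<^sup>+y. (\<integral>\<^sup>+t. indicator {0..} t * (ennreal (exp (- \<epsilon> * t)) * transition_op t f y) \<partial>lborel) \<partial>\<nu>)"
    by (intro nn_integral_cong resolvent_Fubini) (simp_all add: space_nu)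
  also have "\<dots> = (\<integral>\<^sup>+t. (\<integral>\<^sup>+y. indicator {0..} t * (ennreal (exp (- \<epsilon> * t)) * transition_op t f y) \<partial>\<nu>) \<partial>lborel)"
    by (rule Fubini'[symmetric]) measurable
  also have "\<dots> = (\<integral>\<^sup>+t. (\<integral>\<^sup>+y. f y \<partial>\<nu>) * (ennreal (exp (- \<epsilon> * t)) * indicator {0..} t) \<partial>lborel)"
  proof (rule nn_integral_cong)
    fix t :: real
    have [measurable]: "transition_op t f \<in> borel_measurable \<nu>"
      by measurable
    show "(\<integral>\<^sup>+y. indicator {0..} t * (ennreal (exp (- \<epsilon> * t)) * transition_op t f y) \<partial>\<nu>) =
        (\<integral>\<^sup>+y. f y \<partial>\<nu>) * (ennreal (exp (- \<epsilon> * t)) * indicator {0..} t)"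
      by (cases "0 \<le> t") (simp_all add: nn_integral_cmult nn_integral_transition_op mult.commute)
  qed
  also have "\<dots> = (\<integral>\<^sup>+y. f y \<partial>\<nu>) * ennreal (1 / \<epsilon>)"
    using eps by (subst nn_integral_cmult) (auto simp: nn_integral_exp_Ici[simplified])
  finally have *: "(\<integral>\<^sup>+y. resolvent \<epsilon> f y \<partial>\<nu>) = (\<integral>\<^sup>+y. f y \<partial>\<nu>) * ennreal (1 / \<epsilon>)" .
  have "ennreal \<epsilon> * ennreal (1 / \<epsilon>) = 1"
    using eps by (subst ennreal_mult[symmetric]) auto
  then show ?thesis
    unfolding * mult.left_commute[of "ennreal \<epsilon>"] by simp
qed

lemma nn_integral_killed:
  assumes f [measurable]: "f \<in> borel_measurable S" and eps: "0 < \<epsilon>"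
  shows "(\<integral>\<^sup>+y. f y \<partial>\<nu>) = ennreal \<epsilon> * (\<integral>\<^sup>+y. killed \<epsilon> f y \<partial>\<nu>) +
    ennreal \<epsilon> * (\<integral>\<^sup>+y. laplace \<epsilon> y \<partial>\<nu>) * resolvent \<epsilon> f ystar"
proof -
  have "(\<integral>\<^sup>+y. resolvent \<epsilon> f y \<partial>\<nu>) = (\<integral>\<^sup>+y. killed \<epsilon> f y + laplace \<epsilon> y * resolvent \<epsilon> f ystar \<partial>\<nu>)"
    by (intro nn_integral_cong resolvent_eq) (simp_all add: space_nu)
  also have "\<dots> = (\<integral>\<^sup>+y. killed \<epsilon> f y \<partial>\<nu>) + (\<integral>\<^sup>+y. laplace \<epsilon> y \<partial>\<nu>) * resolvent \<epsilon> f ystar"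
    by (subst nn_integral_add) (auto simp: nn_integral_multc)
  finally show ?thesis
    unfolding nn_integral_resolvent[OF f eps, symmetric] by (simp add: distrib_left mult.assoc)
qed

text \<open>Sigma-finiteness supplies a positive \<open>h\<close> of finite integral. That integral
  dominates \<open>\<epsilon> * \<nu> s\<^sub>\<epsilon> * R\<^sub>\<epsilon> h y*\<close>, whose
  last factor is positive.\<close>

lemma nn_integral_laplace_finite:
  assumes eps: "0 < \<epsilon>"
  shows "(\<integral>\<^sup>+y. laplace \<epsilon> y \<partial>\<nu>) < \<infinity>"
proof -
  interpret nu: sigma_finite_measure \<nu> by (rule nu)
  obtain h where h [measurable]: "h \<in> borel_measurable \<nu>" and fin: "(\<integral>\<^sup>+y. h y \<partial>\<nu>) \<noteq> \<infinity>"
    and pos: "\<And>x. x \<in> space \<nu> \<Longrightarrow> 0 < h x \<and> h x < \<infinity>"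
    using nu.Ex_finite_integrable_function by auto
  have hS: "h \<in> borel_measurable S"
    by measurable
  have "resolvent \<epsilon> h ystar \<noteq> 0"
    using pos by (intro resolvent_pos hS) (auto simp: space_nu)
  moreover have "ennreal \<epsilon> * (\<integral>\<^sup>+y. laplace \<epsilon> y \<partial>\<nu>) * resolvent \<epsilon> h ystar \<le> (\<integral>\<^sup>+y. h y \<partial>\<nu>)"
    unfolding nn_integral_killed[OF hS eps] by simp
  from le_less_trans[OF this] have "ennreal \<epsilon> * (\<integral>\<^sup>+y. laplace \<epsilon> y \<partial>\<nu>) * resolvent \<epsilon> h ystar < \<infinity>"
    using fin by (simp add: top.not_eq_extremum)
  ultimately show ?thesis
    using eps by (auto simp: ennreal_mult_less_top)
qed

text \<open>The inequality comes from dropping the nonnegative first term in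
  \<open>nn_integral_killed\<close>. The point is that one and the same \<open>c\<close> serves
  every \<open>\<epsilon>\<close> between 0 and 1.\<close>

lemma ex_laplace_ratio:
  obtains c where "c < \<infinity>" "(\<integral>\<^sup>+y. laplace 1 y \<partial>\<nu>) = c * (\<integral>\<^sup>+y. laplace 1 y \<partial>cycle_measure)"
    "\<And>\<epsilon> f. 0 < \<epsilon> \<Longrightarrow> \<epsilon> < 1 \<Longrightarrow> f \<in> borel_measurable S \<Longrightarrow> c * killed \<epsilon> f ystar \<le> (\<integral>\<^sup>+y. f y \<partial>\<nu>)"
proof -
  obtain a where a: "laplace 1 ystar = ennreal a" "0 \<le> a" "a < 1"
    using laplace_less_1[OF ystar_in_S, of 1]
    by (cases "laplace 1 ystar") (auto simp: ennreal_less_one_iff)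
  obtain n where n: "(\<integral>\<^sup>+y. laplace 1 y \<partial>\<nu>) = ennreal n" "0 \<le> n"
    using nn_integral_laplace_finite[of 1] by (cases "\<integral>\<^sup>+y. laplace 1 y \<partial>\<nu>") auto
  \<comment> \<open>Dictated by the required ratio, since
    \<open>\<Pi> s\<^sub>1 = 1 - a\<close>.\<close>
  define c where "c = ennreal (n / (1 - a))"
  have cyc: "(\<integral>\<^sup>+y. laplace 1 y \<partial>cycle_measure) = ennreal (1 - a)"
    using nn_integral_cycle_laplace a
    by (cases "\<integral>\<^sup>+y. laplace 1 y \<partial>cycle_measure") (auto simp flip: ennreal_plus ennreal_1)
  show ?thesis
  proof
    show "c < \<infinity>" by (simp add: c_def)
    show "(\<integral>\<^sup>+y. laplace 1 y \<partial>\<nu>) = c * (\<integral>\<^sup>+y. laplace 1 y \<partial>cycle_measure)"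
      using a n by (simp add: cyc c_def ennreal_mult'[symmetric])
  next
    fix \<epsilon> :: real and f :: "state \<Rightarrow> ennreal" assume eps: "0 < \<epsilon>" "\<epsilon> < 1" and f: "f \<in> borel_measurable S"
    \<comment> \<open>Besides \<open>a = s\<^sub>1 y*\<close> and
      \<open>n = \<nu> s\<^sub>1\<close>, the real numbers \<open>b\<close>, \<open>m\<close>,
      \<open>k\<close>, \<open>u\<close> stand for \<open>s\<^sub>\<epsilon> y*\<close>,
      \<open>\<nu> s\<^sub>\<epsilon>\<close>, \<open>\<nu> (U\<^sub>\<epsilon> s\<^sub>1)\<close>
      and \<open>U\<^sub>\<epsilon> s\<^sub>1 y*\<close>.\<close>
    obtain b where b: "laplace \<epsilon> ystar = ennreal b" "0 \<le> b" "b < 1"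
      using laplace_less_1[OF ystar_in_S, of \<epsilon>] eps
      by (cases "laplace \<epsilon> ystar") (auto simp: ennreal_less_one_iff)
    obtain m where m: "(\<integral>\<^sup>+y. laplace \<epsilon> y \<partial>\<nu>) = ennreal m" "0 \<le> m"
      using nn_integral_laplace_finite[of \<epsilon>] eps by (cases "\<integral>\<^sup>+y. laplace \<epsilon> y \<partial>\<nu>") auto
    have sum: "ennreal (1 - \<epsilon>) * (\<integral>\<^sup>+y. killed \<epsilon> (laplace 1) y \<partial>\<nu>) + ennreal n = ennreal m"
    proof -
      have "(\<integral>\<^sup>+y. laplace \<epsilon> y \<partial>\<nu>) = (\<integral>\<^sup>+y. ennreal (1 - \<epsilon>) * killed \<epsilon> (laplace 1) y + laplace 1 y \<partial>\<nu>)"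
        using eps by (intro nn_integral_cong killed_laplace[symmetric]) (auto simp: space_nu)
      also have "\<dots> = ennreal (1 - \<epsilon>) * (\<integral>\<^sup>+y. killed \<epsilon> (laplace 1) y \<partial>\<nu>) + (\<integral>\<^sup>+y. laplace 1 y \<partial>\<nu>)"
        by (subst nn_integral_add) (auto simp: nn_integral_cmult)
      finally show ?thesis using n m by simp
    qed
    obtain k where k: "(\<integral>\<^sup>+y. killed \<epsilon> (laplace 1) y \<partial>\<nu>) = ennreal k" "0 \<le> k"
      using sum eps by (cases "\<integral>\<^sup>+y. killed \<epsilon> (laplace 1) y \<partial>\<nu>") (auto simp: ennreal_mult_top)
    have k_eq: "(1 - \<epsilon>) * k + n = m"
      using sum k n m eps by (simp flip: ennreal_plus ennreal_mult)
    obtain u where u: "killed \<epsilon> (laplace 1) ystar = ennreal u" "0 \<le> u"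
      using killed_laplace[OF ystar_in_S, of \<epsilon>] eps a b
      by (cases "killed \<epsilon> (laplace 1) ystar") (auto simp: ennreal_mult_top)
    have u_eq: "(1 - \<epsilon>) * u + a = b"
      using killed_laplace[OF ystar_in_S, of \<epsilon>] eps a b u by (simp flip: ennreal_plus ennreal_mult)
    \<comment> \<open>Solving \<open>resolvent_eq\<close> at \<open>ystar\<close> gives equality if
      the resolvent is finite; otherwise the bound is trivial.\<close>
    have res_ge: "ennreal (1 / (1 - b)) * killed \<epsilon> g ystar \<le> resolvent \<epsilon> g ystar"
      if "g \<in> borel_measurable S" for g
    proof (cases "resolvent \<epsilon> g ystar")
      case (real r)
      with resolvent_eq[OF ystar_in_S that, of \<epsilon>] obtain v
        where v: "killed \<epsilon> g ystar = ennreal v" "0 \<le> v"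
        by (cases "killed \<epsilon> g ystar") auto
      have "r = v + b * r"
        using resolvent_eq[OF ystar_in_S that, of \<epsilon>] real v b by (simp flip: ennreal_plus ennreal_mult)
      then have "v / (1 - b) = r"
        using b by (simp add: field_simps)
      with real v b show ?thesis
        by (simp flip: ennreal_mult)
    qed simp
    have bound: "ennreal \<epsilon> * ennreal m * ennreal (1 / (1 - b)) * killed \<epsilon> g ystar \<le> (\<integral>\<^sup>+y. g y \<partial>\<nu>)"
      if "g \<in> borel_measurable S" for g
    proof -
      have "ennreal \<epsilon> * ennreal m * (ennreal (1 / (1 - b)) * killed \<epsilon> g ystar) \<le>
          ennreal \<epsilon> * ennreal m * resolvent \<epsilon> g ystar"
        by (intro mult_left_mono res_ge that) simp
      also have "\<dots> \<le> (\<integral>\<^sup>+y. g y \<partial>\<nu>)"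
        using nn_integral_killed[OF that eps(1)] m by simp
      finally show ?thesis by (simp add: mult.assoc)
    qed
    have "c = ennreal \<epsilon> * ennreal m * ennreal (1 / (1 - b))"
    proof -
      have fin: "resolvent \<epsilon> (laplace 1) ystar = ennreal (u / (1 - b))"
      proof (cases "resolvent \<epsilon> (laplace 1) ystar")
        case (real r)
        have "r = u + b * r"
          using resolvent_eq[OF ystar_in_S laplace_measurable, of \<epsilon> 1] real u b
          by (simp flip: ennreal_plus ennreal_mult)
        then have "u / (1 - b) = r"
          using b by (simp add: field_simps)
        with real show ?thesis by simp
      next
        case top
        \<comment> \<open>An infinite value is impossible: \<open>laplace 1 \<le> 1\<close> bounds
          the resolvent by \<open>1 / \<epsilon>\<close>.\<close>
        have "resolvent \<epsilon> (laplace 1) ystar \<le> (\<integral>\<^sup>+t. ennreal (exp (- \<epsilon> * t)) * indicator {0..} t \<partial>lborel)"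
          unfolding resolvent_Fubini[OF ystar_in_S laplace_measurable]
        proof (rule nn_integral_mono)
          fix t
          have "transition_op t (laplace 1) ystar \<le> (\<integral>\<^sup>+w. 1 \<partial>N)"
            unfolding transition_op_def by (intro nn_integral_mono laplace_le_1) simp
          then have "transition_op t (laplace 1) ystar \<le> 1"
            using N.emeasure_space_1 by simp
          from mult_left_mono[OF this, of "ennreal (exp (- \<epsilon> * t))"]
          show "indicator {0..} t * (ennreal (exp (- \<epsilon> * t)) * transition_op t (laplace 1) ystar) \<le>
              ennreal (exp (- \<epsilon> * t)) * indicator {0..} t"
            by (auto split: split_indicator)
        qed
        also have "\<dots> < \<infinity>"
          by (subst nn_integral_exp_Ici[OF eps(1)]) simp
        finally show ?thesis using top by simp
      qed
      have "ennreal n = ennreal \<epsilon> * ennreal k + ennreal \<epsilon> * ennreal m * ennreal (u / (1 - b))"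
        using nn_integral_killed[OF laplace_measurable eps(1), of 1] n m k fin by simp
      then have "n = \<epsilon> * k + \<epsilon> * m * (u / (1 - b))"
        using eps k m u b n by (simp flip: ennreal_plus ennreal_mult)
      \<comment> \<open>Multiplication by \<open>1 - \<epsilon>\<close> allows \<open>k\<close> and
        \<open>u\<close> to be eliminated in favour of \<open>m - n\<close> and
        \<open>b - a\<close>.\<close>
      then have "(1 - \<epsilon>) * n = \<epsilon> * ((1 - \<epsilon>) * k) + \<epsilon> * m * (((1 - \<epsilon>) * u) / (1 - b))"
        by (simp add: algebra_simps)
      moreover have e: "(1 - \<epsilon>) * k = m - n" "(1 - \<epsilon>) * u = b - a"
        using k_eq u_eq by auto
      ultimately have "n = \<epsilon> * m + \<epsilon> * m * ((b - a) / (1 - b))"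
        unfolding e by (simp add: algebra_simps)
      also have "\<dots> = \<epsilon> * m * ((1 - a) / (1 - b))"
        using b by (simp add: field_simps)
      finally have "n / (1 - a) = \<epsilon> * m * (1 / (1 - b))"
        using a b by (simp add: field_simps)
      then show ?thesis
        using eps m b by (simp add: c_def flip: ennreal_mult)
    qed
    with bound[OF f] show "c * killed \<epsilon> f ystar \<le> (\<integral>\<^sup>+y. f y \<partial>\<nu>)" by simp
  qed
qed

text \<open>Monotone convergence along rates that decrease to 0 and lie strictly between 0 and 1,
  the range covered by \<open>ex_laplace_ratio\<close>.\<close>

lemma killed_0_eq_SUP:
  assumes [measurable]: "f \<in> borel_measurable S"
  shows "killed 0 f ystar = (SUP n. killed (1 / real (n + 2)) f ystar)"
proof -
  define I where "I p = (indicator {t. 0 \<le> t \<and> ennreal t < T ystar (fst p)} (snd p) :: ennreal)"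
    for p :: "(real \<times> real) stream \<times> real"
  define g where "g n p = I p * (ennreal (exp (- (1 / real (n + 2)) * snd p)) * f (path ystar (fst p) (snd p)))"
    for n and p :: "(real \<times> real) stream \<times> real"
  have [measurable]: "I \<in> borel_measurable (N \<Otimes>\<^sub>M lborel)"
    unfolding I_def by measurable
  have [measurable]: "g n \<in> borel_measurable (N \<Otimes>\<^sub>M lborel)" for n
    unfolding g_def by measurable
  have mono: "incseq g"
  proof (intro incseq_SucI le_funI)
    fix n p
    show "g n p \<le> g (Suc n) p"
    proof (cases "0 \<le> snd p")
      case True
      have "1 / real (Suc n + 2) * snd p \<le> 1 / real (n + 2) * snd p"
        by (intro mult_right_mono divide_left_mono) (use True in auto)
      then have "exp (- (1 / real (n + 2)) * snd p) \<le> exp (- (1 / real (Suc n + 2)) * snd p)"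
        by simp
      then show ?thesis
        unfolding g_def by (intro mult_left_mono mult_right_mono ennreal_leI) auto
    qed (simp add: g_def I_def)
  qed
  have lim: "(SUP n. g n p) = I p * (ennreal (exp (- 0 * snd p)) * f (path ystar (fst p) (snd p)))" for p
  proof (rule LIMSEQ_unique[OF LIMSEQ_SUP])
    show "incseq (\<lambda>n. g n p)"
      using mono by (simp add: incseq_def le_fun_def del: split_paired_All)
    have "(\<lambda>n. 1 / real (n + 2)) \<longlonglongrightarrow> 0"
      using LIMSEQ_ignore_initial_segment[OF lim_1_over_n, of 2] by simp
    then have "(\<lambda>n. ennreal (exp (- (1 / real (n + 2)) * snd p))) \<longlonglongrightarrow> ennreal (exp (- 0 * snd p))"
      by (intro tendsto_ennrealI tendsto_exp tendsto_mult tendsto_minus tendsto_const)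
    then have "(\<lambda>n. ennreal (exp (- (1 / real (n + 2)) * snd p)) * (I p * f (path ystar (fst p) (snd p)))) \<longlonglongrightarrow>
        ennreal (exp (- 0 * snd p)) * (I p * f (path ystar (fst p) (snd p)))"
      by (intro tendsto_mult_ennreal tendsto_const) auto
    then show "(\<lambda>n. g n p) \<longlonglongrightarrow> I p * (ennreal (exp (- 0 * snd p)) * f (path ystar (fst p) (snd p)))"
      unfolding g_def by (simp only: mult.left_commute)
  qed
  have "killed 0 f ystar = (\<integral>\<^sup>+p. (SUP n. g n p) \<partial>(N \<Otimes>\<^sub>M lborel))"
    unfolding lim killed_eq_pair[OF assms] I_def ..
  also have "\<dots> = (SUP n. \<integral>\<^sup>+p. g n p \<partial>(N \<Otimes>\<^sub>M lborel))"
    by (intro nn_integral_monotone_convergence_SUP mono) auto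
  also have "\<dots> = (SUP n. killed (1 / real (n + 2)) f ystar)"
    unfolding g_def I_def killed_eq_pair[OF assms] ..
  finally show ?thesis .
qed

lemma invariant_eq_scale: "\<exists>c<\<infinity>. \<nu> = scale_measure c cycle_measure"
proof -
  obtain c where c: "c < \<infinity>" "(\<integral>\<^sup>+y. laplace 1 y \<partial>\<nu>) = c * (\<integral>\<^sup>+y. laplace 1 y \<partial>cycle_measure)"
    and le: "\<And>\<epsilon> f. 0 < \<epsilon> \<Longrightarrow> \<epsilon> < 1 \<Longrightarrow> f \<in> borel_measurable S \<Longrightarrow> c * killed \<epsilon> f ystar \<le> (\<integral>\<^sup>+y. f y \<partial>\<nu>)"
    by (rule ex_laplace_ratio) blast
  have "scale_measure c cycle_measure = \<nu>"
  proof (rule measure_eqI_le[where f = "laplace 1"])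
    show "0 < laplace 1 x \<and> laplace 1 x < \<infinity>" if "x \<in> space (scale_measure c cycle_measure)" for x
      using that laplace_pos[of x 1] laplace_le_1[of 1 x]
      by (auto simp: space_scale_measure sets_eq_imp_space_eq[OF sets_cycle_measure] le_less_trans)
    show "(\<integral>\<^sup>+x. g x \<partial>scale_measure c cycle_measure) \<le> (\<integral>\<^sup>+x. g x \<partial>\<nu>)"
      if "g \<in> borel_measurable (scale_measure c cycle_measure)" for g
    proof -
      have g: "g \<in> borel_measurable S"
        using that by (simp cong: measurable_cong_sets add: sets_cycle_measure)
      have "(\<integral>\<^sup>+x. g x \<partial>scale_measure c cycle_measure) = c * killed 0 g ystar"
        using g by (subst nn_integral_scale_measure) (auto simp: nn_integral_cycle_measure cong: measurable_cong_sets)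
      also have "\<dots> = (SUP n. c * killed (1 / real (n + 2)) g ystar)"
        unfolding killed_0_eq_SUP[OF g] by (rule SUP_mult_left_ennreal)
      also have "\<dots> \<le> (\<integral>\<^sup>+x. g x \<partial>\<nu>)"
        by (intro SUP_least le g) auto
      finally show ?thesis .
    qed
    have eq: "(\<integral>\<^sup>+x. laplace 1 x \<partial>scale_measure c cycle_measure) = c * (\<integral>\<^sup>+x. laplace 1 x \<partial>cycle_measure)"
      by (rule nn_integral_scale_measure) measurable
    show "(\<integral>\<^sup>+x. laplace 1 x \<partial>scale_measure c cycle_measure) = (\<integral>\<^sup>+x. laplace 1 x \<partial>\<nu>)"
      by (simp add: eq c)
    then show "(\<integral>\<^sup>+x. laplace 1 x \<partial>scale_measure c cycle_measure) < \<infinity>"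
      using nn_integral_laplace_finite[of 1] by simp
  qed (auto simp: sets_nu sets_cycle_measure)
  with c show ?thesis by auto
qed

end

end

section \<open>Transfer to the given probability space\<close>

theorem theorem4p1:
  fixes \<alpha> \<beta> A lam0 :: real
    and G :: "real \<Rightarrow> real"
    and ell :: "nat \<Rightarrow> real \<Rightarrow> real"
    and M :: "'w measure"
    and E Z :: "nat \<Rightarrow> 'w \<Rightarrow> real"
    and S :: "state measure"
    and Y :: "state \<Rightarrow> real \<Rightarrow> 'w \<Rightarrow> state"
    and T :: "state \<Rightarrow> 'w \<Rightarrow> ennreal"
  assumes "\<alpha> \<ge> 0" and "\<beta> > 0" and "\<beta> < A" and "0 < lam0" and "lam0 \<le> \<beta>"
    and ell_pos: "\<And>n z. n \<ge> 1 \<Longrightarrow> z \<ge> 0 \<Longrightarrow> ell n z > 0"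
    and ell_mono: "\<And>n. n \<ge> 1 \<Longrightarrow> mono_on {0..} (ell n)"
    and ell_cont: "\<And>n. n \<ge> 1 \<Longrightarrow> continuous_on {0..} (ell n)"
    and "prob_space M"
    and indep: "prob_space.indep_vars M (\<lambda>_. borel) (case_sum E Z) ({1..} <+> {1..})"
    and E_dist: "\<And>i. i \<ge> 1 \<Longrightarrow> distributed M lborel (E i) (exponential_density 1)"
    and Z_nonneg: "\<And>i \<omega>. i \<ge> 1 \<Longrightarrow> \<omega> \<in> space M \<Longrightarrow> Z i \<omega> \<ge> 0"
    and Z_dist: "\<And>i. i \<ge> 1 \<Longrightarrow> cdf (distr M borel (Z i)) = G"
    and Z_square: "\<And>i. i \<ge> 1 \<Longrightarrow> integrable M (\<lambda>\<omega>. (Z i \<omega>)\<^sup>2)"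
    and S_def: "S = state_space lam0 A"
    and Y_def: "Y = (\<lambda>y t \<omega>. pdmp_path \<alpha> \<beta> A lam0 ell y (\<lambda>i. E i \<omega>) (\<lambda>i. Z i \<omega>) t)"
    and T_def: "T = (\<lambda>y \<omega>. first_reset \<alpha> \<beta> A lam0 ell y (\<lambda>i. E i \<omega>) (\<lambda>i. Z i \<omega>))"
    and reset: "\<And>y. y \<in> space S \<Longrightarrow> \<P>(\<omega> in M. T y \<omega> < \<infinity>) = 1"
  shows "harris_recurrent S M Y \<and>
    (\<exists>\<pi>. sets \<pi> = sets S \<and>
       (\<forall>B\<in>sets S. emeasure \<pi> B =
          (\<integral>\<^sup>+\<omega>. (\<integral>\<^sup>+t\<in>{t. 0 \<le> t \<and> ennreal t < T (0, lam0) \<omega>}.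
             indicator B (Y (0, lam0) t \<omega>) \<partial>lborel) \<partial>M)) \<and>
       unique_invariant S M Y \<pi> \<and>
       (finite_measure \<pi> \<longleftrightarrow> (\<integral>\<^sup>+\<omega>. T (0, lam0) \<omega> \<partial>M) < \<infinity>))"
proof -
  interpret prob_space M by fact
  \<comment> \<open>\<open>L\<close> agrees with \<open>ell\<close> at the marks that occur, which
    are nonnegative; clamping makes it positive and continuous on the whole line for each
    \<open>n \<ge> 1\<close>.\<close>
  define L where "L n z = ell n (max 0 z)" for n z
  define mark where "mark = distr M borel (Z 1)"
  have rv: "case_sum E Z i \<in> borel_measurable M" if "i \<in> {1..} <+> {1..}" for i
    using indep that by (auto simp: indep_vars_def)
  have [measurable]: "E (Suc i) \<in> borel_measurable M" "Z (Suc i) \<in> borel_measurable M" for i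
    using rv[of "Inl (Suc i)"] rv[of "Inr (Suc i)"] by auto
  interpret pdmp: resetting_pdmp \<alpha> \<beta> A lam0 L mark
  proof (rule resetting_pdmp.intro)
    show "0 < L (Suc n) z" for n z
      by (simp add: L_def ell_pos)
    show "L (Suc n) \<in> borel_measurable borel" for n
    proof (rule borel_measurable_continuous_onI)
      show "continuous_on UNIV (L (Suc n))"
        unfolding L_def
        by (rule continuous_on_compose2[OF ell_cont]) (auto intro!: continuous_intros)
    qed
    show "prob_space mark"
      unfolding mark_def using rv[of "Inr 1"] by (intro prob_space_distr) auto
  qed (use assms in \<open>auto simp: mark_def\<close>)

  define W where "W \<omega> = to_stream (\<lambda>i. (E (Suc i) \<omega>, Z (Suc i) \<omega>))" for \<omega>
  have law: "distr M (borel \<Otimes>\<^sub>M borel) (\<lambda>\<omega>. (E (Suc i) \<omega>, Z (Suc i) \<omega>)) = pdmp.noise" for i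
  proof -
    have "distr M borel (E (Suc i)) = distr M lborel (E (Suc i))"
      by (rule distr_cong) auto
    also have "\<dots> = density lborel (exponential_density 1)"
      using E_dist[of "Suc i"] by (simp add: distributed_def)
    finally have "distr M borel (E (Suc i)) = density lborel (exponential_density 1)" .
    \<comment> \<open>All marks share the distribution function \<open>G\<close>, hence the law of
      \<open>Z 1\<close>.\<close>
    moreover have "distr M borel (Z (Suc i)) = mark"
      unfolding mark_def using rv[of "Inr 1"]
      by (intro cdf_unique real_distribution_distr) (auto simp: Z_dist)
    ultimately show ?thesis
      by (simp add: indep_vars_pairs(2)[OF indep] pdmp.noise_def)
  qed
  have W [measurable]: "W \<in> M \<rightarrow>\<^sub>M pdmp.N" and distr_W: "distr M pdmp.N W = pdmp.N"
    using distr_to_stream[OF indep_vars_pairs(1)[OF indep] law] unfolding W_def pdmp.N_def by auto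

  have Y_eq: "Y y t \<omega> = pdmp.raw_path y (W \<omega>) t" if "\<omega> \<in> space M" for y t \<omega>
    unfolding Y_def pdmp.raw_path_def using Z_nonneg[OF _ that]
    by (intro pdmp_path_cong) (auto simp: W_def to_stream_def L_def max_def)
  have T_eq: "T y \<omega> = pdmp.T y (W \<omega>)" if "\<omega> \<in> space M" for y \<omega>
    unfolding T_def pdmp.T_def using Z_nonneg[OF _ that]
    by (intro first_reset_cong) (auto simp: W_def to_stream_def L_def max_def)

  have S: "y \<in> space S \<longleftrightarrow> y \<in> space pdmp.S" for y
    by (simp add: S_def)
  interpret pdmp: recurrent_pdmp \<alpha> \<beta> A lam0 L mark
  proof
    fix y assume y: "y \<in> space pdmp.S"
    have [measurable]: "(\<lambda>w. pdmp.T y w) \<in> borel_measurable pdmp.N"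
      using y by measurable
    have "{\<omega> \<in> space M. T y \<omega> < \<infinity>} = {\<omega> \<in> space M. pdmp.T y (W \<omega>) < \<infinity>}"
      by (auto simp: T_eq)
    with reset[of y] y have "\<P>(\<omega> in M. pdmp.T y (W \<omega>) < \<infinity>) = 1"
      by (simp add: S_def)
    then have "AE \<omega> in M. pdmp.T y (W \<omega>) < \<infinity>"
      by (subst (asm) prob_Collect_eq_1) measurable
    then have "AE w in distr M pdmp.N W. pdmp.T y w < \<infinity>"
      by (subst AE_distr_iff) measurable
    then show "AE w in pdmp.N. pdmp.T y w < \<infinity>"
      by (simp only: distr_W)
  qed

  have transfer_AE: "AE \<omega> in M. P (W \<omega>)" if "AE w in pdmp.N. P w" for P
    by (rule AE_distrD[OF W]) (use that in \<open>simp only: distr_W\<close>)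
  have transfer_int: "(\<integral>\<^sup>+\<omega>. f (W \<omega>) \<partial>M) = (\<integral>\<^sup>+w. f w \<partial>pdmp.N)"
    if "f \<in> borel_measurable pdmp.N" for f
    using nn_integral_distr[OF W, of f] that by (simp only: distr_W)
  \<comment> \<open>One null event serves all times, as occupation integrals require.\<close>
  have AE_Y: "AE \<omega> in M. \<forall>t\<ge>0. Y y t \<omega> = pdmp.path y (W \<omega>) t" if "y \<in> space S" for y
    using transfer_AE[OF pdmp.AE_no_explosion[OF that[unfolded S]]] AE_space
    by eventually_elim (simp add: Y_eq)

  have transition: "transition M Y t y B = pdmp.transition_op t (indicator B) y"
    if t: "0 \<le> t" and B: "B \<in> sets S" and y: "y \<in> space S" for t B y
  proof -
    have [measurable]: "B \<in> sets pdmp.S"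
      using B by (simp add: S_def)
    have [measurable]: "(\<lambda>w. pdmp.path y w t) \<in> pdmp.N \<rightarrow>\<^sub>M pdmp.S"
      using y by (intro pdmp.path_measurable) (auto simp: S_def)
    have [measurable]: "(\<lambda>\<omega>. pdmp.raw_path y (W \<omega>) t) \<in> M \<rightarrow>\<^sub>M count_space UNIV \<Otimes>\<^sub>M borel"
      using y by (intro pdmp.raw_path_measurable) (auto simp: S_def)
    have [measurable]: "B \<in> sets (count_space UNIV \<Otimes>\<^sub>M borel)"
      using B by (intro pdmp.sets_S_borel) (simp add: S_def)
    \<comment> \<open>Outside \<open>sets M\<close> the value of \<open>emeasure\<close> is 0, so
      measurability must be established for the event itself. \<open>Y\<close> equals the raw path
      on all of \<open>space M\<close>, but \<open>path\<close> only almost surely.\<close>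
    have eq: "{\<omega> \<in> space M. Y y t \<omega> \<in> B} = {\<omega> \<in> space M. pdmp.raw_path y (W \<omega>) t \<in> B}"
      by (auto simp: Y_eq)
    have "emeasure M {\<omega> \<in> space M. pdmp.raw_path y (W \<omega>) t \<in> B} = (\<integral>\<^sup>+\<omega>. indicator {\<omega> \<in> space M. pdmp.raw_path y (W \<omega>) t \<in> B} \<omega> \<partial>M)"
      by (rule nn_integral_indicator[symmetric]) measurable
    also have "\<dots> = (\<integral>\<^sup>+\<omega>. indicator B (pdmp.path y (W \<omega>) t) \<partial>M)"
    proof (rule nn_integral_cong_AE)
      show "AE \<omega> in M. indicator {\<omega> \<in> space M. pdmp.raw_path y (W \<omega>) t \<in> B} \<omega> =
          (indicator B (pdmp.path y (W \<omega>) t) :: ennreal)"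
        using AE_Y[OF y] AE_space by eventually_elim (use t in \<open>auto simp: Y_eq split: split_indicator\<close>)
    qed
    also have "\<dots> = pdmp.transition_op t (indicator B) y"
      unfolding pdmp.transition_op_def by (rule transfer_int) measurable
    finally show ?thesis by (simp add: transition_def eq)
  qed
  have invariant_iff: "invariant S M Y \<nu> \<longleftrightarrow> sets \<nu> = sets S \<and>
      (\<forall>t\<ge>0. \<forall>B\<in>sets S. (\<integral>\<^sup>+y. pdmp.transition_op t (indicator B) y \<partial>\<nu>) = emeasure \<nu> B)" for \<nu>
  proof -
    have "(\<integral>\<^sup>+y. transition M Y t y B \<partial>\<nu>) = (\<integral>\<^sup>+y. pdmp.transition_op t (indicator B) y \<partial>\<nu>)"
      if "sets \<nu> = sets S" "0 \<le> t" "B \<in> sets S" for t B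
      using that sets_eq_imp_space_eq[OF that(1)] by (intro nn_integral_cong transition) auto
    then show ?thesis
      by (auto simp: invariant_def)
  qed

  let ?\<pi> = "pdmp.cycle_measure"
  have sets: "sets ?\<pi> = sets S"
    by (simp add: pdmp.sets_cycle_measure S_def)
  have space_pos: "emeasure ?\<pi> (space S) \<noteq> 0"
    using pdmp.nn_integral_T_pos[OF pdmp.ystar_in_S] by (simp add: S_def pdmp.emeasure_cycle_space)
  have T_int: "(\<integral>\<^sup>+\<omega>. T (0, lam0) \<omega> \<partial>M) = emeasure ?\<pi> (space S)"
  proof -
    have "(\<integral>\<^sup>+\<omega>. T (0, lam0) \<omega> \<partial>M) = (\<integral>\<^sup>+\<omega>. pdmp.T (0, lam0) (W \<omega>) \<partial>M)"
      by (intro nn_integral_cong) (simp add: T_eq)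
    also have "\<dots> = (\<integral>\<^sup>+w. pdmp.T (0, lam0) w \<partial>pdmp.N)"
      by (rule transfer_int) measurable
    finally show ?thesis by (simp add: S_def pdmp.emeasure_cycle_space)
  qed
  have formula: "emeasure ?\<pi> B = (\<integral>\<^sup>+\<omega>. (\<integral>\<^sup>+t\<in>{t. 0 \<le> t \<and> ennreal t < T (0, lam0) \<omega>}.
      indicator B (Y (0, lam0) t \<omega>) \<partial>lborel) \<partial>M)" if "B \<in> sets S" for B
  proof -
    have B [measurable]: "B \<in> sets pdmp.S"
      using that by (simp add: S_def)
    have "emeasure ?\<pi> B = (\<integral>\<^sup>+w. pdmp.win 0 (indicator B) (pdmp.T (0, lam0) w) (0, lam0) w \<partial>pdmp.N)"
      by (simp add: pdmp.emeasure_cycle_measure[OF B] pdmp.killed_def)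
    also have "\<dots> = (\<integral>\<^sup>+\<omega>. pdmp.win 0 (indicator B) (pdmp.T (0, lam0) (W \<omega>)) (0, lam0) (W \<omega>) \<partial>M)"
      by (rule transfer_int[symmetric]) measurable
    also have "\<dots> = (\<integral>\<^sup>+\<omega>. (\<integral>\<^sup>+t\<in>{t. 0 \<le> t \<and> ennreal t < T (0, lam0) \<omega>}.
      indicator B (Y (0, lam0) t \<omega>) \<partial>lborel) \<partial>M)"
    proof (rule nn_integral_cong_AE)
      have "(0, lam0) \<in> space S" by (simp add: S_def)
      from AE_Y[OF this] AE_space
      show "AE \<omega> in M. pdmp.win 0 (indicator B) (pdmp.T (0, lam0) (W \<omega>)) (0, lam0) (W \<omega>) =
          (\<integral>\<^sup>+t\<in>{t. 0 \<le> t \<and> ennreal t < T (0, lam0) \<omega>}. indicator B (Y (0, lam0) t \<omega>) \<partial>lborel)"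
        by eventually_elim (auto simp: pdmp.win_def T_eq intro!: nn_integral_cong split: split_indicator)
    qed
    finally show ?thesis .
  qed

  \<comment> \<open>\<Pi> itself is the reference measure: positive mass of \<open>B\<close> means
    positive mean occupation of \<open>B\<close> during a cycle from
    \<open>(0, lam0)\<close>.\<close>
  have "harris_recurrent S M Y"
    unfolding harris_recurrent_def
  proof (intro exI[of _ ?\<pi>] conjI ballI impI)
    fix B y assume "B \<in> sets S" "0 < emeasure ?\<pi> B" and y: "y \<in> space S"
    then have B: "B \<in> sets pdmp.S" and "pdmp.killed 0 (indicator B) (0, lam0) \<noteq> 0"
      by (auto simp: S_def pdmp.emeasure_cycle_measure)
    then have "AE w in pdmp.N. pdmp.win 0 (indicator B) \<infinity> y w = \<infinity>"
      using y by (intro pdmp.AE_occupation_infinite) (auto simp: S_def)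
    from transfer_AE[OF this] AE_Y[OF y]
    show "AE \<omega> in M. (\<integral>\<^sup>+t\<in>{0..}. indicator B (Y y t \<omega>) \<partial>lborel) = \<infinity>"
    proof eventually_elim
      case (elim \<omega>)
      have "(\<integral>\<^sup>+t\<in>{0..}. indicator B (Y y t \<omega>) \<partial>lborel) = pdmp.win 0 (indicator B) \<infinity> y (W \<omega>)"
        unfolding pdmp.win_def using elim(2) by (intro nn_integral_cong) (auto split: split_indicator)
      with elim(1) show ?case by simp
    qed
  qed (use pdmp.sigma_finite_cycle_measure sets space_pos in auto)
  moreover have "unique_invariant S M Y ?\<pi>"
    unfolding unique_invariant_def
  proof (intro conjI allI impI)
    show "invariant S M Y ?\<pi>"
      unfolding invariant_iff
    proof (intro conjI allI impI ballI)
      fix t :: real and B assume t: "0 \<le> t" and "B \<in> sets S"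
      then have B [measurable]: "B \<in> sets pdmp.S" by (simp add: S_def)
      have "(\<integral>\<^sup>+y. pdmp.transition_op t (indicator B) y \<partial>?\<pi>) = pdmp.killed 0 (pdmp.transition_op t (indicator B)) (0, lam0)"
        by (rule pdmp.nn_integral_cycle_measure) measurable
      also have "\<dots> = pdmp.killed 0 (indicator B) (0, lam0)"
        using t by (intro pdmp.killed_transition_op) (auto simp: indicator_def)
      finally show "(\<integral>\<^sup>+y. pdmp.transition_op t (indicator B) y \<partial>?\<pi>) = emeasure ?\<pi> B"
        by (simp add: pdmp.emeasure_cycle_measure[OF B])
    qed (rule sets)
    fix \<nu> :: "state measure" assume "sigma_finite_measure \<nu> \<and> invariant S M Y \<nu>"
    then have \<nu>: "sigma_finite_measure \<nu>" "sets \<nu> = sets S"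
      and inv: "\<And>t B. 0 \<le> t \<Longrightarrow> B \<in> sets S \<Longrightarrow>
        (\<integral>\<^sup>+y. pdmp.transition_op t (indicator B) y \<partial>\<nu>) = emeasure \<nu> B"
      unfolding invariant_iff by auto
    show "\<exists>c<\<infinity>. \<nu> = scale_measure c ?\<pi>"
      by (rule pdmp.invariant_eq_scale) (use \<nu> inv in \<open>auto simp: S_def\<close>)
  qed (use pdmp.sigma_finite_cycle_measure space_pos in auto)
  moreover have "finite_measure ?\<pi> \<longleftrightarrow> (\<integral>\<^sup>+\<omega>. T (0, lam0) \<omega> \<partial>M) < \<infinity>"
    unfolding T_int sets_eq_imp_space_eq[OF sets, symmetric]
    by (auto intro: finite_measureI simp: finite_measure.emeasure_finite top.not_eq_extremum[symmetric])
  ultimately show ?thesis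
    using sets formula by (intro conjI exI[of _ ?\<pi>]) auto
qed

end
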